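(* Let $M$ be an indecomposable symmetrizable generalized intersection matrix of size $n\times n$, $n\ge3$, which is positive definite or semi-positive definite. Then $M$ is braid-equivalent to the intersection matrix determined by one of the modified Dynkin diagrams $A_l(r)$, $B_l(r,s)$, $C_l(r,s)$, $D_l(r)$, $E_6(r)$, $E_7(r)$, $E_8(r)$, $F_4(r,s)$, $G_2(r,s)$, $A_1(r,s)$, $BC_l(r,s,t)$, for some positive integers $l$, $r,s,t$ (as applicable).
   Context: Generalized intersection matrix (GIM): an $n\times n$ integer matrix $M=(m_{ij})$ with $m_{ii}=2$ and, for $i\neq j$, $m_{ij}<0$ iff $m_{ji}<0$, and $m_{ij}>0$ iff $m_{ji}>0$. $M$ is symmetrizable if there is a non-degenerate diagonal matrix $S$ such that $SM$ is symmetric; it is positive definite (resp. semi-positive definite) if $S$ can be chosen with positive diagonal entries such that $SM$ is symmetric positive definite (resp. positive semi-definite). $M$ is indecomposable if the index set cannot be partitioned into two non-empty subsets $I,J$ with $m_{ij}=m_{ji}=0$ for all $i\in I,j\in J$. Prime root system of $M$: a linearly independent set $\Pi=\{\alpha_1,\dots,\alpha_n\}$ in a complex vector space $V$ of dimension $2n-\operatorname{rank}(M)$ with a non-degenerate symmetric bilinear form $(\cdot,\cdot)$ such that $\frac{2(\alpha_i,\alpha_j)}{(\alpha_i,\alpha_i)}=m_{ij}$ for all $i,j$, normalized so that $(\alpha_i,\alpha_i)>0$ for all $i$. For $v\in V$ with $(v,v)\ne 0$, let $\rho_v(\lambda)=\lambda-\frac{2(\lambda,v)}{(v,v)}v$.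 Braid-equivalence: $\Pi\sim\Pi'$ if $\Pi'$ is obtained from $\Pi$ by a finite sequence of transformations $\Pi_k\mapsto\Pi_{k+1}=(\Pi_k\setminus\{\beta\})\cup\{\rho_\alpha(\beta)\}$ with $\alpha,\beta\in\Pi_k$ ($\alpha=\beta$ is allowed, giving $\beta\mapsto-\beta$). Two GIMs $M$ and $N$ are braid-equivalent if they have prime root systems $\Pi$ and $\Pi'$, respectively (in the same space $V$ with the same form), with $\Pi\sim\Pi'$. Modified Dynkin diagrams: each is an ordinary (finite or affine) Dynkin diagram in which some nodes carry a positive integer, the number of copies of the corresponding simple root; unmarked nodes have one copy. Nodes, edges and arrows have the usual meaning, with arrows pointing to the shorter root. The associated intersection matrix is obtained from the Cartan matrix $(a_{pq})$ of the underlying diagram, $a_{pq}=2(\gamma_p,\gamma_q)/(\gamma_p,\gamma_p)$ with $\gamma_p$ the simple roots, by replacing each node $p$ by its copies: the entry for a copy of $p$ and a copy of $q$ is $a_{pq}$. In particular two copies of the same node have entry $2$, i.e. their inner product equals the common square length. The diagrams are (nodes numbered, markings indicated): - $A_l(r)$, $l\ge1$: chain $1-2-\cdots-l$; node $1$ has $r$ copies. - $B_l(r,s)$, $l\ge2$: chain $1-2-\cdots-(l-1)\Rightarrow l$ (node $l$ short); node $1$ has $r$ copies, node $l$ has $s$ copies. For instance, its roots are $\alpha_{1,i}$ ($1\le i\le r$), $\alpha_2,\dots,\alpha_{l-1}$, $\alpha_{l,j}$ ($1\le j\le s$), and (for $l\ge3$) the matrix has size $(r+s+l-2)\times(r+s+l-2)$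 with $(\alpha_{1,i},\alpha_{1,k})=2$, $(\alpha_p,\alpha_p)=2$, $(\alpha_{l,t},\alpha_{l,j})=1$, all adjacent pairs having inner product $-1$, and other pairs orthogonal. - $C_l(r,s)$, $l\ge2$: chain $1\Rightarrow2-3-\cdots-l$ (node $1$ long, the others short); node $1$ has $r$ copies, node $l$ has $s$ copies. - $D_l(r)$, $l\ge4$: chain $1-2-\cdots-(l-2)$ with both nodes $l-1$ and $l$ joined to node $l-2$; node $1$ has $r$ copies. - $E_l(r)$, $l=6,7,8$: chain $1-3-4-5-6-\cdots-l$ with node $2$ joined to node $4$; node $1$ has $r$ copies. - $F_4(r,s)$: $1-2\Rightarrow3-4$; node $1$ has $r$ copies, node $4$ has $s$ copies. - $G_2(r,s)$: nodes $1$ (long) and $2$ (short) joined by a triple edge, with $a_{12}=-1$, $a_{21}=-3$; node $1$ has $r$ copies, node $2$ has $s$ copies. - $A_1(r,s)$: nodes $1$ (long) and $2$ (short) joined by a quadruple edge, with $a_{12}=-1$, $a_{21}=-4$ (type $A_2^{(2)}$); node $1$ has $r$ copies, node $2$ has $s$ copies. - $BC_l(r,s,t)$, $l\ge2$: chain $1\Rightarrow2-3-\cdots-l\Rightarrow(l+1)$ on $l+1$ nodes (type $A_{2l}^{(2)}$; for $l=2$ it is $1\Rightarrow2\Rightarrow3$); node $1$ has $r$ copies, node $2$ has $s$ copies, node $l+1$ has $t$ copies. *)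

theory Defs
  imports
    "HOL.Complex"
    "Jordan_Normal_Form.DL_Rank"
begin

definition gim :: "nat \<Rightarrow> int mat \<Rightarrow> bool" where
  "gim n M \<longleftrightarrow> M \<in> carrier_mat n n \<and>
     (\<forall>i<n. M $$ (i, i) = 2) \<and>
     (\<forall>i<n. \<forall>j<n. i \<noteq> j \<longrightarrow>
        (M $$ (i, j) < 0 \<longleftrightarrow> M $$ (j, i) < 0) \<and> (M $$ (i, j) > 0 \<longleftrightarrow> M $$ (j, i) > 0))"

definition symmetrizes :: "nat \<Rightarrow> real mat \<Rightarrow> int mat \<Rightarrow> bool" where
  "symmetrizes n S M \<longleftrightarrow> S \<in> carrier_mat n n \<and> diagonal_mat S \<and>
     transpose_mat (S * map_mat real_of_int M) = S * map_mat real_of_int M"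

definition symmetrizable :: "nat \<Rightarrow> int mat \<Rightarrow> bool" where
  "symmetrizable n M \<longleftrightarrow> (\<exists>S. symmetrizes n S M \<and> invertible_mat S)"

definition gim_positive_definite :: "nat \<Rightarrow> int mat \<Rightarrow> bool" where
  "gim_positive_definite n M \<longleftrightarrow> (\<exists>S. symmetrizes n S M \<and> (\<forall>i<n. S $$ (i, i) > 0) \<and>
     (\<forall>x\<in>carrier_vec n. x \<noteq> 0\<^sub>v n \<longrightarrow> x \<bullet> ((S * map_mat real_of_int M) *\<^sub>v x) > 0))"

definition gim_positive_semidefinite :: "nat \<Rightarrow> int mat \<Rightarrow> bool" where
  "gim_positive_semidefinite n M \<longleftrightarrow> (\<exists>S. symmetrizes n S M \<and> (\<forall>i<n. S $$ (i, i) > 0) \<and>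
     (\<forall>x\<in>carrier_vec n. x \<bullet> ((S * map_mat real_of_int M) *\<^sub>v x) \<ge> 0))"

definition indecomposable :: "nat \<Rightarrow> int mat \<Rightarrow> bool" where
  "indecomposable n M \<longleftrightarrow>
     \<not> (\<exists>I J. I \<noteq> {} \<and> J \<noteq> {} \<and> I \<inter> J = {} \<and> I \<union> J = {..<n} \<and>
          (\<forall>i\<in>I. \<forall>j\<in>J. M $$ (i, j) = 0 \<and> M $$ (j, i) = 0))"

text \<open>Linearity in the second argument follows from symmetry.\<close>

definition nondeg_symm_bilinear_form ::
  "(complex, 'v, 'm) module_scheme \<Rightarrow> ('v \<Rightarrow> 'v \<Rightarrow> complex) \<Rightarrow> bool" where
  "nondeg_symm_bilinear_form V form \<longleftrightarrow>
     (\<forall>x\<in>carrier V. \<forall>y\<in>carrier V. form x y = form y x) \<and>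
     (\<forall>x\<in>carrier V. \<forall>y\<in>carrier V. \<forall>z\<in>carrier V. form (x \<oplus>\<^bsub>V\<^esub> y) z = form x z + form y z) \<and>
     (\<forall>c. \<forall>x\<in>carrier V. \<forall>y\<in>carrier V. form (c \<odot>\<^bsub>V\<^esub> x) y = c * form x y) \<and>
     (\<forall>x\<in>carrier V. (\<forall>y\<in>carrier V. form x y = 0) \<longrightarrow> x = \<zero>\<^bsub>V\<^esub>)"

definition reflection ::
  "(complex, 'v, 'm) module_scheme \<Rightarrow> ('v \<Rightarrow> 'v \<Rightarrow> complex) \<Rightarrow> 'v \<Rightarrow> 'v \<Rightarrow> 'v" where
  "reflection V form v x = x \<ominus>\<^bsub>V\<^esub> (2 * form x v / form v v) \<odot>\<^bsub>V\<^esub> v"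

definition prime_root_system ::
  "(complex, 'v, 'm) module_scheme \<Rightarrow> ('v \<Rightarrow> 'v \<Rightarrow> complex) \<Rightarrow> int mat \<Rightarrow> 'v set \<Rightarrow> bool" where
  "prime_root_system V form M R \<longleftrightarrow>
     vectorspace class_ring V \<and> vectorspace.fin_dim class_ring V \<and>
     vectorspace.dim class_ring V
       = 2 * dim_row M - vec_space.rank (dim_row M) (map_mat complex_of_int M) \<and>
     nondeg_symm_bilinear_form V form \<and>
     R \<subseteq> carrier V \<and> \<not> module.lin_dep class_ring V R \<and>
     (\<exists>\<alpha>. bij_betw \<alpha> {..<dim_row M} R \<and>
        (\<forall>i<dim_row M. form (\<alpha> i) (\<alpha> i) \<in> \<real> \<and> Re (form (\<alpha> i) (\<alpha> i)) > 0) \<and>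
        (\<forall>i<dim_row M. \<forall>j<dim_row M.
           2 * form (\<alpha> i) (\<alpha> j) / form (\<alpha> i) (\<alpha> i) = of_int (M $$ (i, j))))"

inductive braid_step ::
  "(complex, 'v, 'm) module_scheme \<Rightarrow> ('v \<Rightarrow> 'v \<Rightarrow> complex) \<Rightarrow> 'v set \<Rightarrow> 'v set \<Rightarrow> bool"
  for V form where
  "\<alpha> \<in> R \<Longrightarrow> \<beta> \<in> R \<Longrightarrow> form \<alpha> \<alpha> \<noteq> 0 \<Longrightarrow>
     braid_step V form R ((R - {\<beta>}) \<union> {reflection V form \<alpha> \<beta>})"

text \<open>Every finite-dimensional complex vector space is isomorphic to one carried by a set of
  complex vectors, so fixing the carrier type of \<open>V\<close> loses no generality.\<close>

definition braid_equivalent :: "int mat \<Rightarrow> int mat \<Rightarrow> bool" where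
  "braid_equivalent M N \<longleftrightarrow>
     (\<exists>(V :: (complex, complex vec) module) form R R'.
        prime_root_system V form M R \<and> prime_root_system V form N R' \<and>
        (braid_step V form)\<^sup>*\<^sup>* R R')"

text \<open>A diagram has nodes \<open>1, \<dots>, k\<close>. A bond \<open>((p, q), m)\<close> is an \<open>m\<close>-fold edge between \<open>p\<close> and \<open>q\<close>
  whose arrow, if \<open>m > 1\<close>, points from the longer root \<open>p\<close> to the shorter root \<open>q\<close>. Each pair of
  adjacent nodes is listed in one orientation only. Node \<open>p\<close> has \<open>copies p\<close> copies.\<close>

datatype modified_diagram =
  Diagram (nodes: nat) (bonds: "((nat \<times> nat) \<times> nat) list") (copies: "nat \<Rightarrow> nat")

text \<open>As \<open>a\<^sub>p\<^sub>q = 2(\<gamma>\<^sub>p,\<gamma>\<^sub>q)/(\<gamma>\<^sub>p,\<gamma>\<^sub>p)\<close> is normalized by the length of \<open>\<gamma>\<^sub>p\<close>, an \<open>m\<close>-fold edge with \<open>p\<close> long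
  and \<open>q\<close> short gives \<open>a\<^sub>p\<^sub>q = -1\<close> and \<open>a\<^sub>q\<^sub>p = -m\<close>.\<close>

definition cartan_entry :: "modified_diagram \<Rightarrow> nat \<Rightarrow> nat \<Rightarrow> int" where
  "cartan_entry D p q =
     (if p = q then 2
      else case map_of (bonds D) (q, p) of
        Some m \<Rightarrow> - int m
      | None \<Rightarrow> (case map_of (bonds D) (p, q) of Some m \<Rightarrow> -1 | None \<Rightarrow> 0))"

text \<open>The copies are listed as \<open>1, \<dots>, 1, 2, \<dots>, 2, \<dots>, k, \<dots>, k\<close>.\<close>

definition copy_list :: "modified_diagram \<Rightarrow> nat list" where
  "copy_list D = concat (map (\<lambda>p. replicate (copies D p) p) [1..<nodes D + 1])"

definition intersection_matrix :: "modified_diagram \<Rightarrow> int mat" where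
  "intersection_matrix D =
     mat (length (copy_list D)) (length (copy_list D))
       (\<lambda>(i, j). cartan_entry D (copy_list D ! i) (copy_list D ! j))"

definition chain :: "nat \<Rightarrow> nat \<Rightarrow> ((nat \<times> nat) \<times> nat) list" where
  "chain a b = map (\<lambda>p. ((p, p + 1), 1)) [a..<b]"

definition diagram_A :: "nat \<Rightarrow> nat \<Rightarrow> modified_diagram" where
  "diagram_A l r = Diagram l (chain 1 l) ((\<lambda>_. 1)(1 := r))"

definition diagram_B :: "nat \<Rightarrow> nat \<Rightarrow> nat \<Rightarrow> modified_diagram" where
  "diagram_B l r s =
     Diagram l (chain 1 (l - 1) @ [((l - 1, l), 2)]) ((\<lambda>_. 1)(1 := r, l := s))"

definition diagram_C :: "nat \<Rightarrow> nat \<Rightarrow> nat \<Rightarrow> modified_diagram" where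
  "diagram_C l r s = Diagram l (((1, 2), 2) # chain 2 l) ((\<lambda>_. 1)(1 := r, l := s))"

definition diagram_D :: "nat \<Rightarrow> nat \<Rightarrow> modified_diagram" where
  "diagram_D l r =
     Diagram l (chain 1 (l - 2) @ [((l - 2, l - 1), 1), ((l - 2, l), 1)]) ((\<lambda>_. 1)(1 := r))"

definition diagram_E :: "nat \<Rightarrow> nat \<Rightarrow> modified_diagram" where
  "diagram_E l r = Diagram l ([((1, 3), 1), ((2, 4), 1)] @ chain 3 l) ((\<lambda>_. 1)(1 := r))"

definition diagram_F4 :: "nat \<Rightarrow> nat \<Rightarrow> modified_diagram" where
  "diagram_F4 r s =
     Diagram 4 [((1, 2), 1), ((2, 3), 2), ((3, 4), 1)] ((\<lambda>_. 1)(1 := r, 4 := s))"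

definition diagram_G2 :: "nat \<Rightarrow> nat \<Rightarrow> modified_diagram" where
  "diagram_G2 r s = Diagram 2 [((1, 2), 3)] ((\<lambda>_. 1)(1 := r, 2 := s))"

definition diagram_A1 :: "nat \<Rightarrow> nat \<Rightarrow> modified_diagram" where
  "diagram_A1 r s = Diagram 2 [((1, 2), 4)] ((\<lambda>_. 1)(1 := r, 2 := s))"

definition diagram_BC :: "nat \<Rightarrow> nat \<Rightarrow> nat \<Rightarrow> nat \<Rightarrow> modified_diagram" where
  "diagram_BC l r s t =
     Diagram (l + 1) (((1, 2), 2) # chain 2 l @ [((l, l + 1), 2)])
       ((\<lambda>_. 1)(1 := r, 2 := s, l + 1 := t))"

inductive modified_dynkin :: "modified_diagram \<Rightarrow> bool" where
  A: "l \<ge> 1 \<Longrightarrow> r \<ge> 1 \<Longrightarrow> modified_dynkin (diagram_A l r)"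
| B: "l \<ge> 2 \<Longrightarrow> r \<ge> 1 \<Longrightarrow> s \<ge> 1 \<Longrightarrow> modified_dynkin (diagram_B l r s)"
| C: "l \<ge> 2 \<Longrightarrow> r \<ge> 1 \<Longrightarrow> s \<ge> 1 \<Longrightarrow> modified_dynkin (diagram_C l r s)"
| D: "l \<ge> 4 \<Longrightarrow> r \<ge> 1 \<Longrightarrow> modified_dynkin (diagram_D l r)"
| E: "l \<in> {6, 7, 8} \<Longrightarrow> r \<ge> 1 \<Longrightarrow> modified_dynkin (diagram_E l r)"
| F4: "r \<ge> 1 \<Longrightarrow> s \<ge> 1 \<Longrightarrow> modified_dynkin (diagram_F4 r s)"
| G2: "r \<ge> 1 \<Longrightarrow> s \<ge> 1 \<Longrightarrow> modified_dynkin (diagram_G2 r s)"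
| A1: "r \<ge> 1 \<Longrightarrow> s \<ge> 1 \<Longrightarrow> modified_dynkin (diagram_A1 r s)"
| BC: "l \<ge> 2 \<Longrightarrow> r \<ge> 1 \<Longrightarrow> s \<ge> 1 \<Longrightarrow> t \<ge> 1 \<Longrightarrow> modified_dynkin (diagram_BC l r s t)"

end

theory Submission
  imports Defs "Jordan_Normal_Form.Matrix_Kernel" "HOL-Library.Function_Algebras"
begin

text \<open>
  Modulo the radical of the form, the rows of \<open>M\<close> are roots spanning a Euclidean space, and the
  moves are reflections of one member of a family of roots in another one. Choose a linear height
  that takes nonzero integer values on all roots and, among all families reachable from the given
  one, take one that minimizes the sum of the absolute heights; flip signs to make all heights
  positive. Two members at an acute angle could be replaced by a family of smaller weight, unless
  they are proportional. So distinct directions form obtuse angles, and as they lie on one side of a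
  hyperplane they form a simple system, whose Dynkin diagram is of finite type. The classification
  is by removing a leaf, the excluded diagrams being those that carry a nonnegative subharmonic
  function. The surplus members are proportional to simple roots with factor 1 or 2. Reflections in
  the simple roots move those with factor 1 to one designated simple root of their length. Factor
  2 forces type \<open>B\<close>, and then the longest roots are moved to the extra node of the diagram \<open>BC\<close>.

  Since only the Gram matrix matters, the moves lift to the linearly independent roots of a prime
  root system; its ambient space is \<open>\<complex>\<^sup>n\<close> extended by a dual of the radical.
\<close>

section \<open>Dynkin diagrams of finite type\<close>

text \<open>The Cartan integers \<open>x\<close>, \<open>y\<close> of two roots at an acute angle
  satisfy 1 \<le> x y \<le> 4. If x y \<le> 3, one of them is 1, and one of the two reflections
  lowers the weight. If x y = 4, the Cauchy-Schwarz inequality is an equality, and the roots are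
  proportional with factor 1/2, 1 or 2; this is the origin of the factors 1 and 2. If the double of
  a simple root is a root, all off-diagonal entries in the row of the simple root are even, which
  happens only in rank one and at the short end of \<open>B\<close>. The obstacle is the radical.
  Modulo it several members may coincide, yet all \<open>n\<close> of them must survive. So the
  family stays indexed by its positions, the base is a set of positions, and equality of vectors is
  weakened to equality of all inner products. The radical also determines the dimension of the
  ambient space, which has to be right for both matrices at once; hence the ranks are compared at
  the end.\<close>

definition subharmonic_free :: "'i set \<Rightarrow> ('i \<Rightarrow> 'i \<Rightarrow> int) \<Rightarrow> bool" where
  "subharmonic_free K a \<longleftrightarrow> (\<forall>c :: 'i \<Rightarrow> real. (\<forall>i\<in>K. c i \<ge> 0) \<longrightarrow> (\<exists>i\<in>K. c i > 0) \<longrightarrow>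
     (\<exists>i\<in>K. c i > 0 \<and> (\<Sum>j\<in>K. of_int (a i j) * c j) > 0))"

text \<open>Given the other conditions, \<open>subharmonic_free\<close> is equivalent to positive
  definiteness of the symmetrized matrix. In this form it passes to subsets by extending weights by
  zero, and a violation is certified by one weight per node.\<close>

definition dynkin :: "'i set \<Rightarrow> ('i \<Rightarrow> 'i \<Rightarrow> int) \<Rightarrow> bool" where
  "dynkin K a \<longleftrightarrow> finite K \<and> (\<forall>i\<in>K. a i i = 2) \<and>
     (\<forall>i\<in>K. \<forall>j\<in>K. i \<noteq> j \<longrightarrow> a i j \<le> 0 \<and> (a i j = 0 \<longleftrightarrow> a j i = 0)) \<and>
     (\<exists>d :: 'i \<Rightarrow> real. \<forall>i\<in>K. d i > 0 \<and> (\<forall>j\<in>K. d i * a i j = d j * a j i)) \<and>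
     subharmonic_free K a"

definition linked :: "'i set \<Rightarrow> ('i \<Rightarrow> 'i \<Rightarrow> int) \<Rightarrow> bool" where
  "linked K a \<longleftrightarrow> (\<forall>A. A \<subseteq> K \<longrightarrow> A \<noteq> {} \<longrightarrow> A \<noteq> K \<longrightarrow> (\<exists>i\<in>A. \<exists>j\<in>K - A. a i j \<noteq> 0))"

lemma dynkin_finite: "dynkin K a \<Longrightarrow> finite K"
  and dynkin_diag: "dynkin K a \<Longrightarrow> i \<in> K \<Longrightarrow> a i i = 2"
  and dynkin_nonpos: "dynkin K a \<Longrightarrow> i \<in> K \<Longrightarrow> j \<in> K \<Longrightarrow> i \<noteq> j \<Longrightarrow> a i j \<le> 0"
  and dynkin_zero: "dynkin K a \<Longrightarrow> i \<in> K \<Longrightarrow> j \<in> K \<Longrightarrow> a i j = 0 \<longleftrightarrow> a j i = 0"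
  by (auto simp: dynkin_def)

lemma subharmonic_freeD:
  "subharmonic_free K a \<Longrightarrow> (\<And>i. i \<in> K \<Longrightarrow> (c i :: real) \<ge> 0) \<Longrightarrow> i \<in> K \<Longrightarrow> c i > 0 \<Longrightarrow>
     \<exists>i\<in>K. c i > 0 \<and> (\<Sum>j\<in>K. of_int (a i j) * c j) > 0"
  unfolding subharmonic_free_def by blast

lemma dynkin_subset:
  assumes d: "dynkin K a" and L: "L \<subseteq> K"
  shows "dynkin L a"
proof -
  have fin: "finite K" using d by (rule dynkin_finite)
  have "subharmonic_free L a"
    unfolding subharmonic_free_def
  proof (intro allI impI)
    fix c :: "'a \<Rightarrow> real"
    assume nn: "\<forall>i\<in>L. c i \<ge> 0" and "\<exists>i\<in>L. c i > 0"
    then obtain i where i: "i \<in> L" "c i > 0" by blast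
    let ?c = "\<lambda>i. if i \<in> L then c i else 0"
    have "subharmonic_free K a" using d by (simp add: dynkin_def)
    have "\<exists>i\<in>K. ?c i > 0 \<and> (\<Sum>j\<in>K. of_int (a i j) * ?c j) > 0"
      by (rule subharmonic_freeD[OF \<open>subharmonic_free K a\<close>, of ?c i]) (use nn i L in auto)
    then obtain k where
      k: "k \<in> K" "?c k > 0" "(\<Sum>j\<in>K. of_int (a k j) * ?c j) > 0" by blast
    have kL: "k \<in> L" "c k > 0" using k(2) by (auto split: if_splits)
    have "(\<Sum>j\<in>K. of_int (a k j) * ?c j) = (\<Sum>j\<in>L. of_int (a k j) * ?c j)"
      using fin L by (intro sum.mono_neutral_right) auto
    also have "\<dots> = (\<Sum>j\<in>L. of_int (a k j) * c j)" by simp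
    finally show "\<exists>i\<in>L. c i > 0 \<and> (\<Sum>j\<in>L. of_int (a i j) * c j) > 0"
      using k(3) kL by auto
  qed
  moreover from d obtain D :: "'a \<Rightarrow> real"
    where "\<forall>i\<in>K. D i > 0 \<and> (\<forall>j\<in>K. D i * a i j = D j * a j i)"
    unfolding dynkin_def by blast
  then have "\<exists>D :: 'a \<Rightarrow> real. \<forall>i\<in>L. D i > 0 \<and> (\<forall>j\<in>L. D i * a i j = D j * a j i)"
    using L by (intro exI[of _ D]) blast
  moreover have "\<forall>i\<in>L. \<forall>j\<in>L. i \<noteq> j \<longrightarrow> a i j \<le> 0 \<and> (a i j = 0 \<longleftrightarrow> a j i = 0)"
    using dynkin_nonpos[OF d] dynkin_zero[OF d] L by (meson subsetD)
  ultimately show ?thesis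
    using dynkin_diag[OF d] L finite_subset[OF L fin] unfolding dynkin_def by blast
qed

lemma dynkin_reindex:
  assumes d: "dynkin K a" and g: "bij_betw g L K"
  shows "dynkin L (\<lambda>i j. a (g i) (g j))"
proof -
  have gK: "\<And>i. i \<in> L \<Longrightarrow> g i \<in> K" using g by (auto simp: bij_betw_def)
  have inj: "inj_on g L" and im: "g ` L = K" using g by (auto simp: bij_betw_def)
  have neq: "\<And>i j. i \<in> L \<Longrightarrow> j \<in> L \<Longrightarrow> i \<noteq> j \<Longrightarrow> g i \<noteq> g j" using inj by (auto simp: inj_on_def)
  have fin: "finite L" using d g bij_betw_finite dynkin_finite by blast
  have "subharmonic_free L (\<lambda>i j. a (g i) (g j))"
    unfolding subharmonic_free_def
  proof (intro allI impI)
    fix c :: "'b \<Rightarrow> real"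
    assume nn: "\<forall>i\<in>L. c i \<ge> 0" and "\<exists>i\<in>L. c i > 0"
    then obtain i where i: "i \<in> L" "c i > 0" by blast
    let ?h = "inv_into L g"
    have h: "\<And>k. k \<in> K \<Longrightarrow> ?h k \<in> L" "\<And>i. i \<in> L \<Longrightarrow> ?h (g i) = i"
      using im inj by (auto simp: inv_into_into)
    have "subharmonic_free K a" using d by (simp add: dynkin_def)
    have "\<exists>k\<in>K. c (?h k) > 0 \<and> (\<Sum>j\<in>K. of_int (a k j) * c (?h j)) > 0"
      by (rule subharmonic_freeD[OF \<open>subharmonic_free K a\<close>, of "\<lambda>k. c (?h k)" "g i"])
        (use nn i gK h in auto)
    then obtain k where
      k: "k \<in> K" "c (?h k) > 0" "(\<Sum>j\<in>K. of_int (a k j) * c (?h j)) > 0" by blast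
    have "(\<Sum>j\<in>K. of_int (a k j) * c (?h j)) = (\<Sum>j\<in>L. of_int (a k (g j)) * c (?h (g j)))"
      using sum.reindex_bij_betw[OF g, of "\<lambda>j. of_int (a k j) * c (?h j)"] by simp
    also have "\<dots> = (\<Sum>j\<in>L. of_int (a (g (?h k)) (g j)) * c j)"
      using h k(1) im by (intro sum.cong) (auto simp: f_inv_into_f)
    finally show "\<exists>i\<in>L. c i > 0 \<and> (\<Sum>j\<in>L. of_int (a (g i) (g j)) * c j) > 0"
      using k h by auto
  qed
  moreover from d obtain D :: "'a \<Rightarrow> real"
    where "\<forall>i\<in>K. D i > 0 \<and> (\<forall>j\<in>K. D i * a i j = D j * a j i)"
    unfolding dynkin_def by blast
  then have "\<exists>D :: 'b \<Rightarrow> real. \<forall>i\<in>L. D i > 0 \<and>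
     (\<forall>j\<in>L. D i * a (g i) (g j) = D j * a (g j) (g i))"
    using gK by (intro exI[of _ "D \<circ> g"]) auto
  ultimately show ?thesis
    using d gK fin neq unfolding dynkin_def by auto
qed

section \<open>Exclusion of diagrams by weights, and existence of leaves\<close>

lemma no_subharmonic:
  assumes d: "dynkin K a" and S: "S \<subseteq> K" "S \<noteq> {}"
    and pos: "\<And>i. i \<in> S \<Longrightarrow> c i > (0 :: int)"
    and sub: "\<And>i. i \<in> S \<Longrightarrow> T i \<subseteq> S - {i} \<and> 2 * c i \<le> (\<Sum>t\<in>T i. - a i t * c t)"
  shows False
proof -
  have dS: "dynkin S a" using dynkin_subset[OF d S(1)] .
  have fin: "finite S" using dS by (rule dynkin_finite)
  obtain i0 where i0: "i0 \<in> S" using S by blast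
  have "subharmonic_free S a" using dS by (simp add: dynkin_def)
  from subharmonic_freeD[OF this, of "\<lambda>i. of_int (c i)" i0] pos i0
  obtain i where i: "i \<in> S" "(\<Sum>j\<in>S. of_int (a i j) * (of_int (c j) :: real)) > 0"
    by (force simp: less_imp_le)
  have "(\<Sum>j\<in>S. of_int (a i j) * (of_int (c j) :: real)) = of_int (\<Sum>j\<in>S. a i j * c j)" by simp
  then have p: "(\<Sum>j\<in>S. a i j * c j) > 0" using i(2) by linarith
  have T: "T i \<subseteq> S - {i}" "2 * c i \<le> (\<Sum>t\<in>T i. - a i t * c t)" using sub[OF i(1)] by auto
  \<comment> \<open>Members of \<open>S\<close> outside \<open>T i\<close> only help the inequality,
    so it is enough to know some neighbours of \<open>i\<close> and lower bounds for their
    bonds.\<close>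
  have nn: "\<And>t. t \<in> S - {i} \<Longrightarrow> - a i t * c t \<ge> 0"
    using dynkin_nonpos[OF dS i(1)] pos by (metis DiffD1 DiffD2 neg_0_le_iff_le insertI1
      mult_nonneg_nonneg less_imp_le)
  have "(\<Sum>t\<in>T i. - a i t * c t) \<le> (\<Sum>t\<in>S - {i}. - a i t * c t)"
    using T(1) fin nn by (intro sum_mono2) auto
  moreover have "(\<Sum>j\<in>S. a i j * c j) = a i i * c i + (\<Sum>j\<in>S - {i}. a i j * c j)"
    using fin i(1) by (rule sum.remove)
  ultimately show False using p T(2) dynkin_diag[OF dS i(1)] by (simp add: sum_negf)
qed

text \<open>This compares twice the weight 2 of \<open>u\<close> with its neighbours. A member of
  \<open>P\<close> has weight 2; a neighbour \<open>t\<close> outside \<open>P\<close> has weight at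
  least - a t u and so contributes at least a u t * a t u.\<close>

definition heavy_at :: "'i set \<Rightarrow> ('i \<Rightarrow> 'i \<Rightarrow> int) \<Rightarrow> 'i set \<Rightarrow> 'i \<Rightarrow> bool" where
  "heavy_at K a P u \<longleftrightarrow> (\<exists>S T. S \<subseteq> P - {u} \<and> T \<subseteq> K - P \<and>
     4 \<le> 2 * (\<Sum>s\<in>S. - a u s) + (\<Sum>t\<in>T. a u t * a t u))"

lemma heavy_atI:
  "S \<subseteq> P - {u} \<Longrightarrow> T \<subseteq> K - P \<Longrightarrow> 4 \<le> 2 * (\<Sum>s\<in>S. - a u s) + (\<Sum>t\<in>T. a u t * a t u) \<Longrightarrow> heavy_at K a P u"
  unfolding heavy_at_def by blast

text \<open>The weights are 2 on \<open>P\<close> and \<open>-\<Sum>u\<in>P. a z u\<close> on the neighbours \<open>z\<close> of \<open>P\<close>. This excludes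
  cycles, nodes of valency four and pairs of forks or multiple bonds joined by a path.\<close>

lemma no_heavy_core:
  assumes d: "dynkin K a" and P: "P \<subseteq> K" "P \<noteq> {}"
    and heavy: "\<And>u. u \<in> P \<Longrightarrow> heavy_at K a P u"
  shows False
proof -
  have fin: "finite K" using d by (rule dynkin_finite)
  have finP: "finite P" using P fin by (auto intro: finite_subset)
  define c where "c z = (if z \<in> P then 2 else (\<Sum>u\<in>P. - a z u))" for z
  define N where "N = {z \<in> K - P. \<exists>u\<in>P. a z u \<noteq> 0}"
  have np: "a i j \<le> 0" if "i \<in> K" "j \<in> K" "i \<noteq> j" for i j using dynkin_nonpos[OF d that] .
  have cz: "c z \<ge> - a z u" if "z \<in> K - P" "u \<in> P" for z u
  proof -
    have nn: "- a z b \<ge> 0" if "b \<in> P" for b using np[of z b] that \<open>z \<in> K - P\<close> P by auto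
    have "- a z u = (\<Sum>u\<in>{u}. - a z u)" by simp
    also have "\<dots> \<le> (\<Sum>u\<in>P. - a z u)"
      using that finP nn by (intro sum_mono2) auto
    finally show ?thesis using that by (simp add: c_def)
  qed
  have "\<forall>i\<in>P \<union> N. \<exists>T\<subseteq>P \<union> N - {i}. 2 * c i \<le> (\<Sum>t\<in>T. - a i t * c t)"
  proof
    fix i assume i: "i \<in> P \<union> N"
    show "\<exists>T\<subseteq>P \<union> N - {i}. 2 * c i \<le> (\<Sum>t\<in>T. - a i t * c t)"
    proof (cases "i \<in> P")
      case True
      obtain S T where ST: "S \<subseteq> P - {i}" "T \<subseteq> K - P"
        "4 \<le> 2 * (\<Sum>s\<in>S. - a i s) + (\<Sum>t\<in>T. a i t * a t i)" using heavy[OF True] unfolding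
          heavy_at_def by blast
      define T' where "T' = {t \<in> T. a t i \<noteq> 0}"
      have finT: "finite T" "finite S" using ST fin finP by (auto intro: finite_subset)
      have T'N: "T' \<subseteq> N" "T' \<inter> P = {}" using ST True by (auto simp: T'_def N_def)
      have "(\<Sum>t\<in>T. a i t * a t i) = (\<Sum>t\<in>T'. a i t * a t i)"
        using finT by (intro sum.mono_neutral_right) (auto simp: T'_def)
      also have "\<dots> \<le> (\<Sum>t\<in>T'. - a i t * c t)"
      proof (rule sum_mono)
        fix t assume t: "t \<in> T'"
        then have tk: "t \<in> K - P" using ST by (auto simp: T'_def)
        have "- a i t \<ge> 0" using np[of i t] tk True P by auto
        from mult_left_mono[OF cz[OF tk True] this] show "a i t * a t i \<le> - a i t * c t" by simp
      qed
      moreover have "2 * (\<Sum>s\<in>S. - a i s) = (\<Sum>s\<in>S. - a i s * c s)"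
        unfolding sum_distrib_left using ST by (intro sum.cong) (auto simp: c_def)
      moreover have "(\<Sum>s\<in>S \<union> T'. - a i s * c s) = (\<Sum>s\<in>S. - a i s * c s) + (\<Sum>s\<in>T'. - a i s * c s)"
        using finT T'N ST by (intro sum.union_disjoint) (auto simp: T'_def)
      ultimately have "2 * c i \<le> (\<Sum>s\<in>S \<union> T'. - a i s * c s)"
        using ST(3) True by (simp add: c_def)
      then show ?thesis using ST T'N True by (intro exI[of _ "S \<union> T'"]) auto
    next
      case False
      \<comment> \<open>Outside \<open>P\<close> there is equality: the weight of a neighbour is
        half of what \<open>P\<close> contributes to its row.\<close>
      have "2 * c i = (\<Sum>t\<in>P. - a i t * c t)"
        using False by (auto simp: c_def sum_distrib_left intro!: sum.cong)
      then show ?thesis using False by (intro exI[of _ P]) auto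
    qed
  qed
  then obtain T where T: "\<And>i. i \<in> P \<union> N \<Longrightarrow> T i \<subseteq> P \<union> N - {i} \<and> 2 * c i \<le> (\<Sum>t\<in>T i. - a i t * c t)"
    by metis
  show False
  proof (rule no_subharmonic[OF d _ _ _ T])
    show "P \<union> N \<subseteq> K" "P \<union> N \<noteq> {}" using P by (auto simp: N_def)
  next
    fix i assume i: "i \<in> P \<union> N"
    show "c i > 0"
    proof (cases "i \<in> P")
      case False
      with i obtain u where u: "u \<in> P" "a i u \<noteq> 0" "i \<in> K - P" by (auto simp: N_def)
      then have "a i u < 0" using np[of i u] P by fastforce
      then show ?thesis using cz[OF u(3,1)] by simp
    qed (simp add: c_def)
  qed
qed

text \<open>A node with total bond multiplicity four would be a heavy core by itself.\<close>

lemma dynkin_valency: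
  assumes "dynkin K a" "u \<in> K" "T \<subseteq> K - {u}"
  shows "(\<Sum>t\<in>T. a u t * a t u) \<le> 3"
proof (rule ccontr)
  assume "\<not> ?thesis"
  then show False using assms
    by (intro no_heavy_core[of K a "{u}"]) (auto intro!: heavy_atI[of "{}" _ _ T])
qed

lemma dynkin_adjacent:
  assumes "dynkin K a" "i \<in> K" "j \<in> K" "i \<noteq> j" "a i j \<noteq> 0"
  shows "a i j \<le> -1 \<and> a j i \<le> -1"
  using assms dynkin_nonpos[of K a i j] dynkin_nonpos[of K a j i] dynkin_zero[of K a i j] by force

lemma linked_neighbour:
  assumes "linked K a" "i \<in> K" "K \<noteq> {i}"
  shows "\<exists>j\<in>K - {i}. a i j \<noteq> 0"
  using assms unfolding linked_def by (drule_tac x="{i}" in spec) auto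

text \<open>The test vector is the sum of the roots, scaled to a common length. At a node
  \<open>v\<close> where its row sum is positive, every neighbour subtracts at least
  \<open>c v\<close> from 2 \<open>c v\<close>, so there is room for only one.\<close>

lemma dynkin_leaf:
  assumes d: "dynkin K a" and l: "linked K a" and ne: "v0 \<in> K" "K \<noteq> {v0}"
  obtains v p where "v \<in> K" "p \<in> K" "p \<noteq> v" "a v p \<noteq> 0" "\<And>q. q \<in> K \<Longrightarrow> q \<noteq> v \<Longrightarrow> q \<noteq> p \<Longrightarrow> a v q = 0"
proof -
  have fin: "finite K" using d by (rule dynkin_finite)
  obtain D :: "'a \<Rightarrow> real" where D: "\<And>i. i \<in> K \<Longrightarrow> D i > 0"
    "\<And>i j. i \<in> K \<Longrightarrow> j \<in> K \<Longrightarrow> D i * a i j = D j * a j i"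
    using d unfolding dynkin_def by blast
  define c where "c i = 1 / sqrt (D i)" for i
  have cpos: "i \<in> K \<Longrightarrow> c i > 0" for i using D by (simp add: c_def)
  have "subharmonic_free K a" using d by (simp add: dynkin_def)
  from subharmonic_freeD[OF this, of c v0] ne cpos less_imp_le obtain v where
    v: "v \<in> K" "(\<Sum>j\<in>K. of_int (a v j) * c j) > 0" by metis
  have bound: "of_int (a v j) * c j \<le> - c v" if j: "j \<in> K" "j \<noteq> v" "a v j \<noteq> 0" for j
  proof -
    have ad: "a v j \<le> -1" "a j v \<le> -1" using dynkin_adjacent[OF d v(1) j(1)] j by auto
    have Dp: "D v > 0" "D j > 0" using D(1) v j by auto
    have "D j \<le> D j * (real_of_int (a j v) * real_of_int (a v j))"
    proof -
      have "(- a j v) * (- a v j) \<ge> 1 * 1" using ad by (intro mult_mono) auto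
      then have "real_of_int (a j v * a v j) \<ge> 1" by linarith
      then show ?thesis using Dp by simp
    qed
    also have "\<dots> = D v * (real_of_int (a v j))\<^sup>2" using D(2)[OF v(1) j(1)]
      by (simp add: power2_eq_square)
    finally have "sqrt (D j) \<le> sqrt (D v * (real_of_int (a v j))\<^sup>2)" by simp
    also have "\<dots> = sqrt (D v) * (- real_of_int (a v j))" using ad Dp
      by (simp add: real_sqrt_mult)
    finally show ?thesis using Dp by (simp add: c_def field_simps)
  qed
  obtain p where p: "p \<in> K - {v}" "a v p \<noteq> 0"
    using linked_neighbour[OF l v(1)] ne by fastforce
  have "a v q = 0" if q: "q \<in> K" "q \<noteq> v" "q \<noteq> p" for q
  proof (rule ccontr)
    assume nz: "a v q \<noteq> 0"
    have "(\<Sum>j\<in>K. of_int (a v j) * c j) = of_int (a v v) * c v + (\<Sum>j\<in>K - {v}. of_int (a v j) * c j)"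
      using fin v(1) by (rule sum.remove)
    also have "(\<Sum>j\<in>K - {v}. of_int (a v j) * c j) \<le> (\<Sum>j\<in>{p, q}. of_int (a v j) * c j)"
    proof -
      have "(\<Sum>j\<in>{p, q}. - (of_int (a v j) * c j)) \<le> (\<Sum>j\<in>K - {v}. - (of_int (a v j) * c j))"
        using fin p q v(1) dynkin_nonpos[OF d v(1)] cpos
        by (intro sum_mono2) (auto simp: mult_nonpos_nonneg less_imp_le)
      then show ?thesis unfolding sum_negf by linarith
    qed
    also have "(\<Sum>j\<in>{p, q}. of_int (a v j) * c j) \<le> - c v - c v"
      using bound[of p] bound[of q] p q nz by auto
    finally show False using v dynkin_diag[OF d v(1)] by simp
  qed
  then show thesis using that p v by auto
qed

text \<open>The leaf can be put on the side of its only neighbour \<open>p\<close> without creating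
  an entry across the cut, so a cut of the remaining nodes that nothing crosses would give one of
  \<open>K\<close>.\<close>

lemma linked_remove_leaf:
  assumes d: "dynkin K a" and l: "linked K a" and v: "v \<in> K"
    and leaf: "\<And>q. q \<in> K \<Longrightarrow> q \<noteq> v \<Longrightarrow> q \<noteq> p \<Longrightarrow> a v q = 0"
  shows "linked (K - {v}) a"
  unfolding linked_def
proof (intro allI impI)
  fix A assume A: "A \<subseteq> K - {v}" "A \<noteq> {}" "A \<noteq> K - {v}"
  have z: "a i v = 0" if "i \<in> K" "i \<noteq> v" "i \<noteq> p" for i
    using leaf[OF that] dynkin_zero[OF d that(1) v] by simp
  show "\<exists>i\<in>A. \<exists>j\<in>K - {v} - A. a i j \<noteq> 0"
  proof (cases "p \<in> A")
    case True
    have "insert v A \<subseteq> K" "insert v A \<noteq> {}" "insert v A \<noteq> K" using A v by auto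
    then obtain i j where ij: "i \<in> insert v A" "j \<in> K - insert v A" "a i j \<noteq> 0"
      using l unfolding linked_def by meson
    then have "i \<noteq> v" using leaf[of j] True by auto
    then show ?thesis using ij by auto
  next
    case False
    have "A \<subseteq> K" "A \<noteq> K" using A v by auto
    then obtain i j where ij: "i \<in> A" "j \<in> K - A" "a i j \<noteq> 0"
      using l A(2) unfolding linked_def by meson
    then have "j \<noteq> v" using z[of i] False A by auto
    then show ?thesis using ij by auto
  qed
qed

text \<open>Below, the weights are the marks of the affine diagrams.\<close>

lemma no_affine_E6:
  assumes d: "dynkin K a" and s: "{x, y1, y2, z1, z2, u1, u2} \<subseteq> K"
    "distinct [x, y1, y2, z1, z2, u1, u2]"
    and e: "a x y1 \<noteq> 0" "a y1 y2 \<noteq> 0" "a x z1 \<noteq> 0" "a z1 z2 \<noteq> 0" "a x u1 \<noteq> 0" "a u1 u2 \<noteq> 0"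
  shows False
proof -
  have ad: "a x y1 \<le> -1" "a y1 x \<le> -1" "a y1 y2 \<le> -1" "a y2 y1 \<le> -1"
    "a x z1 \<le> -1" "a z1 x \<le> -1" "a z1 z2 \<le> -1" "a z2 z1 \<le> -1"
    "a x u1 \<le> -1" "a u1 x \<le> -1" "a u1 u2 \<le> -1" "a u2 u1 \<le> -1"
    using dynkin_adjacent[OF d] s e by auto
  let ?S = "{x, y1, y2, z1, z2, u1, u2}"
    and ?c = "(\<lambda>_. 1)(x := 3, y1 := 2, z1 := 2, u1 := 2) :: 'a \<Rightarrow> int"
    and ?T = "(\<lambda>_. {})(x := {y1, z1, u1}, y1 := {x, y2}, y2 := {y1}, z1 := {x, z2}, z2 := {z1}, u1
      := {x, u2}, u2 := {u1})"
  have "\<forall>i\<in>?S. 0 < ?c i \<and> ?T i \<subseteq> ?S - {i} \<and> 2 * ?c i \<le> (\<Sum>t\<in>?T i. - a i t * ?c t)"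
    using s(2) ad by auto
  then show False by (intro no_subharmonic[OF d s(1), of ?c ?T]) blast+
qed

lemma no_affine_E7:
  assumes d: "dynkin K a" and s: "{x, y1, y2, y3, z1, z2, z3, u} \<subseteq> K"
    "distinct [x, y1, y2, y3, z1, z2, z3, u]"
    and e: "a x y1 \<noteq> 0" "a y1 y2 \<noteq> 0" "a y2 y3 \<noteq> 0" "a x z1 \<noteq> 0" "a z1 z2 \<noteq> 0" "a z2 z3 \<noteq> 0"
      "a x u \<noteq> 0"
  shows False
proof -
  have ad: "a x y1 \<le> -1" "a y1 x \<le> -1" "a y1 y2 \<le> -1" "a y2 y1 \<le> -1"
    "a y2 y3 \<le> -1" "a y3 y2 \<le> -1" "a x z1 \<le> -1" "a z1 x \<le> -1"
    "a z1 z2 \<le> -1" "a z2 z1 \<le> -1" "a z2 z3 \<le> -1" "a z3 z2 \<le> -1"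
    "a x u \<le> -1" "a u x \<le> -1"
    using dynkin_adjacent[OF d] s e by auto
  let ?S = "{x, y1, y2, y3, z1, z2, z3, u}"
    and ?c = "(\<lambda>_. 1)(x := 4, y1 := 3, y2 := 2, z1 := 3, z2 := 2, u := 2) :: 'a \<Rightarrow> int"
    and ?T = "(\<lambda>_. {})(x := {y1, z1, u}, y1 := {x, y2}, y2 := {y1, y3}, y3 := {y2}, z1 := {x, z2},
      z2 := {z1, z3}, z3 := {z2}, u := {x})"
  have "\<forall>i\<in>?S. 0 < ?c i \<and> ?T i \<subseteq> ?S - {i} \<and> 2 * ?c i \<le> (\<Sum>t\<in>?T i. - a i t * ?c t)"
    using s(2) ad by auto
  then show False by (intro no_subharmonic[OF d s(1), of ?c ?T]) blast+
qed

lemma no_affine_E8: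
  assumes d: "dynkin K a" and s: "{x, y1, y2, y3, y4, y5, z1, z2, u} \<subseteq> K"
      "distinct [x, y1, y2, y3, y4, y5, z1, z2, u]"
    and e: "a x y1 \<noteq> 0" "a y1 y2 \<noteq> 0" "a y2 y3 \<noteq> 0" "a y3 y4 \<noteq> 0" "a y4 y5 \<noteq> 0"
      "a x z1 \<noteq> 0" "a z1 z2 \<noteq> 0" "a x u \<noteq> 0"
  shows False
proof -
  have ad: "a x y1 \<le> -1" "a y1 x \<le> -1" "a y1 y2 \<le> -1" "a y2 y1 \<le> -1"
    "a y2 y3 \<le> -1" "a y3 y2 \<le> -1" "a y3 y4 \<le> -1" "a y4 y3 \<le> -1"
    "a y4 y5 \<le> -1" "a y5 y4 \<le> -1" "a x z1 \<le> -1" "a z1 x \<le> -1"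
    "a z1 z2 \<le> -1" "a z2 z1 \<le> -1" "a x u \<le> -1" "a u x \<le> -1"
    using dynkin_adjacent[OF d] s e by auto
  let ?S = "{x, y1, y2, y3, y4, y5, z1, z2, u}"
    and ?c = "(\<lambda>_. 1)(x := 6, y1 := 5, y2 := 4, y3 := 3, y4 := 2, z1 := 4, z2 := 2, u := 3) :: 'a
      \<Rightarrow> int"
    and ?T = "(\<lambda>_. {})(x := {y1, z1, u}, y1 := {x, y2}, y2 := {y1, y3}, y3 := {y2, y4}, y4 :=
      {y3, y5}, y5 := {y4}, z1 := {x, z2}, z2 := {z1}, u := {x})"
  have "\<forall>i\<in>?S. 0 < ?c i \<and> ?T i \<subseteq> ?S - {i} \<and> 2 * ?c i \<le> (\<Sum>t\<in>?T i. - a i t * ?c t)"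
    using s(2) ad by auto
  then show False by (intro no_subharmonic[OF d s(1), of ?c ?T]) blast+
qed

lemma no_affine_F4:
  assumes d: "dynkin K a" and s: "{x1, x2, x3, x4, x5} \<subseteq> K" "distinct [x1, x2, x3, x4, x5]"
    and e: "a x1 x2 \<noteq> 0" "a x2 x3 \<noteq> 0" "a x3 x4 \<noteq> 0" "a x4 x5 \<noteq> 0" and m: "a x4 x3 \<le> -2"
  shows False
proof -
  have ad: "a x1 x2 \<le> -1" "a x2 x1 \<le> -1" "a x2 x3 \<le> -1" "a x3 x2 \<le> -1"
    "a x3 x4 \<le> -1" "a x4 x3 \<le> -1" "a x4 x5 \<le> -1" "a x5 x4 \<le> -1"
    using dynkin_adjacent[OF d] s e by auto
  let ?S = "{x1, x2, x3, x4, x5}"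
    and ?c = "(\<lambda>_. 1)(x2 := 2, x3 := 3, x4 := 4, x5 := 2) :: 'a \<Rightarrow> int"
    and ?T = "(\<lambda>_. {})(x1 := {x2}, x2 := {x1, x3}, x3 := {x2, x4}, x4 := {x3, x5}, x5 := {x4})"
  have "\<forall>i\<in>?S. 0 < ?c i \<and> ?T i \<subseteq> ?S - {i} \<and> 2 * ?c i \<le> (\<Sum>t\<in>?T i. - a i t * ?c t)"
    using s(2) ad m by auto
  then show False by (intro no_subharmonic[OF d s(1), of ?c ?T]) blast+
qed

lemma no_affine_F4_dual:
  assumes d: "dynkin K a" and s: "{x1, x2, x3, x4, x5} \<subseteq> K" "distinct [x1, x2, x3, x4, x5]"
    and e: "a x1 x2 \<noteq> 0" "a x2 x3 \<noteq> 0" "a x3 x4 \<noteq> 0" "a x4 x5 \<noteq> 0" and m: "a x3 x4 \<le> -2"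
  shows False
proof -
  have ad: "a x1 x2 \<le> -1" "a x2 x1 \<le> -1" "a x2 x3 \<le> -1" "a x3 x2 \<le> -1"
    "a x3 x4 \<le> -1" "a x4 x3 \<le> -1" "a x4 x5 \<le> -1" "a x5 x4 \<le> -1"
    using dynkin_adjacent[OF d] s e by auto
  let ?S = "{x1, x2, x3, x4, x5}"
    and ?c = "(\<lambda>_. 1)(x2 := 2, x3 := 3, x4 := 2) :: 'a \<Rightarrow> int"
    and ?T = "(\<lambda>_. {})(x1 := {x2}, x2 := {x1, x3}, x3 := {x2, x4}, x4 := {x3, x5}, x5 := {x4})"
  have "\<forall>i\<in>?S. 0 < ?c i \<and> ?T i \<subseteq> ?S - {i} \<and> 2 * ?c i \<le> (\<Sum>t\<in>?T i. - a i t * ?c t)"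
    using s(2) ad m by auto
  then show False by (intro no_subharmonic[OF d s(1), of ?c ?T]) blast+
qed

lemma sum_three: "x \<noteq> y \<Longrightarrow> x \<noteq> z \<Longrightarrow> y \<noteq> z \<Longrightarrow> sum f {x, y, z} = f x + (f y + f z)"
  and sum_four: "x \<noteq> y \<Longrightarrow> x \<noteq> z \<Longrightarrow> x \<noteq> u \<Longrightarrow> y \<noteq> z \<Longrightarrow> y \<noteq> u \<Longrightarrow> z \<noteq> u \<Longrightarrow>
    sum f {x, y, z, u} = f x + (f y + (f z + f u))"
  for f :: "'a \<Rightarrow> 'b::comm_monoid_add"
  by simp_all

section \<open>Standard Cartan matrices and numberings of diagrams\<close>

definition cartan_A :: "nat \<Rightarrow> nat \<Rightarrow> int" where
  "cartan_A p q = (if p = q then 2 else if q = Suc p \<or> p = Suc q then -1 else 0)"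

text \<open>Row \<open>p\<close> is divided by the square length of root \<open>p\<close>, so -2
  stands in the row of the short node \<open>l\<close>. The same convention puts -2 into row 2 of
  \<open>cartan_C\<close> and row 3 of \<open>cartan_F\<close>, and -3 into row 2 of
  \<open>cartan_G\<close>.\<close>

definition cartan_B :: "nat \<Rightarrow> nat \<Rightarrow> nat \<Rightarrow> int" where
  "cartan_B l p q = (if p = l \<and> Suc q = l then -2 else cartan_A p q)"

definition cartan_C :: "nat \<Rightarrow> nat \<Rightarrow> int" where
  "cartan_C p q = (if p = 2 \<and> q = 1 then -2 else cartan_A p q)"

definition cartan_D :: "nat \<Rightarrow> nat \<Rightarrow> nat \<Rightarrow> int" where
  "cartan_D l p q = (if p = q then 2 else if p = l then (if q + 2 = l then -1 else 0)
     else if q = l then (if p + 2 = l then -1 else 0) else cartan_A p q)"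

definition cartan_E :: "nat \<Rightarrow> nat \<Rightarrow> int" where
  "cartan_E p q = (if p = q then 2
     else if p = 1 \<and> q = 3 \<or> p = 3 \<and> q = 1 \<or> p = 2 \<and> q = 4 \<or> p = 4 \<and> q = 2 then -1
     else if 3 \<le> p \<and> 3 \<le> q then cartan_A p q else 0)"

definition cartan_F :: "nat \<Rightarrow> nat \<Rightarrow> int" where
  "cartan_F p q = (if p = 3 \<and> q = 2 then -2 else cartan_A p q)"

definition cartan_G :: "nat \<Rightarrow> nat \<Rightarrow> int" where
  "cartan_G p q = (if p = 2 \<and> q = 1 then -3 else cartan_A p q)"

text \<open>The bounds list each diagram once: C_2 is B_2 with the order of the nodes reversed, and
  D_3 is A_3.\<close>

inductive finite_type :: "nat \<Rightarrow> (nat \<Rightarrow> nat \<Rightarrow> int) \<Rightarrow> bool" where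
  "1 \<le> l \<Longrightarrow> finite_type l cartan_A"
| "2 \<le> l \<Longrightarrow> finite_type l (cartan_B l)"
| "3 \<le> l \<Longrightarrow> finite_type l cartan_C"
| "4 \<le> l \<Longrightarrow> finite_type l (cartan_D l)"
| "l \<in> {6, 7, 8} \<Longrightarrow> finite_type l cartan_E"
| "finite_type 4 cartan_F"
| "finite_type 2 cartan_G"

definition numbered :: "nat \<Rightarrow> (nat \<Rightarrow> nat \<Rightarrow> int) \<Rightarrow> ('i \<Rightarrow> 'i \<Rightarrow> int) \<Rightarrow> 'i set \<Rightarrow> bool" where
  "numbered l P a K \<longleftrightarrow> (\<exists>g. bij_betw g {1..l} K \<and>
     (\<forall>p\<in>{1..l}. \<forall>q\<in>{1..l}. a (g p) (g q) = P p q))"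

definition has_finite_type :: "('i \<Rightarrow> 'i \<Rightarrow> int) \<Rightarrow> 'i set \<Rightarrow> bool" where
  "has_finite_type a K \<longleftrightarrow> (\<exists>l P. finite_type l P \<and> numbered l P a K)"

lemma cartan_A_reverse: "p + p' = m \<Longrightarrow> q + q' = m \<Longrightarrow> cartan_A p' q' = cartan_A p q"
  by (auto simp: cartan_A_def)

lemma has_finite_typeI:
  assumes "finite_type m Q" and r: "\<And>k. 1 \<le> k \<Longrightarrow> k \<le> m \<Longrightarrow> 1 \<le> g k \<and> g k \<le> m"
    and i: "\<And>k k'. 1 \<le> k \<Longrightarrow> k \<le> m \<Longrightarrow> 1 \<le> k' \<Longrightarrow> k' \<le> m \<Longrightarrow> g k = g k' \<Longrightarrow> k = k'"
    and e: "\<And>p q. 1 \<le> p \<Longrightarrow> p \<le> m \<Longrightarrow> 1 \<le> q \<Longrightarrow> q \<le> m \<Longrightarrow> a (g p) (g q) = Q p q"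
  shows "has_finite_type a {1..m}"
proof -
  have "inj_on g {1..m}" using i by (auto simp: inj_on_def)
  moreover have "g ` {1..m} \<subseteq> {1..m}" using r by auto
  ultimately have "bij_betw g {1..m} {1..m}" by (simp add: bij_betw_def endo_inj_surj)
  then have "numbered m Q a {1..m}" using e unfolding numbered_def by (intro exI[of _ g]) simp
  then show ?thesis using assms(1) unfolding has_finite_type_def by blast
qed

lemma has_finite_type_transfer:
  assumes h: "has_finite_type (\<lambda>i j. a (g i) (g j)) L" and g: "bij_betw g L K"
  shows "has_finite_type a K"
proof -
  obtain l P h where "finite_type l P" "bij_betw h {1..l} L"
    "\<forall>p\<in>{1..l}. \<forall>q\<in>{1..l}. a (g (h p)) (g (h q)) = P p q"
    using h unfolding has_finite_type_def numbered_def by blast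
  then show ?thesis using bij_betw_trans[OF _ g, of h "{1..l}"]
    unfolding has_finite_type_def numbered_def by (auto intro!: exI[of _ l] exI[of _ P] exI[of _
      "g \<circ> h"])
qed

section \<open>Attaching a leaf to a diagram of finite type\<close>

locale leaf_extension =
  fixes l :: nat and P :: "nat \<Rightarrow> nat \<Rightarrow> int" and a :: "nat \<Rightarrow> nat \<Rightarrow> int" and p0 :: nat
  assumes dynkin: "dynkin {1..Suc l} a"
    and old: "1 \<le> p \<Longrightarrow> p \<le> l \<Longrightarrow> 1 \<le> q \<Longrightarrow> q \<le> l \<Longrightarrow> a p q = P p q"
    and p0: "1 \<le> p0" "p0 \<le> l"
    and bond: "a (Suc l) p0 \<noteq> 0"
    and leaf: "1 \<le> q \<Longrightarrow> q \<le> l \<Longrightarrow> q \<noteq> p0 \<Longrightarrow> a (Suc l) q = 0"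
begin

lemma leaf': "1 \<le> q \<Longrightarrow> q \<le> l \<Longrightarrow> q \<noteq> p0 \<Longrightarrow> a q (Suc l) = 0"
  using leaf[of q] dynkin_zero[OF dynkin, of "Suc l" q] by auto

lemma new_diag: "a (Suc l) (Suc l) = 2"
  using dynkin_diag[OF dynkin] by auto

lemma bond_le: "a (Suc l) p0 \<le> -1" "a p0 (Suc l) \<le> -1"
  using dynkin_adjacent[OF dynkin, of "Suc l" p0] p0 bond by auto

lemma bond': "a p0 (Suc l) \<noteq> 0"
  using bond_le by auto

abbreviation "w \<equiv> a p0 (Suc l) * a (Suc l) p0"

lemma w_ge: "1 \<le> w"
proof -
  have "1 * 1 \<le> (- a p0 (Suc l)) * (- a (Suc l) p0)" using bond_le by (intro mult_mono) auto
  then show ?thesis by simp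
qed

lemma simple: "w \<le> 1 \<Longrightarrow> a (Suc l) p0 = -1 \<and> a p0 (Suc l) = -1"
proof -
  assume "w \<le> 1"
  then have "(- a p0 (Suc l)) * (- a (Suc l) p0) = 1" using w_ge by simp
  then show ?thesis using bond_le by (auto simp: zmult_eq_1_iff)
qed

lemma simple_row: "w \<le> 1 \<Longrightarrow> 1 \<le> q \<Longrightarrow> q \<le> l \<Longrightarrow> a (Suc l) q = (if q = p0 then -1 else 0)"
  and simple_col: "w \<le> 1 \<Longrightarrow> 1 \<le> q \<Longrightarrow> q \<le> l \<Longrightarrow> a q (Suc l) = (if q = p0 then -1 else 0)"
  using simple leaf leaf' by auto

lemma bond_cases:
  assumes "w \<le> 3"
  obtains "a (Suc l) p0 = -1" "a p0 (Suc l) = -1"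
    | "a (Suc l) p0 = -2" "a p0 (Suc l) = -1" | "a (Suc l) p0 = -1" "a p0 (Suc l) = -2"
    | "a (Suc l) p0 = -3" "a p0 (Suc l) = -1" | "a (Suc l) p0 = -1" "a p0 (Suc l) = -3"
proof -
  define x y where "x = - a (Suc l) p0" and "y = - a p0 (Suc l)"
  have xy: "x \<ge> 1" "y \<ge> 1" "x * y \<le> 3" using bond_le assms by (auto simp: x_def y_def algebra_simps)
  have "x * 1 \<le> x * y" "1 * y \<le> x * y" using xy by (intro mult_mono; simp)+
  then have "x \<le> 3" "y \<le> 3" using xy by linarith+
  then have "x \<in> {1, 2, 3}" "y \<in> {1, 2, 3}" using xy(1,2) by (simp_all, presburger+)
  then have "x = 1 \<and> y = 1 \<or> x = 2 \<and> y = 1 \<or> x = 1 \<and> y = 2 \<or> x = 3 \<and> y = 1 \<or> x = 1 \<and> y = 3"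
    using xy(3) by auto
  then show ?thesis using that unfolding x_def y_def by force
qed

lemma valency: "u \<in> {1..Suc l} \<Longrightarrow> T \<subseteq> {1..Suc l} - {u} \<Longrightarrow> (\<Sum>t\<in>T. a u t * a t u) \<le> 3"
  using dynkin_valency[OF dynkin] .

lemma valency_contra:
  assumes "u \<in> {1..Suc l}" "T \<subseteq> {1..Suc l} - {u}" "\<not> C \<Longrightarrow> 4 \<le> (\<Sum>t\<in>T. a u t * a t u)"
  shows C
  using valency[OF assms(1,2)] assms(3) by linarith

lemma w_le: "w \<le> 3"
  using valency[of p0 "{Suc l}"] p0 by auto

lemma heavy:
  assumes "Q \<subseteq> {1..Suc l}" "Q \<noteq> {}"
    and "\<And>u. u \<in> Q \<Longrightarrow> heavy_at {1..Suc l} a Q u"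
  shows False
  using no_heavy_core[OF dynkin assms] .

lemmas new = new_diag leaf leaf' bond bond'

lemma new_row: "1 \<le> q \<Longrightarrow> q \<le> l \<Longrightarrow> a (Suc l) q = (if q = p0 then a (Suc l) p0 else 0)"
  and new_col: "1 \<le> q \<Longrightarrow> q \<le> l \<Longrightarrow> a q (Suc l) = (if q = p0 then a p0 (Suc l) else 0)"
  using leaf leaf' by auto

text \<open>The leaf has number Suc l in \<open>a\<close>, but need not be the last node in the
  standard numbering of the result. Here it is; \<open>extend_first\<close> and
  \<open>extend_reverse\<close> make it node 1 and shift or reverse the old numbers.\<close>

lemma extend_last:
  assumes t: "finite_type (Suc l) Q"
    and Q: "\<And>p q. 1 \<le> p \<Longrightarrow> p \<le> l \<Longrightarrow> 1 \<le> q \<Longrightarrow> q \<le> l \<Longrightarrow> Q p q = P p q"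
      "Q (Suc l) (Suc l) = 2"
      "\<And>q. 1 \<le> q \<Longrightarrow> q \<le> l \<Longrightarrow> Q (Suc l) q = (if q = p0 then a (Suc l) p0 else 0)"
      "\<And>q. 1 \<le> q \<Longrightarrow> q \<le> l \<Longrightarrow> Q q (Suc l) = (if q = p0 then a p0 (Suc l) else 0)"
  shows "has_finite_type a {1..Suc l}"
proof (rule has_finite_typeI[OF t, of id])
  fix p q assume "1 \<le> p" "p \<le> Suc l" "1 \<le> q" "q \<le> Suc l"
  then consider "p \<le> l" "q \<le> l" | "p \<le> l" "q = Suc l" | "p = Suc l" "q \<le> l" | "p = Suc l" "q
    = Suc l"
    by linarith
  then show "a (id p) (id q) = Q p q"
    using \<open>1 \<le> p\<close> \<open>1 \<le> q\<close> by cases (simp_all only: id_apply Q old new_diag new_row new_col)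
qed auto

lemma extend_first:
  assumes t: "finite_type (Suc l) Q"
    and Q: "\<And>p q. 1 \<le> p \<Longrightarrow> p \<le> l \<Longrightarrow> 1 \<le> q \<Longrightarrow> q \<le> l \<Longrightarrow> Q (Suc p) (Suc q) = P p q"
      "Q 1 1 = 2"
      "\<And>q. 1 \<le> q \<Longrightarrow> q \<le> l \<Longrightarrow> Q 1 (Suc q) = (if q = p0 then a (Suc l) p0 else 0)"
      "\<And>q. 1 \<le> q \<Longrightarrow> q \<le> l \<Longrightarrow> Q (Suc q) 1 = (if q = p0 then a p0 (Suc l) else 0)"
  shows "has_finite_type a {1..Suc l}"
proof (rule has_finite_typeI[OF t, of "\<lambda>k. if k = 1 then Suc l else k - 1"])
  fix p q assume pq: "1 \<le> p" "p \<le> Suc l" "1 \<le> q" "q \<le> Suc l"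
  have 1: "p = 1 \<or> (\<exists>p'. p = Suc p' \<and> 1 \<le> p' \<and> p' \<le> l)" using pq by (cases p) auto
  have 2: "q = 1 \<or> (\<exists>q'. q = Suc q' \<and> 1 \<le> q' \<and> q' \<le> l)" using pq by (cases q) auto
  show "a (if p = 1 then Suc l else p - 1) (if q = 1 then Suc l else q - 1) = Q p q"
    using 1 2 by (elim disjE exE conjE) (use Q(2) new_diag in \<open>simp_all add: Q(1,3,4)[simplified]
      old new_row new_col\<close>)
qed (auto split: if_splits)

lemma extend_reverse:
  assumes t: "finite_type (Suc l) Q"
    and Q: "\<And>p q p' q'. 1 \<le> p \<Longrightarrow> p \<le> l \<Longrightarrow> 1 \<le> q \<Longrightarrow> q \<le> l \<Longrightarrow> p + p' = l + 2 \<Longrightarrow> q + q' = l + 2 \<Longrightarrow>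
      Q p' q' = P p q"
      "Q 1 1 = 2"
      "\<And>q q'. 1 \<le> q \<Longrightarrow> q \<le> l \<Longrightarrow> q + q' = l + 2 \<Longrightarrow> Q 1 q' = (if q = p0 then a (Suc l) p0 else 0)"
      "\<And>q q'. 1 \<le> q \<Longrightarrow> q \<le> l \<Longrightarrow> q + q' = l + 2 \<Longrightarrow> Q q' 1 = (if q = p0 then a p0 (Suc l) else 0)"
  shows "has_finite_type a {1..Suc l}"
proof (rule has_finite_typeI[OF t, of "\<lambda>k. l + 2 - k"])
  fix p q assume "1 \<le> p" "p \<le> Suc l" "1 \<le> q" "q \<le> Suc l"
  then have e: "(l + 2 - p) + p = l + 2" "(l + 2 - q) + q = l + 2"
    and "p = 1 \<or> (1 \<le> l + 2 - p \<and> l + 2 - p \<le> l)" "q = 1 \<or> (1 \<le> l + 2 - q \<and> l + 2 - q \<le> l)"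
    by linarith+
  moreover have "l + 2 - 1 = Suc l" by simp
  ultimately consider "1 \<le> l + 2 - p" "l + 2 - p \<le> l" "1 \<le> l + 2 - q" "l + 2 - q \<le> l"
    | "p = 1" "l + 2 - p = Suc l" "1 \<le> l + 2 - q" "l + 2 - q \<le> l"
    | "1 \<le> l + 2 - p" "l + 2 - p \<le> l" "q = 1" "l + 2 - q = Suc l"
    | "p = 1" "q = 1" "l + 2 - p = Suc l" "l + 2 - q = Suc l" by metis
  then show "a (l + 2 - p) (l + 2 - q) = Q p q"
  proof cases
    case 1 with e show ?thesis by (simp only: Q(1)[of "l + 2 - p" "l + 2 - q" p q] old)
  next
    case 2 with e show ?thesis by (simp only: Q(3)[of "l + 2 - q" q] new_row)
  next
    case 3 with e show ?thesis by (simp only: Q(4)[of "l + 2 - p" p] new_col)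
  next
    case 4 then show ?thesis by (simp only: Q(2) new_diag)
  qed
qed auto

text \<open>Node \<open>m\<close> has three arms: the rest of the chain 1, ..., \<open>m\<close>,
  the single node \<open>i2\<close>, and \<open>i3\<close> followed by \<open>i1\<close>. For m = 3,
  4, 5 this is E_6, E_7, E_8: \<open>m\<close> becomes node 4, and the chain is read backwards.
  Leaves attached to A and to D both lead here.\<close>

lemma extend_E_chain:
  assumes m: "l = m + 2" "m \<in> {3, 4, 5}" and i: "{i1, i2, i3} = {m + 1, m + 2, m + 3}"
    and P: "\<And>p q. 1 \<le> p \<Longrightarrow> p \<le> m \<Longrightarrow> 1 \<le> q \<Longrightarrow> q \<le> m \<Longrightarrow> P p q = cartan_A p q"
    and e: "a i1 i3 = -1" "a i3 i1 = -1" "a i1 i2 = 0" "a i2 i1 = 0" "a i2 i3 = 0" "a i3 i2 = 0"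
    and c: "\<And>k. 1 \<le> k \<Longrightarrow> k \<le> m \<Longrightarrow> a i1 k = 0 \<and> a k i1 = 0 \<and>
        a i2 k = (if k = m then -1 else 0) \<and> a k i2 = (if k = m then -1 else 0) \<and>
        a i3 k = (if k = m then -1 else 0) \<and> a k i3 = (if k = m then -1 else 0)"
  shows "has_finite_type a {1..Suc l}"
proof -
  let ?g = "\<lambda>k. if k = 1 then i1 else if k = 2 then i2 else if k = 3 then i3 else m + 4 - k"
  have m3: "3 \<le> m" using m by auto
  have i_mem: "i1 \<in> {m + 1, m + 2, m + 3}" "i2 \<in> {m + 1, m + 2, m + 3}" "i3 \<in> {m + 1, m + 2, m + 3}"
    using i by auto
  have i_range: "m < i1" "i1 \<le> Suc l" "m < i2" "i2 \<le> Suc l" "m < i3" "i3 \<le> Suc l"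
    using i_mem m(1) by auto
  have "card {i1, i2, i3} = 3" unfolding i by auto
  then have ne: "i1 \<noteq> i2" "i1 \<noteq> i3" "i2 \<noteq> i3" by (auto simp: card_insert_if split: if_splits)
  have d: "a i1 i1 = 2" "a i2 i2 = 2" "a i3 i3 = 2"
    using dynkin_diag[OF dynkin] i_range by auto
  have split: "k = 1 \<or> k = 2 \<or> k = 3 \<or> (\<exists>k'. m + 4 - k = k' \<and> 1 \<le> k' \<and> k' \<le> m \<and> k + k' = m + 4 \<and>
    4 \<le> k)"
    if "1 \<le> k" "k \<le> Suc l" for k
    using that m(1) by auto
  show ?thesis
  proof (rule has_finite_typeI[of _ cartan_E ?g])
    show "finite_type (Suc l) cartan_E" using m by (intro finite_type.intros) auto
  next
    fix k assume "1 \<le> k" "k \<le> Suc l"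
    then show "1 \<le> ?g k \<and> ?g k \<le> Suc l" using i_range m(1) by auto
  next
    fix k k' assume k: "1 \<le> k" "k \<le> Suc l" "1 \<le> k'" "k' \<le> Suc l" and eq: "?g k = ?g k'"
    show "k = k'" using split[OF k(1,2)] split[OF k(3,4)]
      by (elim disjE exE conjE) (use eq ne i_range in auto)
  next
    fix p q assume k: "1 \<le> p" "p \<le> Suc l" "1 \<le> q" "q \<le> Suc l"
    show "a (?g p) (?g q) = cartan_E p q" using split[OF k(1,2)] split[OF k(3,4)]
    proof (elim disjE exE conjE)
      fix p' q' assume p': "m + 4 - p = p'" "1 \<le> p'" "p' \<le> m" "p + p' = m + 4" "4 \<le> p"
        and q': "m + 4 - q = q'" "1 \<le> q'" "q' \<le> m" "q + q' = m + 4" "4 \<le> q"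
      have "a p' q' = cartan_A p q" using p' q' old[of p' q'] P[of p' q'] cartan_A_reverse[of p p'
        "m + 4" q q'] m(1) by simp
      then show ?thesis using p' q' by (simp add: cartan_E_def cartan_A_def)
    qed (use c d e in \<open>auto simp: cartan_E_def cartan_A_def\<close>)
  qed
qed

end

text \<open>The arm above \<open>p0\<close> is at most as long as the one below;
  \<open>extend_A\<close> reverses the chain otherwise. An interior leaf gives arms of lengths 1, l
  - p0 and p0 - 1. The finite cases are l - p0 = 1, of type D, and l - p0 = 2 with p0 - 1 = 2, 3, 4,
  of type E.\<close>

lemma extend_A_upper:
  assumes "leaf_extension l cartan_A a p0" and half: "l + 1 \<le> 2 * p0"
  shows "has_finite_type a {1..Suc l}"
proof -
  interpret leaf_extension l cartan_A a p0 by fact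
  note p = cartan_A_def
  show ?thesis
  proof (cases "p0 = l")
    case end_node: True
    from w_le show ?thesis
    proof (cases rule: bond_cases)
      case 1
      then show ?thesis using p0 end_node
        by (intro extend_last[of cartan_A]) (auto simp: finite_type.intros p)
    next
      case 2
      then show ?thesis using p0 end_node
        by (intro extend_last[of "cartan_B (Suc l)"]) (auto simp: finite_type.intros p cartan_B_def)
    next
      case 3
      show ?thesis
      \<comment> \<open>For l = 1 the result would be C_2, which is listed as B_2 with the leaf as
        first node.\<close>
      proof (cases "l = 1")
        case True
        then show ?thesis using p0 end_node 3
          by (intro extend_first[of "cartan_B (Suc l)"]) (auto simp: finite_type.intros p
            cartan_B_def)
      next
        case False
        show ?thesis
        proof (rule extend_reverse[of cartan_C])
          show "finite_type (Suc l) cartan_C" using False p0 by (intro finite_type.intros) auto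
        next
          fix p q p' q' assume "1 \<le> p" "p \<le> l" "1 \<le> q" "q \<le> l" and e: "p + p' = l + 2" "q + q'
            = l + 2"
          then have "p' \<noteq> 1" "q' \<noteq> 1" by auto
          then show "cartan_C p' q' = cartan_A p q" using cartan_A_reverse[OF e]
            by (simp add: cartan_C_def)
        qed (use p0 end_node 3 False in \<open>auto simp: p cartan_C_def\<close>)
      qed
    next
      case 4
      \<comment> \<open>A triple bond exhausts the valency of node \<open>l\<close> and leaves no
        room for node l - 1.\<close>
      have "l = 1"
      proof (rule ccontr)
        assume "l \<noteq> 1"
        then have "2 \<le> l" using p0 by simp
        show False
      by (rule valency_contra[of "l" "{l - 1, Suc l}"]) (use p0 \<open>2 \<le> l\<close> end_node 4 in \<open>auto simp:
        old p\<close>)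
      qed
      then show ?thesis using p0 end_node 4
        by (intro extend_last[of cartan_G]) (auto simp: numeral_2_eq_2 finite_type.intros[unfolded
          numeral_2_eq_2] p cartan_G_def)
    next
      case 5
      have "l = 1"
      proof (rule ccontr)
        assume "l \<noteq> 1"
        then have "2 \<le> l" using p0 by simp
        show False
      by (rule valency_contra[of "l" "{l - 1, Suc l}"]) (use p0 \<open>2 \<le> l\<close> end_node 5 in \<open>auto simp:
        old p\<close>)
      qed
      then show ?thesis using p0 end_node 5
        by (intro extend_first[of cartan_G]) (auto simp: numeral_2_eq_2
          finite_type.intros[unfolded numeral_2_eq_2] p cartan_G_def)
    qed
  next
    case False
    then have int: "2 \<le> p0" "Suc p0 \<le> l" using p0 half by auto
    have "w \<le> 1"
      by (rule valency_contra[of "p0" "{p0 - 1, p0 + 1, Suc l}"]) (use int in \<open>auto simp: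
        sum_three old p\<close>)
    note s = simple[OF this] and n = simple_row[OF this] simple_col[OF this]
    consider "p0 + 1 = l" | "p0 + 2 = l" "l \<le> 7" | "p0 + 2 = l" "8 \<le> l" | "p0 + 3 \<le> l" using int
      by linarith
    then show ?thesis
    proof cases
      case 1
      then show ?thesis using int s
        by (intro extend_last[of "cartan_D (Suc l)"]) (auto simp: finite_type.intros p cartan_D_def)
    next
      case 2
      show ?thesis
      proof (rule extend_E_chain[of p0 "p0 + 2" "p0 + 3" "p0 + 1"])
        show "p0 \<in> {3, 4, 5}" using 2 half by auto
        have l: "Suc l = p0 + 3" "p0 + 2 \<le> l" using 2 by auto
        note n = n[unfolded l(1)]
        show "a (p0 + 2) (p0 + 1) = -1" "a (p0 + 1) (p0 + 2) = -1" "a (p0 + 2) (p0 + 3) = 0"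
          "a (p0 + 3) (p0 + 2) = 0"
          "a (p0 + 3) (p0 + 1) = 0" "a (p0 + 1) (p0 + 3) = 0"
          using l(2) by (simp_all add: old n p)
        fix k assume k: "1 \<le> k" "k \<le> p0"
        then show "a (p0 + 2) k = 0 \<and> a k (p0 + 2) = 0 \<and>
          a (p0 + 3) k = (if k = p0 then -1 else 0) \<and> a k (p0 + 3) = (if k = p0 then -1 else 0) \<and>
          a (p0 + 1) k = (if k = p0 then -1 else 0) \<and> a k (p0 + 1) = (if k = p0 then -1 else 0)"
          using l(2) by (simp add: old n p)
      qed (use 2 in auto)
    next
      case 3
      then have "False" using int s half
        by (intro no_affine_E8[OF dynkin, of p0 "p0 - 1" "p0 - 2" "p0 - 3" "p0 - 4" "p0 - 5"
          "p0 + 1" "p0 + 2" "Suc l"])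
          (auto simp: old new p)
      then show ?thesis ..
    next
      case 4
      then have "False" using int s half
        by (intro no_affine_E7[OF dynkin, of p0 "p0 - 1" "p0 - 2" "p0 - 3" "p0 + 1" "p0 + 2"
          "p0 + 3" "Suc l"])
          (auto simp: old new p)
      then show ?thesis ..
    qed
  qed
qed


lemma extend_A:
  assumes "leaf_extension l cartan_A a p0"
  shows "has_finite_type a {1..Suc l}"
proof (cases "l + 1 \<le> 2 * p0")
  case True
  then show ?thesis using assms by (rule extend_A_upper[rotated])
next
  case False
  interpret leaf_extension l cartan_A a p0 by fact
  let ?s = "\<lambda>k. if k = Suc l then k else Suc l - k"
  have "inj_on ?s {1..Suc l}" by (auto simp: inj_on_def split: if_splits)
  moreover have "?s ` {1..Suc l} \<subseteq> {1..Suc l}" by (auto split: if_splits)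
  ultimately have s: "bij_betw ?s {1..Suc l} {1..Suc l}"
    unfolding bij_betw_def by (intro conjI endo_inj_surj) simp_all
  have "leaf_extension l cartan_A (\<lambda>i j. a (?s i) (?s j)) (Suc l - p0)"
  proof
    fix p q assume pq: "1 \<le> p" "p \<le> l" "1 \<le> q" "q \<le> l"
    then have "cartan_A (Suc l - p) (Suc l - q) = cartan_A p q"
      by (intro cartan_A_reverse[of _ _ "Suc l"]) auto
    then show "a (?s p) (?s q) = cartan_A p q" using pq old[of "Suc l - p" "Suc l - q"] by auto
  next
    fix q assume "1 \<le> q" "q \<le> l" "q \<noteq> Suc l - p0"
    then show "a (?s (Suc l)) (?s q) = 0" using leaf[of "Suc l - q"] by auto
  qed (use dynkin_reindex[OF dynkin s] p0 bond in auto)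
  from extend_A_upper[OF this] False p0 have "has_finite_type (\<lambda>i j. a (?s i) (?s j)) {1..Suc l}"
    by linarith
  then show ?thesis using s by (rule has_finite_type_transfer)
qed

text \<open>A simple leaf at node 1 continues B. At the short end it gives C_3 for l = 2 and F_4 for
  l = 3, and an affine F_4 appears from l = 4 on. Everything else has a node of valency four, or a
  path with a fork or a multiple bond at each end.\<close>

lemma extend_B:
  assumes "leaf_extension l (cartan_B l) a p0" and l: "2 \<le> l"
  shows "has_finite_type a {1..Suc l}"
proof -
  interpret leaf_extension l "cartan_B l" a p0 by fact
  note p = cartan_A_def cartan_B_def
  consider "p0 = l" | "p0 = 1" "l = 2" | "p0 = l - 1" "3 \<le> l" | "p0 = 1" "p0 < l - 1" "w \<le> 1"
    | "p0 = 1" "p0 < l - 1" "2 \<le> w" | "2 \<le> p0" "p0 < l - 1"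
    using p0 l by linarith
  then show ?thesis
  proof cases
    case 1
    have "w \<le> 1"
      by (rule valency_contra[of "l" "{l - 1, Suc l}"]) (use 1 l in \<open>auto simp: old p\<close>)
    note s = simple[OF this]
    consider "l = 2" | "l = 3" | "4 \<le> l" using l by linarith
    then show ?thesis
    proof cases
      case l: 1
      then have "Suc l = 3" by simp
      show ?thesis by (rule extend_last[of cartan_C]) (use l 1 s in \<open>auto simp: finite_type.intros
        p cartan_C_def\<close>)
    next
      case l: 2
      show ?thesis
      proof (rule extend_last[of cartan_F])
        have "Suc l = 4" using l by simp
        then show "finite_type (Suc l) cartan_F" by (simp only: finite_type.intros)
      qed (use l 1 s in \<open>auto simp: p cartan_F_def\<close>)
    next
      case 3
      have False using 1 3 s
        by (intro no_affine_F4[OF dynkin, of "l - 3" "l - 2" "l - 1" l "Suc l"])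
          (auto simp: old new p)
      then show ?thesis ..
    qed
  next
    case 2
    have "w \<le> 1"
      by (rule valency_contra[of "1" "{2, 3}"]) (use 2 in \<open>auto simp: old p numeral_3_eq_3\<close>)
    note s = simple[OF this]
    show ?thesis
      by (rule extend_first[of "cartan_B (Suc l)"]) (use 2 s in \<open>auto simp: finite_type.intros p\<close>)
  next
    case 3
    have "w \<le> 0"
      by (rule valency_contra[of "l - 1" "{l - 2, l, Suc l}"]) (use 3 in \<open>auto simp: sum_three old
        p\<close>)
    then show ?thesis using w_ge by simp
  next
    case 4
    note s = simple[OF 4(3)]
    show ?thesis
      by (rule extend_first[of "cartan_B (Suc l)"]) (use 4 l s in \<open>auto simp: finite_type.intros p\<close>)
  next
    case 5
    have False
    proof (rule heavy[of "{1..l - 1}"])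
      fix u assume u: "u \<in> {1..l - 1}"
      then consider "u = 1" | "1 < u" "u < l - 1" | "u = l - 1" "u \<noteq> 1" by fastforce
      then show "heavy_at {1..Suc l} a {1..l - 1} u"
      proof cases
        case 1 then show ?thesis using 5 l by (intro heavy_atI[of "{2}" _ _ "{Suc l}"])
          (auto simp: old p)
      next
        case 2 then show ?thesis using 5 l by (intro heavy_atI[of "{u - 1, u + 1}" _ _ "{}"])
          (auto simp: old p)
      next
        case 3 then show ?thesis using 5 l by (intro heavy_atI[of "{u - 1}" _ _ "{l}"])
          (auto simp: old p)
      qed
    qed (use l in auto)
    then show ?thesis ..
  next
    case 6
    have False
    proof (rule heavy[of "{p0..l - 1}"])
      fix u assume u: "u \<in> {p0..l - 1}"
      then consider "u = p0" | "p0 < u" "u < l - 1" | "u = l - 1" "u \<noteq> p0" by fastforce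
      then show "heavy_at {1..Suc l} a {p0..l - 1} u"
      proof cases
        case 1 then show ?thesis using 6 l w_ge
          by (intro heavy_atI[of "{u + 1}" _ _ "{u - 1, Suc l}"]) (auto simp: old p)
      next
        case 2 then show ?thesis using 6 l by (intro heavy_atI[of "{u - 1, u + 1}" _ _ "{}"])
          (auto simp: old p)
      next
        case 3 then show ?thesis using 6 l by (intro heavy_atI[of "{u - 1}" _ _ "{l}"])
          (auto simp: old p)
      qed
    qed (use 6 l in auto)
    then show ?thesis ..
  qed
qed

text \<open>A simple leaf at node \<open>l\<close> continues C. At the long end it gives F_4 for l =
  3 and contains the dual affine F_4 from l = 4 on. The rest is excluded as for B.\<close>

lemma extend_C:
  assumes "leaf_extension l cartan_C a p0" and l: "3 \<le> l"
  shows "has_finite_type a {1..Suc l}"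
proof -
  interpret leaf_extension l cartan_C a p0 by fact
  note p = cartan_A_def cartan_C_def
  consider "p0 = 1" | "p0 = 2" | "p0 = l" "w \<le> 1" | "p0 = l" "2 \<le> w" | "3 \<le> p0" "p0 < l"
    using p0 l by linarith
  then show ?thesis
  proof cases
    case 1
    have "w \<le> 1"
      by (rule valency_contra[of "1" "{2, Suc l}"]) (use 1 l in \<open>auto simp: old p\<close>)
    note s = simple[OF this]
    consider "l = 3" | "4 \<le> l" using l by linarith
    then show ?thesis
    proof cases
      case l: 1
      show ?thesis
      proof (rule extend_first[of cartan_F])
        have "Suc l = 4" using l by simp
        then show "finite_type (Suc l) cartan_F" by (simp only: finite_type.intros)
      qed (use l 1 s in \<open>auto simp: p cartan_F_def\<close>)
    next
      case 2
      have False using 1 2 s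
        by (intro no_affine_F4_dual[OF dynkin, of 4 3 2 1 "Suc l"]) (auto simp: old new p)
      then show ?thesis ..
    qed
  next
    case 2
    have "w \<le> 0"
      by (rule valency_contra[of "2" "{1, 3, Suc l}"]) (use 2 l in \<open>auto simp: old p\<close>)
    then show ?thesis using w_ge by simp
  next
    case 3
    note s = simple[OF 3(2)]
    show ?thesis
      by (rule extend_last[of cartan_C]) (use 3 l s in \<open>auto simp: finite_type.intros p\<close>)
  next
    case 4
    have False
    proof (rule heavy[of "{2..l}"])
      fix u assume u: "u \<in> {2..l}"
      then consider "u = 2" | "2 < u" "u < l" | "u = l" "u \<noteq> 2" by fastforce
      then show "heavy_at {1..Suc l} a {2..l} u"
      proof cases
        case 1 then show ?thesis using 4 l by (intro heavy_atI[of "{3}" _ _ "{1}"])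
          (auto simp: old p)
      next
        case 2 then show ?thesis using 4 l by (intro heavy_atI[of "{u - 1, u + 1}" _ _ "{}"])
          (auto simp: old p)
      next
        case 3 then show ?thesis using 4 l by (intro heavy_atI[of "{u - 1}" _ _ "{Suc l}"])
          (auto simp: old p)
      qed
    qed (use l in auto)
    then show ?thesis ..
  next
    case 5
    have False
    proof (rule heavy[of "{2..p0}"])
      fix u assume u: "u \<in> {2..p0}"
      then consider "u = 2" | "2 < u" "u < p0" | "u = p0" "u \<noteq> 2" by fastforce
      then show "heavy_at {1..Suc l} a {2..p0} u"
      proof cases
        case 1 then show ?thesis using 5 l by (intro heavy_atI[of "{3}" _ _ "{1}"])
          (auto simp: old p)
      next
        case 2 then show ?thesis using 5 l by (intro heavy_atI[of "{u - 1, u + 1}" _ _ "{}"])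
          (auto simp: old p)
      next
        case 3 then show ?thesis using 5 l w_ge
          by (intro heavy_atI[of "{u - 1}" _ _ "{u + 1, Suc l}"]) (auto simp: old p)
      qed
    qed (use 5 l in auto)
    then show ?thesis ..
  qed
qed

text \<open>The three ends of D_4 are interchangeable, so the result is D_5 wherever the leaf is
  attached to an end. The leaf and \<open>p0\<close> begin the chain; node 1 and the third end
  \<open>r\<close> form the fork.\<close>

lemma extend_D4:
  assumes "leaf_extension 4 (cartan_D 4) a p0" and p34: "p0 \<in> {3, 4}" and w: "a p0 5 * a 5 p0 \<le> 1"
  shows "has_finite_type a {1..5}"
proof -
  interpret leaf_extension 4 "cartan_D 4" a p0 by fact
  have n: "a 5 q = (if q = p0 then -1 else 0)" "a q 5 = (if q = p0 then -1 else 0)"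
    if "1 \<le> q" "q \<le> 4" for q
    using simple_row[of q] simple_col[of q] w that by simp_all
  have d: "a 5 5 = 2" using new_diag by simp
  \<comment> \<open>As 3 + 4 = 7, this is the other one of the nodes 3 and 4.\<close>
  define r :: nat where "r = 7 - p0"
  have tab: "a 1 1 = 2" "a 1 2 = -1" "a 1 p0 = 0" "a 1 r = 0" "a 1 5 = 0"
    "a 2 1 = -1" "a 2 2 = 2" "a 2 p0 = -1" "a 2 r = -1" "a 2 5 = 0"
    "a p0 1 = 0" "a p0 2 = -1" "a p0 p0 = 2" "a p0 r = 0" "a p0 5 = -1"
    "a r 1 = 0" "a r 2 = -1" "a r p0 = 0" "a r r = 2" "a r 5 = 0"
    "a 5 1 = 0" "a 5 2 = 0" "a 5 p0 = -1" "a 5 r = 0"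
    "r \<noteq> p0" "r \<in> {3, 4}"
    using p34 by (auto simp: r_def old n cartan_D_def cartan_A_def)
  let ?g = "(\<lambda>_. r)(1 := 5, 2 := p0, 3 := 2, 4 := 1)"
  have rng: "i \<in> {1, 2, 3, 4, 5}" if "1 \<le> i" "i \<le> 5" for i :: nat using that by auto
  show ?thesis
  proof (rule has_finite_typeI[of _ "cartan_D 5" ?g])
    fix i :: nat assume "1 \<le> i" "i \<le> 5"
    from rng[OF this] show "1 \<le> ?g i \<and> ?g i \<le> 5" using tab(25,26) p34 by auto
  next
    fix i j :: nat assume "1 \<le> i" "i \<le> 5" "1 \<le> j" "j \<le> 5"
    from rng[OF this(1,2)] rng[OF this(3,4)] show "?g i = ?g j \<Longrightarrow> i = j"
      using tab(25,26) p34 by auto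
  next
    fix i j :: nat assume "1 \<le> i" "i \<le> 5" "1 \<le> j" "j \<le> 5"
    from rng[OF this(1,2)] rng[OF this(3,4)] show "a (?g i) (?g j) = cartan_D 5 i j"
      by (elim insertE emptyE) (simp_all add: tab(1-24)[simplified] d cartan_D_def cartan_A_def)
  qed (auto simp: finite_type.intros)
qed

text \<open>The branching node is k + 1 and the short arms end in k + 2 and k + 3. A simple leaf at
  node 1 continues D. At a short arm it makes arms of lengths 1, 2 and \<open>k\<close>: this is
  D_5, E_6, E_7, E_8 for k = 1, 2, 3, 4 and contains the affine E_8 from k = 5 on.\<close>

lemma extend_D:
  assumes "leaf_extension (k + 3) (cartan_D (k + 3)) a p0" and k: "1 \<le> k"
  shows "has_finite_type a {1..Suc (k + 3)}"
proof -
  interpret leaf_extension "k + 3" "cartan_D (k + 3)" a p0 by fact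
  note p = cartan_A_def cartan_D_def
  consider "p0 = k + 1" | "p0 \<le> k" "p0 = 1" "w \<le> 1" | "p0 \<le> k" "2 \<le> p0 \<or> 2 \<le> w"
    | "p0 \<in> {k + 2, k + 3}" "2 \<le> w" | "p0 \<in> {k + 2, k + 3}" "w \<le> 1"
    using p0 by fastforce
  then show ?thesis
  proof cases
    case 1
    have "w \<le> 0"
      by (rule valency_contra[of "k + 1" "{k, k + 2, k + 3, Suc (k + 3)}"])
        (use 1 k in \<open>auto simp: sum_four old p\<close>)
    then show ?thesis using w_ge by simp
  next
    case 2
    note n = simple[OF 2(3)]
    show ?thesis
      by (rule extend_first[of "cartan_D (Suc (k + 3))"]) (use 2 k n in \<open>auto simp:
        finite_type.intros p\<close>)
  next
    case 3
    have False
    proof (rule heavy[of "{p0..k + 1}"])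
      fix u assume u: "u \<in> {p0..k + 1}"
      then consider "u = p0" "2 \<le> p0" | "u = p0" "2 \<le> w" | "p0 < u" "u < k + 1" | "u = k + 1"
        "u \<noteq> p0"
        using 3 by fastforce
      then show "heavy_at {1..Suc (k + 3)} a {p0..k + 1} u"
      proof cases
        case 1
        then obtain v where v: "p0 = v + 1" "1 \<le> v" using le_Suc_ex[of 2 p0] by auto
        have "4 \<le> 2 * (\<Sum>s\<in>{v + 2}. - a u s) + (\<Sum>t\<in>{v, Suc (k + 3)}. a u t * a t u)"
          using 1 3 v w_ge by (simp add: old p)
        then show ?thesis using 1 3 v by (intro heavy_atI[of "{v + 2}" _ _ "{v, Suc (k + 3)}"]) auto
      next
        case 2 then show ?thesis using 3 p0
          by (intro heavy_atI[of "{u + 1}" _ _ "{Suc (k + 3)}"]) (auto simp: old p)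
      next
        case 3 then show ?thesis using p0
          by (intro heavy_atI[of "{u - 1, u + 1}" _ _ "{}"]) (auto simp: old p)
      next
        case 4 then show ?thesis using 3 p0
          by (intro heavy_atI[of "{k}" _ _ "{k + 2, k + 3}"]) (auto simp: old p)
      qed
    qed (use 3 p0 in auto)
    then show ?thesis ..
  next
    case 4
    define r where "r = 2 * k + 5 - p0"
    have r: "p0 = k + 2 \<and> r = k + 3 \<or> p0 = k + 3 \<and> r = k + 2" using 4 by (auto simp: r_def)
    then have rp: "a (k + 1) p0 = -1" "a p0 (k + 1) = -1" "a (k + 1) k = -1" "a k (k + 1) = -1"
      "a (k + 1) r = -1" "a r (k + 1) = -1" "k \<noteq> r" "k \<noteq> p0" "r \<noteq> p0" "r \<noteq> k + 1" "p0 \<noteq> k + 1"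
      "1 \<le> r" "r \<le> k + 3"
      using k by (elim disjE conjE; simp add: old p)+
    have False
    proof (rule heavy[of "{k + 1, p0}"])
      fix u assume "u \<in> {k + 1, p0}"
      then consider "u = k + 1" | "u = p0" by auto
      then show "heavy_at {1..Suc (k + 3)} a {k + 1, p0} u"
      proof cases
        case 1
        have "4 \<le> 2 * (\<Sum>s\<in>{p0}. - a u s) + (\<Sum>t\<in>{k, r}. a u t * a t u)"
          unfolding 1 using rp by simp
        then show ?thesis using rp k 1 by (intro heavy_atI[of "{p0}" _ _ "{k, r}"]) auto
      next
        case 2
        have "4 \<le> 2 * (\<Sum>s\<in>{k + 1}. - a u s) + (\<Sum>t\<in>{Suc (k + 3)}. a u t * a t u)"
          unfolding 2 using rp 4 by simp
        then show ?thesis using rp p0 2 by (intro heavy_atI[of "{k + 1}" _ _ "{Suc (k + 3)}"]) auto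
      qed
    qed (use 4 in auto)
    then show ?thesis ..
  next
    case 5
    define r where "r = 2 * k + 5 - p0"
    have r: "p0 = k + 2 \<and> r = k + 3 \<or> p0 = k + 3 \<and> r = k + 2" using 5 by (auto simp: r_def)
    note n = simple_row[OF 5(2)] simple_col[OF 5(2)]
    consider "k = 1" | "k \<in> {2, 3, 4}" | j where "k = j + 5"
    proof -
      have "k = 1 \<or> k \<in> {2, 3, 4} \<or> k = (k - 5) + 5" using k by auto
      then show ?thesis using that by blast
    qed
    then show ?thesis
    proof cases
      case 1
      then have "p0 \<in> {3, 4}" using 5 by auto
      moreover have "a p0 5 * a 5 p0 \<le> 1" "leaf_extension 4 (cartan_D 4) a p0"
        using assms(1) 5(2) 1 by simp_all
      ultimately have "has_finite_type a {1..5}" by (intro extend_D4)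
      then show ?thesis using 1 by simp
    next
      case 2
      show ?thesis
      proof (rule extend_E_chain[of "k + 1" "Suc (k + 3)" r p0])
        have "1 \<le> r" "r \<le> k + 3" "r \<noteq> p0" using r by auto
        then show "a (Suc (k + 3)) p0 = -1" "a p0 (Suc (k + 3)) = -1"
          "a (Suc (k + 3)) r = 0" "a r (Suc (k + 3)) = 0"
          using p0 n by presburger+
        show "a r p0 = 0" "a p0 r = 0" using r by (elim disjE conjE; simp add: old p)+
        fix i assume i: "1 \<le> i" "i \<le> k + 1"
        from r show "a (Suc (k + 3)) i = 0 \<and> a i (Suc (k + 3)) = 0 \<and>
          a r i = (if i = k + 1 then -1 else 0) \<and> a i r = (if i = k + 1 then -1 else 0) \<and>
          a p0 i = (if i = k + 1 then -1 else 0) \<and> a i p0 = (if i = k + 1 then -1 else 0)"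
          using i by (elim disjE conjE) (auto simp: old n[simplified] p)
      qed (use 2 r in \<open>auto simp: p\<close>)
    next
      case 3
      have False using r 3
        by (intro no_affine_E8[OF dynkin _ _ _ _ _ _ _ _ bond', of "j + 6" "j + 5" "j + 4" "j + 3"
          "j + 2" "j + 1" r])
          (auto simp: old p)
      then show ?thesis ..
    qed
  qed
qed


text \<open>A simple leaf at node \<open>l\<close> leads to the next type E, and from E_8 to its
  affine diagram. At node 1 it gives E_7 if l = 6 and contains the affine E_7 otherwise; at node 2
  it creates the affine E_6.\<close>

lemma extend_E:
  assumes "leaf_extension l cartan_E a p0" and l: "l \<in> {6, 7, 8}"
  shows "has_finite_type a {1..Suc l}"
proof -
  interpret leaf_extension l cartan_E a p0 by fact
  note p = cartan_A_def cartan_E_def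
  have l6: "6 \<le> l" "l \<le> 8" using l by auto
  consider "p0 = 1" "2 \<le> w" | "p0 = 1" "w \<le> 1" "l = 6" | "p0 = 1" "w \<le> 1" "7 \<le> l" | "p0 = 2" "2 \<le> w"
    | "p0 = 2" "w \<le> 1" | "p0 = 3" | "p0 = 4" | "5 \<le> p0" "p0 < l \<or> 2 \<le> w"
    | "p0 = l" "w \<le> 1" "l \<le> 7" | "p0 = l" "w \<le> 1" "l = 8"
  proof -
    have "p0 = 1 \<or> p0 = 2 \<or> p0 = 3 \<or> p0 = 4 \<or> 5 \<le> p0" using p0 by linarith
    moreover have "w \<le> 1 \<or> 2 \<le> w" "l = 6 \<or> 7 \<le> l" "l \<le> 7 \<or> l = 8" "p0 < l \<or> p0 = l"
      using p0 l6 by linarith+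
    ultimately show ?thesis using that by blast
  qed
  then show ?thesis
  proof cases
    case 1
    have False
    proof (rule heavy[of "{1, 3, 4}"])
      fix u :: nat assume "u \<in> {1, 3, 4}"
      then consider "u = 1" | "u = 3" | "u = 4" by auto
      then show "heavy_at {1..Suc l} a {1, 3, 4} u"
      proof cases
        case 1 then show ?thesis using \<open>p0 = 1\<close> \<open>2 \<le> w\<close> l6
          by (intro heavy_atI[of "{3}" _ _ "{Suc l}"]) (auto simp: old p)
      next
        case 2 then show ?thesis using l6 by (intro heavy_atI[of "{1, 4}" _ _ "{}"])
          (auto simp: old p)
      next
        case 3 then show ?thesis using l6 by (intro heavy_atI[of "{3}" _ _ "{2, 5}"])
          (auto simp: old p)
      qed
    qed (use l6 in auto)
    then show ?thesis ..
  next
    case 2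
    have n: "a 7 q = (if q = 1 then -1 else 0)" "a q 7 = (if q = 1 then -1 else 0)" if "1 \<le> q" "q
      \<le> 6" for q
      using simple_row[of q] simple_col[of q] 2 that by simp_all
    have d: "a 7 7 = 2" using new_diag 2 by simp
    have o6: "a i j = cartan_E i j" if "1 \<le> i" "i \<le> 6" "1 \<le> j" "j \<le> 6" for i j using old that 2
      by simp
    \<comment> \<open>The symmetry of E_6 exchanges 1 with 6 and 3 with 5, which carries the leaf
      from node 1 to the standard place next to node 6.\<close>
    let ?g = "(\<lambda>_ :: nat. 7 :: nat)(1 := 6, 2 := 2, 3 := 5, 4 := 4, 5 := 3, 6 := 1)"
    have rng: "i \<in> {1, 2, 3, 4, 5, 6, 7}" if "1 \<le> i" "i \<le> 7" for i :: nat using that by auto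
    have "has_finite_type a {1..7}"
    proof (rule has_finite_typeI[of _ cartan_E ?g])
      fix i :: nat assume "1 \<le> i" "i \<le> 7"
      from rng[OF this] show "1 \<le> ?g i \<and> ?g i \<le> 7" by auto
    next
      fix i j :: nat assume "1 \<le> i" "i \<le> 7" "1 \<le> j" "j \<le> 7"
      from rng[OF this(1,2)] rng[OF this(3,4)] show "?g i = ?g j \<Longrightarrow> i = j" by auto
    next
      fix i j :: nat assume "1 \<le> i" "i \<le> 7" "1 \<le> j" "j \<le> 7"
      from rng[OF this(1,2)] rng[OF this(3,4)] show "a (?g i) (?g j) = cartan_E i j"
        by (elim insertE emptyE) (simp_all add: n d o6 p)
    qed (auto simp: finite_type.intros)
    then show ?thesis using 2 by simp
  next
    case 3
    note n = simple_row[OF 3(2)] simple_col[OF 3(2)]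
    have False
      by (rule no_affine_E7[OF dynkin, of 4 3 1 "Suc l" 5 6 7 2]) (use 3 l6 in \<open>simp_all add: old
        n p\<close>)
    then show ?thesis ..
  next
    case 4
    have False
    proof (rule heavy[of "{2, 4}"])
      fix u :: nat assume "u \<in> {2, 4}"
      then consider "u = 2" | "u = 4" by auto
      then show "heavy_at {1..Suc l} a {2, 4} u"
      proof cases
        case 1 then show ?thesis using 4 l6
          by (intro heavy_atI[of "{4}" _ _ "{Suc l}"]) (auto simp: old p)
      next
        case 2 then show ?thesis using l6 by (intro heavy_atI[of "{2}" _ _ "{3, 5}"])
          (auto simp: old p)
      qed
    qed (use l6 in auto)
    then show ?thesis ..
  next
    case 5
    note n = simple_row[OF 5(2)] simple_col[OF 5(2)]
    have False
      by (rule no_affine_E6[OF dynkin, of 4 3 1 5 6 2 "Suc l"]) (use 5 l6 in \<open>simp_all add: old n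
        p\<close>)
    then show ?thesis ..
  next
    case 6
    have False
    proof (rule heavy[of "{3, 4}"])
      fix u :: nat assume "u \<in> {3, 4}"
      then consider "u = 3" | "u = 4" by auto
      then show "heavy_at {1..Suc l} a {3, 4} u"
      proof cases
        case 1 then show ?thesis using 6 l6 w_ge
          by (intro heavy_atI[of "{4}" _ _ "{1, Suc l}"]) (auto simp: old p)
      next
        case 2 then show ?thesis using l6 by (intro heavy_atI[of "{3}" _ _ "{2, 5}"])
          (auto simp: old p)
      qed
    qed (use l6 in auto)
    then show ?thesis ..
  next
    case 7
    have "w \<le> 0"
      by (rule valency_contra[of 4 "{2, 3, 5, Suc l}"]) (use 7 l6 in \<open>auto simp: sum_four old p\<close>)
    then show ?thesis using w_ge by simp
  next
    case 8
    have False
    proof (rule heavy[of "{4..p0}"])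
      fix u :: nat assume u: "u \<in> {4..p0}"
      then consider "u = 4" | "4 < u" "u < p0" | "u = p0" "p0 < l" | "u = p0" "2 \<le> w" using 8
        by fastforce
      then show "heavy_at {1..Suc l} a {4..p0} u"
      proof cases
        case 1 then show ?thesis using 8 l6 by (intro heavy_atI[of "{5}" _ _ "{2, 3}"])
          (auto simp: old p)
      next
        case 2 then show ?thesis using 8 p0
          by (intro heavy_atI[of "{u - 1, u + 1}" _ _ "{}"]) (auto simp: old p)
      next
        case 3 then show ?thesis using 8 p0 w_ge
          by (intro heavy_atI[of "{u - 1}" _ _ "{u + 1, Suc l}"]) (auto simp: old p)
      next
        case 4 then show ?thesis using 8 p0
          by (intro heavy_atI[of "{u - 1}" _ _ "{Suc l}"]) (auto simp: old p)
      qed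
    qed (use 8 p0 in auto)
    then show ?thesis ..
  next
    case 9
    note n = simple[OF 9(2)]
    show ?thesis
    proof (rule extend_last[of cartan_E])
      show "finite_type (Suc l) cartan_E" using 9 l6 by (intro finite_type.intros) auto
    qed (use 9 l6 n in \<open>auto simp: p\<close>)
  next
    case 10
    note n = simple_row[OF 10(2)] simple_col[OF 10(2)]
    have False
      by (rule no_affine_E8[OF dynkin, of 4 5 6 7 8 "Suc l" 3 1 2]) (use 10 in \<open>simp_all add: old
        n[unfolded 10(1,3), simplified] p\<close>)
    then show ?thesis ..
  qed
qed

text \<open>The inner nodes have valency three already, multiple bonds at the ends give heavy paths,
  and simple leaves at the two ends give the two affine diagrams.\<close>

lemma extend_F:
  assumes "leaf_extension 4 cartan_F a p0"
  shows False
proof -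
  interpret leaf_extension 4 cartan_F a p0 by fact
  note p = cartan_A_def cartan_F_def
  consider "p0 = 1" "2 \<le> w" | "p0 = 1" "w \<le> 1" | "p0 = 2" | "p0 = 3" | "p0 = 4" "2 \<le> w" | "p0 = 4"
    "w \<le> 1"
    using p0 by linarith
  then show ?thesis
  proof cases
    case 1
    show False
    proof (rule heavy[of "{1, 2}"])
      fix u :: nat assume "u \<in> {1, 2}"
      then consider "u = 1" | "u = 2" by auto
      then show "heavy_at {1..Suc 4} a {1, 2} u"
      proof cases
        case 1 then show ?thesis using \<open>p0 = 1\<close> \<open>2 \<le> w\<close>
          by (intro heavy_atI[of "{2}" _ _ "{Suc 4}"]) (auto simp: old p)
      next
        case 2 then show ?thesis by (intro heavy_atI[of "{1}" _ _ "{3}"]) (auto simp: old p)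
      qed
    qed auto
  next
    case 2
    note n = simple_row[OF 2(2)] simple_col[OF 2(2)]
    show False
      by (rule no_affine_F4[OF dynkin, of "Suc 4" 1 2 3 4]) (use 2 in \<open>simp_all add: old
        n[simplified] p\<close>)
  next
    case 3
    have "w \<le> 0" by (rule valency_contra[of 2 "{1, 3, Suc 4}"]) (use 3 in \<open>auto simp: old p\<close>)
    then show ?thesis using w_ge by simp
  next
    case 4
    have "w \<le> 0" by (rule valency_contra[of 3 "{2, 4, Suc 4}"]) (use 4 in \<open>auto simp: old p\<close>)
    then show ?thesis using w_ge by simp
  next
    case 5
    show False
    proof (rule heavy[of "{3, 4}"])
      fix u :: nat assume "u \<in> {3, 4}"
      then consider "u = 3" | "u = 4" by auto
      then show "heavy_at {1..Suc 4} a {3, 4} u"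
      proof cases
        case 1 then show ?thesis by (intro heavy_atI[of "{4}" _ _ "{2}"]) (auto simp: old p)
      next
        case 2 then show ?thesis using 5
          by (intro heavy_atI[of "{3}" _ _ "{Suc 4}"]) (auto simp: old p)
      qed
    qed auto
  next
    case 6
    note n = simple_row[OF 6(2)] simple_col[OF 6(2)]
    show False
      by (rule no_affine_F4_dual[OF dynkin, of "Suc 4" 4 3 2 1]) (use 6 in \<open>simp_all add: old
        n[simplified] p\<close>)
  qed
qed

lemma extend_G:
  assumes "leaf_extension 2 cartan_G a p0"
  shows False
proof -
  interpret leaf_extension 2 cartan_G a p0 by fact
  note p = cartan_A_def cartan_G_def
  consider "p0 = 1" | "p0 = 2" using p0 by linarith
  then have "w \<le> 0"
  proof cases
    case 1
    show ?thesis by (rule valency_contra[of 1 "{2, Suc 2}"]) (use 1 in \<open>simp_all add: old p\<close>)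
  next
    case 2
    show ?thesis by (rule valency_contra[of 2 "{1, Suc 2}"]) (use 2 in \<open>simp_all add: old p\<close>)
  qed
  then show False using w_ge by simp
qed

section \<open>Classification by induction on the number of nodes\<close>

lemma has_finite_type_leaf:
  assumes "finite_type l P" "leaf_extension l P a p0"
  shows "has_finite_type a {1..Suc l}"
  using assms
proof (induction rule: finite_type.induct)
  case (1 l) then show ?case by (intro extend_A)
next
  case (2 l) then show ?case by (intro extend_B)
next
  case (3 l) then show ?case by (intro extend_C)
next
  case (4 l)
  then obtain k where "l = k + 3" "1 \<le> k" using le_Suc_ex[of 4 l] by auto
  then show ?case using 4 extend_D by blast
next
  case (5 l) then show ?case by (intro extend_E)
next
  case 6 then show ?case using extend_F by blast
next
  case 7 then show ?case using extend_G by blast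
qed

theorem dynkin_classification:
  assumes "dynkin K a" "linked K a" "K \<noteq> {}"
  shows "has_finite_type a K"
  using assms
proof (induction "card K" arbitrary: K rule: less_induct)
  case less
  have fin: "finite K" using less(2) by (rule dynkin_finite)
  obtain v0 where v0: "v0 \<in> K" using less(4) by blast
  show ?case
  proof (cases "K = {v0}")
    case True
    have "a v0 v0 = 2" using dynkin_diag[OF less(2) v0] .
    then have "numbered 1 cartan_A a K" using True
      by (auto simp: numbered_def cartan_A_def bij_betw_def intro!: exI[of _ "\<lambda>_. v0"])
    then show ?thesis using finite_type.intros(1)[of 1] unfolding has_finite_type_def by auto
  next
    case False
    then obtain v p where v: "v \<in> K" and p: "p \<in> K" "p \<noteq> v" "a v p \<noteq> 0"
      and leaf: "\<And>q. q \<in> K \<Longrightarrow> q \<noteq> v \<Longrightarrow> q \<noteq> p \<Longrightarrow> a v q = 0"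
      using dynkin_leaf[OF less(2,3) v0] by metis
    have "has_finite_type a (K - {v})"
    proof (rule less(1))
      show "card (K - {v}) < card K" using fin v by (meson card_Diff1_less)
      show "dynkin (K - {v}) a" using less(2) by (rule dynkin_subset) auto
      show "linked (K - {v}) a" using less(2,3) v leaf by (rule linked_remove_leaf)
      show "K - {v} \<noteq> {}" using p by auto
    qed
    then obtain l P g where t: "finite_type l P" and g: "bij_betw g {1..l} (K - {v})"
      and old: "\<forall>p\<in>{1..l}. \<forall>q\<in>{1..l}. a (g p) (g q) = P p q"
      unfolding has_finite_type_def numbered_def by blast
    let ?g = "g(Suc l := v)"
    have "bij_betw ?g {1..l} (K - {v})" using g by (rule bij_betw_cong[THEN iffD1, rotated]) auto
    then have "bij_betw ?g ({1..l} \<union> {Suc l}) ((K - {v}) \<union> {v})"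
      by (rule bij_betw_combine) (auto simp: bij_betw_def)
    moreover have "{1..l} \<union> {Suc l} = {1..Suc l}" "(K - {v}) \<union> {v} = K" using v by auto
    ultimately have g': "bij_betw ?g {1..Suc l} K" by simp
    have "p \<in> g ` {1..l}" using g p by (simp add: bij_betw_def)
    then obtain p0 where p0: "p0 \<in> {1..l}" "g p0 = p" by blast
    have "leaf_extension l P (\<lambda>i j. a (?g i) (?g j)) p0"
    proof
      show "dynkin {1..Suc l} (\<lambda>i j. a (?g i) (?g j))" using less(2) g' by (rule dynkin_reindex)
    next
      fix q assume q: "1 \<le> q" "q \<le> l" "q \<noteq> p0"
      then have "g q \<in> K - {v}" using bij_betwE[OF g] by simp
      moreover have "g q \<noteq> p" using q p0 inj_onD[OF bij_betw_imp_inj_on[OF g], of q p0] by auto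
      ultimately have "g q \<in> K" "g q \<noteq> v" "g q \<noteq> p" by auto
      then show "a (?g (Suc l)) (?g q) = 0" using leaf q by auto
    qed (use old p0 p in auto)
    from has_finite_type_leaf[OF t this] show ?thesis using g' by (rule has_finite_type_transfer)
  qed
qed

section \<open>Reflections in a positive semidefinite space\<close>

text \<open>Modulo 9 only the lowest digit remains; as its absolute value is at most 4, it is 0, and
  the remaining sum can be divided by 9.\<close>

lemma balanced_digits_zero:
  fixes d :: "nat \<Rightarrow> int"
  assumes "\<And>j. j < n \<Longrightarrow> \<bar>d j\<bar> \<le> 4" "(\<Sum>j<n. d j * 9 ^ j) = 0" "j < n"
  shows "d j = 0"
  using assms
proof (induction n arbitrary: d j)
  case (Suc n)
  have s: "(\<Sum>j<Suc n. d j * 9 ^ j) = d 0 + 9 * (\<Sum>j<n. d (Suc j) * 9 ^ j)"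
    by (subst sum.lessThan_Suc_shift) (simp add: sum_distrib_left mult_ac)
  have "d 0 = 9 * (- (\<Sum>j<n. d (Suc j) * 9 ^ j))" using s Suc.prems(2) by simp
  then have "9 dvd d 0" by (rule dvdI)
  moreover have "\<bar>d 0\<bar> < 9" using Suc.prems(1)[of 0] by simp
  ultimately have d0: "d 0 = 0" using dvd_imp_le_int by fastforce
  then have "(\<Sum>j<n. d (Suc j) * 9 ^ j) = 0" using s Suc.prems(2) by simp
  then have "d (Suc j) = 0" if "j < n" for j
    using Suc.IH[of "\<lambda>j. d (Suc j)" j] Suc.prems(1) that by auto
  then show ?case using d0 Suc.prems(3) by (cases j) auto
qed simp

locale psd_form =
  fixes f :: "'a::real_vector \<Rightarrow> 'a \<Rightarrow> real"
  assumes sym: "f x y = f y x"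
    and add_left: "f (x + y) z = f x z + f y z"
    and scale_left: "f (c *\<^sub>R x) z = c * f x z"
    and psd: "0 \<le> f x x"
begin

lemma add_right: "f z (x + y) = f z x + f z y"
  using add_left sym by metis

lemma scale_right: "f z (c *\<^sub>R x) = c * f z x"
  using scale_left sym by metis

lemma minus_left: "f (- x) z = - f x z"
  using scale_left[of "-1"] by simp

lemma minus_right: "f z (- x) = - f z x"
  using minus_left sym by metis

lemma diff_left: "f (x - y) z = f x z - f y z"
  using add_left[of x "- y"] minus_left by simp

lemma diff_right: "f z (x - y) = f z x - f z y"
  using diff_left sym by metis

lemma zero_left: "f 0 z = 0"
  using scale_left[of 0] by simp

lemma sum_left: "f (\<Sum>i\<in>A. g i) z = (\<Sum>i\<in>A. f (g i) z)"
  by (induction A rule: infinite_finite_induct) (auto simp: add_left zero_left)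

lemma sum_right: "f z (\<Sum>i\<in>A. g i) = (\<Sum>i\<in>A. f z (g i))"
  using sum_left sym by simp

lemmas bilinear = add_left add_right scale_left scale_right minus_left minus_right diff_left
  diff_right

lemma isotropic_radical:
  assumes "f x x = 0"
  shows "f x z = 0"
proof (rule ccontr)
  assume nz: "f x z \<noteq> 0"
  \<comment> \<open>This makes the value of \<open>f\<close> at z + t x equal to -1.\<close>
  define t where "t = - (f z z + 1) / (2 * f x z)"
  have "0 \<le> f (z + t *\<^sub>R x) (z + t *\<^sub>R x)" by (rule psd)
  also have "\<dots> = f z z + 2 * t * f x z" using assms sym[of z x]
    by (simp add: bilinear algebra_simps)
  also have "2 * t * f x z = - (f z z + 1)" using nz by (simp add: t_def)
  finally show False by simp
qed

lemma cauchy_schwarz: "f x y * f x y \<le> f x x * f y y"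
proof (cases "f x x = 0")
  case True then show ?thesis using isotropic_radical by simp
next
  case False
  define t where "t = f x y / f x x"
  have "0 \<le> f (y - t *\<^sub>R x) (y - t *\<^sub>R x)" by (rule psd)
  also have "\<dots> = f y y - 2 * t * f x y + t * t * f x x"
    using sym[of y x] by (simp add: bilinear algebra_simps)
  also have "\<dots> = f y y - f x y * f x y / f x x" using False by (simp add: t_def field_simps)
  finally have "f x y * f x y / f x x \<le> f y y" by simp
  moreover have "f x x > 0" using psd[of x] False by simp
  ultimately show ?thesis by (simp add: field_simps)
qed

text \<open>For isotropic \<open>a\<close> division by zero makes this the identity, so it is an
  isometry for every \<open>a\<close>.\<close>

definition refl :: "'a \<Rightarrow> 'a \<Rightarrow> 'a" where
  "refl a x = x - (2 * f x a / f a a) *\<^sub>R a"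

lemma refl_self: "f a a \<noteq> 0 \<Longrightarrow> refl a a = - a"
  by (simp add: refl_def scaleR_2)

lemma refl_isometry: "f (refl a x) (refl a y) = f x y"
proof (cases "f a a = 0")
  case False
  then show ?thesis using sym[of a x] sym[of a y] by (simp add: refl_def bilinear field_simps)
qed (simp add: refl_def)

text \<open>\<open>x = c y\<close> modulo the radical of \<open>f\<close>.\<close>

definition parallel :: "real \<Rightarrow> 'a \<Rightarrow> 'a \<Rightarrow> bool" where
  "parallel c x y \<longleftrightarrow> (\<forall>z. f x z = c * f y z)"

lemma parallelD: "parallel c x y \<Longrightarrow> f x z = c * f y z" "parallel c x y \<Longrightarrow> f z x = c * f z y"
  unfolding parallel_def using sym by metis+

lemma parallel_refl [simp]: "parallel 1 x x"
  by (simp add: parallel_def)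

lemma parallel_refl_cong: "parallel 1 x y \<Longrightarrow> parallel 1 (refl a x) (refl a y)"
  by (simp add: parallel_def refl_def bilinear)

lemma parallel_minus_cong: "parallel 1 x y \<Longrightarrow> parallel 1 (- x) (- y)"
  by (simp add: parallel_def bilinear)

section \<open>Moves on indexed families\<close>

inductive move :: "nat \<Rightarrow> (nat \<Rightarrow> 'a) \<Rightarrow> (nat \<Rightarrow> 'a) \<Rightarrow> bool" for n where
  "i < n \<Longrightarrow> j < n \<Longrightarrow> move n w (w(j := refl (w i) (w j)))"

abbreviation "reach n \<equiv> (move n)\<^sup>*\<^sup>*"

definition connected_family :: "nat \<Rightarrow> (nat \<Rightarrow> 'a) \<Rightarrow> bool" where
  "connected_family n w \<longleftrightarrow> (\<forall>A. A \<subseteq> {..<n} \<longrightarrow> A \<noteq> {} \<longrightarrow> A \<noteq> {..<n} \<longrightarrow>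
     (\<exists>i\<in>A. \<exists>j\<in>{..<n} - A. f (w i) (w j) \<noteq> 0))"

text \<open>A cut that nothing crosses after the move is shown to be one before it. If
  \<open>i\<close> and \<open>j\<close> are on the same side, the old \<open>w j\<close> differs
  from the new one by a multiple of \<open>w i\<close>, which is orthogonal to the other side. If
  they are on different sides, the new \<open>w j\<close> is orthogonal to \<open>w i\<close>, so
  the reflection was trivial.\<close>

lemma connected_family_move:
  assumes "move n w w'" "connected_family n w"
  shows "connected_family n w'"
  using assms
proof (induction rule: move.induct)
  case (1 i j w)
  let ?w = "w(j := refl (w i) (w j))"
  define m where "m = 2 * f (w j) (w i) / f (w i) (w i)"
  have wj: "?w j = w j - m *\<^sub>R w i" by (simp add: refl_def m_def)
  show ?case
    unfolding connected_family_def
  proof (intro allI impI, rule ccontr)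
    fix A assume A: "A \<subseteq> {..<n}" "A \<noteq> {}" "A \<noteq> {..<n}"
      and "\<not> (\<exists>a\<in>A. \<exists>b\<in>{..<n} - A. f (?w a) (?w b) \<noteq> 0)"
    then have s: "f (?w a) (?w b) = 0" if "a \<in> A \<and> b \<in> {..<n} - A \<or> b \<in> A \<and> a \<in> {..<n} - A" for a b
      using that sym by metis
    have "f (w j) (w b) = 0" if b: "b \<noteq> j" "j \<in> A \<and> b \<in> {..<n} - A \<or> b \<in> A \<and> j \<in> {..<n} - A" for b
    proof -
      have jb: "f (?w j) (w b) = 0" using s[of j b] b by simp
      then have e: "f (w j) (w b) = m * f (w i) (w b)" unfolding wj by (simp add: bilinear)
      show ?thesis
      proof (cases "i = j")
        case True
        then have "(1 - m) * f (w j) (w b) = 0" using e by (simp add: algebra_simps)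
        moreover have "1 - m \<noteq> 0" if "f (w j) (w b) \<noteq> 0"
          using True that isotropic_radical[of "w j" "w b"] by (auto simp: m_def)
        ultimately show ?thesis by auto
      next
        case ij: False
        show ?thesis
        proof (cases "i \<in> A \<longleftrightarrow> j \<in> A")
          case True
          then have "f (w i) (w b) = 0" using s[of i b] b ij 1 by auto
          then show ?thesis using e by simp
        next
          case False
          then have "f (w i) (?w j) = 0" using s[of i j] ij 1 A by auto
          then have "f (w i) (w j) = m * f (w i) (w i)" unfolding wj by (simp add: bilinear)
          then have "m = 0" using sym[of "w i" "w j"] isotropic_radical[of "w i" "w j"]
            by (cases "f (w i) (w i) = 0") (auto simp: m_def field_simps)
          then show ?thesis using e by simp
        qed
      qed
    qed
    moreover have "f (w a) (w b) = 0" if "a \<in> A" "b \<in> {..<n} - A" "a \<noteq> j" "b \<noteq> j" for a b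
      using s[of a b] that by simp
    ultimately have "\<forall>a\<in>A. \<forall>b\<in>{..<n} - A. f (w a) (w b) = 0"
      using sym by (metis DiffE)
    then show False using 1(3) A unfolding connected_family_def by blast
  qed
qed

lemma connected_family_reach: "reach n w w' \<Longrightarrow> connected_family n w \<Longrightarrow> connected_family n w'"
  by (induction rule: rtranclp_induct) (auto intro: connected_family_move)

text \<open>The path of a single vector while the members with index in \<open>J\<close> act as
  mirrors. The sign change stands for the reflection of the vector in itself.\<close>

definition orbit_step :: "(nat \<Rightarrow> 'a) \<Rightarrow> nat set \<Rightarrow> 'a \<Rightarrow> 'a \<Rightarrow> bool" where
  "orbit_step w J x y \<longleftrightarrow> (\<exists>j\<in>J. y = refl (w j) x) \<or> y = - x"

abbreviation "orbit w J \<equiv> (orbit_step w J)\<^sup>*\<^sup>*"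

lemma orbit_norm: "orbit w J x y \<Longrightarrow> f y y = f x x"
  by (induction rule: rtranclp_induct) (auto simp: orbit_step_def refl_isometry bilinear)

lemma reach_orbit_one:
  assumes "orbit w J (w' i) t" "i < n" "J \<subseteq> {..<n}" "i \<notin> J" "\<And>j. j \<in> J \<Longrightarrow> w' j = w j"
    "f (w' i) (w' i) \<noteq> 0"
  shows "reach n w' (w'(i := t))"
  using assms(1)
proof (induction rule: rtranclp_induct)
  case (step y z)
  let ?u = "w'(i := y)"
  have fy: "f y y \<noteq> 0" using orbit_norm[OF step(1)] assms(6) by simp
  have "move n ?u (?u(i := z))"
  proof (cases "z = - y")
    case True
    then show ?thesis using move.intros[of i n i ?u] assms(2) refl_self[OF fy] by simp
  next
    case False
    then obtain j where j: "j \<in> J" "z = refl (w j) y" using step(2) by (auto simp: orbit_step_def)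
    then have "j < n" "j \<noteq> i" using assms(3,4) by auto
    then show ?thesis using move.intros[of j n i ?u] j assms(2) assms(5)[of j] by simp
  qed
  then have "move n ?u (w'(i := z))" by (simp only: fun_upd_upd)
  with step(3) show ?case by (meson rtranclp.rtrancl_into_rtrancl)
qed simp

text \<open>The mirrors never change, so the members outside \<open>J\<close> can be moved one after
  another, each along its own path.\<close>

lemma reach_orbit:
  assumes J: "J \<subseteq> {..<n}" and I: "I \<subseteq> {..<n} - J"
    and t: "\<And>i. i \<in> I \<Longrightarrow> orbit w J (w i) (t i) \<and> f (w i) (w i) \<noteq> 0"
  shows "reach n w (\<lambda>i. if i \<in> I then t i else w i)"
proof -
  have "finite I" using I finite_subset by blast
  then show ?thesis using I t
  proof (induction I rule: finite_induct)
    case (insert i I)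
    let ?u = "\<lambda>i. if i \<in> I then t i else w i"
    have "reach n w ?u" using insert by auto
    moreover have "reach n ?u (?u(i := t i))"
      by (rule reach_orbit_one[of w J]) (use insert J in auto)
    moreover have "?u(i := t i) = (\<lambda>k. if k \<in> insert i I then t k else w k)" by auto
    ultimately show ?case by simp
  qed simp
qed

end

section \<open>Roots and Cartan integers\<close>

locale root_lattice = psd_form +
  fixes Q :: "'a set"
  assumes Q_diff: "x \<in> Q \<Longrightarrow> y \<in> Q \<Longrightarrow> x - of_int m *\<^sub>R y \<in> Q"
begin

text \<open>Integrality is required against all of \<open>Q\<close> and not against a given set of
  roots. Thus reflections in roots preserve \<open>Q\<close>, and with it the property of being a
  root.\<close>

definition root :: "'a \<Rightarrow> bool" where
  "root x \<longleftrightarrow> x \<in> Q \<and> f x x > 0 \<and> (\<forall>u\<in>Q. 2 * f u x / f x x \<in> \<int>)"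

definition cart :: "'a \<Rightarrow> 'a \<Rightarrow> int" where
  "cart x y = \<lfloor>2 * f x y / f x x\<rfloor>"

lemma root_pos: "root x \<Longrightarrow> f x x > 0"
  by (simp add: root_def)

lemma cart_eq: "root x \<Longrightarrow> y \<in> Q \<Longrightarrow> of_int (cart x y) = 2 * f x y / f x x"
  using sym[of x y] by (auto simp: root_def cart_def elim!: Ints_cases)

lemma cart_mult: "root x \<Longrightarrow> y \<in> Q \<Longrightarrow> of_int (cart x y) * f x x = 2 * f x y"
  using cart_eq root_pos[of x] by simp

lemma rootQ: "root x \<Longrightarrow> x \<in> Q"
  by (simp add: root_def)

lemma refl_Q: "root a \<Longrightarrow> x \<in> Q \<Longrightarrow> refl a x \<in> Q"
  using Q_diff[of x a "cart a x"] by (simp add: cart_eq refl_def rootQ sym)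

lemma refl_refl: "f a a \<noteq> 0 \<Longrightarrow> refl a (refl a x) = x"
  by (simp add: refl_def bilinear field_simps)

lemma root_refl:
  assumes "root a" "root b"
  shows "root (refl a b)"
  unfolding root_def
proof (intro conjI ballI)
  show "refl a b \<in> Q" using assms rootQ refl_Q by blast
  show "0 < f (refl a b) (refl a b)" using assms root_pos by (simp add: refl_isometry)
  fix u assume "u \<in> Q"
  then have "refl a u \<in> Q" using assms refl_Q by blast
  then have "2 * f (refl a u) b / f b b \<in> \<int>" using assms by (simp add: root_def)
  moreover have "f u (refl a b) = f (refl a u) b"
    using refl_isometry[of a "refl a u" b] refl_refl[of a u] root_pos[OF assms(1)] by simp
  ultimately show "2 * f u (refl a b) / f (refl a b) (refl a b) \<in> \<int>" by (simp add: refl_isometry)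
qed

definition root_family :: "nat \<Rightarrow> (nat \<Rightarrow> 'a) \<Rightarrow> bool" where
  "root_family n w \<longleftrightarrow> (\<forall>i<n. root (w i))"

lemma root_family_reach: "reach n w w' \<Longrightarrow> root_family n w \<Longrightarrow> root_family n w'"
proof (induction rule: rtranclp_induct)
  case (step y z)
  from step(2,3,4) show ?case by (auto simp: root_family_def root_refl elim!: move.cases)
qed

lemma cart_zero: "root x \<Longrightarrow> root y \<Longrightarrow> cart x y = 0 \<longleftrightarrow> f x y = 0"
  using cart_mult[of x y] rootQ[of y] root_pos[of x] by auto

lemma cart_sgn: "root x \<Longrightarrow> root y \<Longrightarrow> cart x y > 0 \<longleftrightarrow> f x y > 0"
proof -
  assume r: "root x" "root y"
  have "cart x y > 0 \<longleftrightarrow> real_of_int (cart x y) > 0" by simp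
  also have "\<dots> \<longleftrightarrow> f x y > 0" using cart_eq[OF r(1) rootQ[OF r(2)]] root_pos[OF r(1)]
    by (simp add: zero_less_divide_iff)
  finally show ?thesis .
qed

lemma cart_prod_real:
  assumes r: "root x" "root y"
  shows "of_int (cart x y * cart y x) * (f x x * f y y) = 4 * (f x y * f x y)"
proof -
  have "of_int (cart x y * cart y x) * (f x x * f y y)
      = (of_int (cart x y) * f x x) * (of_int (cart y x) * f y y)" by simp
  also have "\<dots> = 4 * (f x y * f x y)"
    using cart_mult[OF r(1) rootQ[OF r(2)]] cart_mult[OF r(2) rootQ[OF r(1)]] sym[of y x] by simp
  finally show ?thesis .
qed

lemma cart_prod_le:
  assumes r: "root x" "root y"
  shows "cart x y * cart y x \<le> 4"
proof -
  have "of_int (cart x y * cart y x) * (f x x * f y y) \<le> 4 * (f x x * f y y)"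
    unfolding cart_prod_real[OF r] using cauchy_schwarz[of x y] by simp
  then have "real_of_int (cart x y * cart y x) \<le> 4" using root_pos r by simp
  then show ?thesis by linarith
qed

lemma cart_abs_le:
  assumes r: "root x" "root y"
  shows "\<bar>cart x y\<bar> \<le> 4"
proof (cases "cart x y = 0")
  case False
  then have nz: "f x y \<noteq> 0" using cart_zero[OF r] by simp
  then have ne: "cart y x \<noteq> 0" using cart_zero[OF r(2,1)] sym by simp
  have "of_int (cart x y * cart y x) * (f x x * f y y) > 0"
    unfolding cart_prod_real[OF r] using nz by (auto simp: zero_less_mult_iff)
  moreover have "f x x * f y y > 0" using root_pos r by simp
  ultimately have "real_of_int (cart x y * cart y x) > 0" by (rule zero_less_mult_pos2)
  then have pos: "cart x y * cart y x > 0" by linarith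
  then have "\<bar>cart x y\<bar> * \<bar>cart y x\<bar> \<le> 4" using cart_prod_le[OF r]
    by (simp add: abs_mult[symmetric])
  moreover have "\<bar>cart x y\<bar> * 1 \<le> \<bar>cart x y\<bar> * \<bar>cart y x\<bar>" using ne by (intro mult_left_mono) auto
  ultimately show ?thesis by simp
qed simp

text \<open>Equality in the Cauchy-Schwarz inequality makes y - t x isotropic, hence radical. The
  Cartan integer 2 t is a positive divisor of 4, so t is 1/2, 1 or 2.\<close>

lemma cart_prod_four:
  assumes r: "root x" "root y" and p: "f x y > 0" and e: "cart x y * cart y x = 4"
  shows "parallel 1 x y \<or> parallel 2 x y \<or> parallel 2 y x"
proof -
  have c: "cart x y > 0" "cart y x > 0" using cart_sgn[OF r] cart_sgn[OF r(2,1)] p sym by auto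
  define t where "t = f x y / f x x"
  have fx: "f x x > 0" "f y y > 0" using r root_pos by auto
  have "f x y * f x y = f x x * f y y" using cart_prod_real[OF r] e by simp
  then have "f (y - t *\<^sub>R x) (y - t *\<^sub>R x) = 0"
    using fx sym[of y x] by (simp add: t_def bilinear field_simps)
  then have par: "parallel t y x" using isotropic_radical[of "y - t *\<^sub>R x"]
    by (simp add: parallel_def bilinear)
  have t: "2 * t = of_int (cart x y)" using cart_eq[OF r(1) rootQ[OF r(2)]] by (simp add: t_def)
  have "cart x y * 1 \<le> cart x y * cart y x" using c by (intro mult_left_mono) auto
  then have "cart x y \<in> {1, 2, 3, 4}" using c e by auto
  moreover have "cart x y \<noteq> 3"
  proof
    assume "cart x y = 3"
    then have "3 * cart y x = 4" using e by simp
    then show False by presburger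
  qed
  ultimately consider "t = 1/2" | "t = 1" | "t = 2" using t by auto
  then show ?thesis
  proof cases
    case 1 then show ?thesis using par by (simp add: parallel_def)
  next
    case 2 then show ?thesis using par by (simp add: parallel_def)
  next
    case 3 then show ?thesis using par by simp
  qed
qed

end

section \<open>Reduction to a base\<close>

text \<open>The assumption \<open>v_span\<close> says that the \<open>v j\<close> span modulo the
  radical, in the form needed for heights: no root has only zero Cartan integers with them.\<close>

locale root_span = root_lattice f Q for f :: "'a::real_vector \<Rightarrow> 'a \<Rightarrow> real" and Q +
  fixes n :: nat and v :: "nat \<Rightarrow> 'a"
  assumes v_root: "j < n \<Longrightarrow> root (v j)"
    and v_span: "x \<in> Q \<Longrightarrow> (\<And>j. j < n \<Longrightarrow> f x (v j) = 0) \<Longrightarrow> f x x = 0"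
begin

text \<open>On roots the coefficients are integers of absolute value at most 4, i.e. balanced digits in
  base 9, so no root has height 0.\<close>

definition height :: "'a \<Rightarrow> real" where
  "height x = (\<Sum>j<n. 2 * f (v j) x / f (v j) (v j) * 9 ^ j)"

lemma height_add: "height (x + y) = height x + height y"
  unfolding height_def sum.distrib[symmetric]
  by (intro sum.cong) (simp_all add: bilinear distrib_left distrib_right add_divide_distrib)

lemma height_scale: "height (c *\<^sub>R x) = c * height x"
  unfolding height_def sum_distrib_left
  by (intro sum.cong) (simp_all add: bilinear)

lemma height_minus: "height (- x) = - height x"
  using height_scale[of "-1" x] by simp

lemma height_diff: "height (x - y) = height x - height y"
  using height_add[of x "- y"] height_minus by simp

lemma height_zero: "height 0 = 0"
  using height_scale[of 0] by simp

lemma height_sum: "height (\<Sum>i\<in>A. g i) = (\<Sum>i\<in>A. height (g i))"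
  by (induction A rule: infinite_finite_induct) (auto simp: height_add height_zero)

lemma height_radical:
  assumes "f x x = 0"
  shows "height x = 0"
proof -
  have "f (v j) x = 0" for j using isotropic_radical[OF assms] sym by metis
  then show ?thesis by (simp add: height_def)
qed

lemma height_int: "x \<in> Q \<Longrightarrow> height x = of_int (\<Sum>j<n. cart (v j) x * 9 ^ j)"
  using cart_eq[OF v_root] by (simp add: height_def)

lemma height_nonzero:
  assumes "root x"
  shows "height x \<noteq> 0"
proof
  assume "height x = 0"
  then have "of_int (\<Sum>j<n. cart (v j) x * 9 ^ j) = (0 :: real)" using height_int rootQ[OF assms]
    by simp
  then have z: "(\<Sum>j<n. cart (v j) x * 9 ^ j) = 0" by linarith
  have "cart (v j) x = 0" if "j < n" for j
    by (rule balanced_digits_zero[of n "\<lambda>j. cart (v j) x"]) (use cart_abs_le v_root assms z that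
      in auto)
  then have "f x (v j) = 0" if "j < n" for j using cart_zero[OF v_root assms] sym that by metis
  then show False using v_span[of x] rootQ[OF assms] root_pos[OF assms] by simp
qed

text \<open>Heights are integers on \<open>Q\<close>, so the floor loses nothing there, and natural
  values guarantee a minimum.\<close>

definition weight :: "(nat \<Rightarrow> 'a) \<Rightarrow> nat" where
  "weight w = (\<Sum>i<n. nat \<lfloor>\<bar>height (w i)\<bar>\<rfloor>)"

lemma weight_decreases:
  assumes "j < n" "w j \<in> Q" "y \<in> Q" "\<bar>height y\<bar> < \<bar>height (w j)\<bar>"
  shows "weight (w(j := y)) < weight w"
proof -
  have s: "weight u = nat \<lfloor>\<bar>height (u j)\<bar>\<rfloor> + (\<Sum>i\<in>{..<n} - {j}. nat \<lfloor>\<bar>height (u i)\<bar>\<rfloor>)" for u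
    unfolding weight_def using assms(1) by (intro sum.remove) auto
  have "nat \<lfloor>\<bar>height y\<bar>\<rfloor> < nat \<lfloor>\<bar>height (w j)\<bar>\<rfloor>"
    using assms(4) unfolding height_int[OF assms(2)] height_int[OF assms(3)] of_int_abs[symmetric]
      floor_of_int by linarith
  moreover have "(\<Sum>i\<in>{..<n} - {j}. nat \<lfloor>\<bar>height ((w(j := y)) i)\<bar>\<rfloor>) =
      (\<Sum>i\<in>{..<n} - {j}. nat \<lfloor>\<bar>height (w i)\<bar>\<rfloor>)" by (intro sum.cong) auto
  ultimately show ?thesis unfolding s[of w] s[of "w(j := y)"] by simp
qed

text \<open>Let h be the height, x = w i and y = w j. Reflecting y in x turns h y into h y - h x,
  which is smaller in absolute value if h x < 2 h y. Otherwise x is reflected in y: this subtracts c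
  h y from h x, where c = cart y x and 0 < c h y \<le> 3 h y < 2 h x.\<close>

lemma acute_pair_decreases:
  assumes ij: "i < n" "j < n" "i \<noteq> j" and r: "root_family n w"
    and h: "height (w i) > 0" "height (w j) > 0" and c: "cart (w i) (w j) = 1"
      "cart (w j) (w i) \<in> {1, 2, 3}"
  shows "\<exists>w'. move n w w' \<and> weight w' < weight w"
proof -
  let ?x = "w i" and ?y = "w j"
  have rx: "root ?x" and ry: "root ?y" using r ij by (auto simp: root_family_def)
  have e1: "refl ?x ?y = ?y - ?x"
    using cart_eq[OF rx rootQ[OF ry]] c(1) sym[of ?x ?y] by (simp add: refl_def)
  have e2: "refl ?y ?x = ?x - of_int (cart ?y ?x) *\<^sub>R ?y"
    using cart_eq[OF ry rootQ[OF rx]] sym[of ?x ?y] by (simp add: refl_def)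
  show ?thesis
  proof (cases "height ?x < 2 * height ?y")
    case True
    then have "\<bar>height (refl ?x ?y)\<bar> < \<bar>height ?y\<bar>" using h by (simp add: e1 height_diff)
    then have "weight (w(j := refl ?x ?y)) < weight w"
      using ij rx ry rootQ root_refl by (intro weight_decreases) auto
    then show ?thesis using move.intros[OF ij(1,2)] by blast
  next
    case False
    have "of_int (cart ?y ?x) * height ?y \<le> 3 * height ?y" "1 * height ?y \<le> of_int (cart ?y ?x) *
      height ?y"
      using c(2) h by (intro mult_right_mono; auto)+
    then have "\<bar>height (refl ?y ?x)\<bar> < \<bar>height ?x\<bar>"
      unfolding e2 height_diff height_scale using h False by linarith
    then have "weight (w(i := refl ?y ?x)) < weight w"
      using ij rx ry rootQ root_refl by (intro weight_decreases) auto
    then show ?thesis using move.intros[OF ij(2,1)] by blast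
  qed
qed

lemma reduced_family:
  obtains w where "reach n v w" "root_family n w" "\<And>i. i < n \<Longrightarrow> height (w i) > 0"
    "\<And>i j. i < n \<Longrightarrow> j < n \<Longrightarrow> i \<noteq> j \<Longrightarrow> f (w i) (w j) > 0 \<Longrightarrow>
       parallel 1 (w i) (w j) \<or> parallel 2 (w i) (w j) \<or> parallel 2 (w j) (w i)"
proof -
  obtain w0 where w0: "reach n v w0" and min: "\<And>w. reach n v w \<Longrightarrow> weight w0 \<le> weight w"
    using ex_has_least_nat[of "reach n v" v weight] by auto
  have r0: "root_family n w0" using root_family_reach[OF w0] v_root by (simp add: root_family_def)
  define I where "I = {i\<in>{..<n}. height (w0 i) < 0}"
  define w where "w = (\<lambda>i. if i \<in> I then - w0 i else w0 i)"
  have "reach n w0 w" unfolding w_def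
  proof (rule reach_orbit[of "{}"])
    fix i assume "i \<in> I"
    then have "root (w0 i)" using r0 by (auto simp: root_family_def I_def)
    then show "orbit w0 {} (w0 i) (- w0 i) \<and> f (w0 i) (w0 i) \<noteq> 0"
      using root_pos[of "w0 i"] by (auto simp: orbit_step_def)
  qed (auto simp: I_def)
  then have reach: "reach n v w" using w0 by auto
  have rw: "root_family n w" using root_family_reach[OF reach] v_root by (simp add: root_family_def)
  \<comment> \<open>The sign changes made after the minimization do not affect the weight, so
    \<open>w\<close> is minimal too.\<close>
  have "weight w = weight w0" unfolding weight_def
    by (intro sum.cong) (auto simp: w_def height_minus)
  then have min': "weight w \<le> weight w'" if "reach n w w'" for w'
    using min[of w'] reach that by (metis rtranclp_trans)
  have pos: "height (w i) > 0" if "i < n" for i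
    using height_nonzero[of "w0 i"] r0 that by (auto simp: w_def I_def height_minus root_family_def)
  have "parallel 1 (w i) (w j) \<or> parallel 2 (w i) (w j) \<or> parallel 2 (w j) (w i)"
    if ij: "i < n" "j < n" "i \<noteq> j" and p: "f (w i) (w j) > 0" for i j
  proof -
    have r: "root (w i)" "root (w j)" using rw ij by (auto simp: root_family_def)
    define x y where "x = cart (w i) (w j)" and "y = cart (w j) (w i)"
    have xy: "x \<ge> 1" "y \<ge> 1" using cart_sgn[OF r] cart_sgn[OF r(2,1)] p sym
      by (auto simp: x_def y_def)
    have le: "x * y \<le> 4" using cart_prod_le[OF r] by (simp add: x_def y_def)
    have nd: "\<not> (cart (w i') (w j') = 1 \<and> cart (w j') (w i') \<in> {1, 2, 3})"
      if "i' < n" "j' < n" "i' \<noteq> j'" for i' j'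
      using acute_pair_decreases[OF that rw pos pos] that min' by (meson leD r_into_rtranclp)
    have "x * y = 4"
    proof (rule ccontr)
      assume "x * y \<noteq> 4"
      then have l3: "x * y \<le> 3" using le by simp
      have "x * 1 \<le> x * y" "1 * y \<le> x * y" using xy by (intro mult_mono; simp)+
      then have "x \<le> 3" "y \<le> 3" using l3 by linarith+
      then have "x \<in> {1, 2, 3}" "y \<in> {1, 2, 3}" using xy by (simp_all, presburger+)
      moreover from this l3 have "x = 1 \<or> y = 1" by auto
      ultimately show False using nd[of i j] nd[of j i] ij unfolding x_def y_def by auto
    qed
    then show ?thesis using cart_prod_four[OF r p] by (simp add: x_def y_def)
  qed
  then show ?thesis using that[OF reach rw pos] by blast
qed

text \<open>A nonnegative combination x with a positive coefficient has positive height, so it is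
  not radical and f x x > 0. Expanding the left argument of f x x yields an index where both the
  coefficient and the inner product of \<open>w i\<close> with x are positive.\<close>

lemma dynkin_of_obtuse:
  assumes J: "J \<subseteq> {..<n}" and r: "root_family n w" and h: "\<And>i. i < n \<Longrightarrow> height (w i) > 0"
    and np: "\<And>i j. i \<in> J \<Longrightarrow> j \<in> J \<Longrightarrow> i \<noteq> j \<Longrightarrow> f (w i) (w j) \<le> 0"
  shows "dynkin J (\<lambda>i j. cart (w i) (w j))"
proof -
  have rt: "root (w i)" "w i \<in> Q" "f (w i) (w i) > 0" if "i \<in> J" for i
    using r J that rootQ root_pos by (auto simp: root_family_def)
  have fin: "finite J" using J finite_subset by blast
  have m: "of_int (cart (w i) (w j)) * f (w i) (w i) = 2 * f (w i) (w j)" if "i \<in> J" "j \<in> J" for i j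
    using cart_mult rt that by blast
  have sub: "subharmonic_free J (\<lambda>i j. cart (w i) (w j))"
    unfolding subharmonic_free_def
  proof (intro allI impI)
    fix c :: "nat \<Rightarrow> real" assume nn: "\<forall>i\<in>J. 0 \<le> c i" and "\<exists>i\<in>J. 0 < c i"
    then obtain i0 where i0: "i0 \<in> J" "0 < c i0" by blast
    define x where "x = (\<Sum>j\<in>J. c j *\<^sub>R w j)"
    have fx: "f (w i) x * 2 = f (w i) (w i) * (\<Sum>j\<in>J. of_int (cart (w i) (w j)) * c j)" if "i \<in> J"
      for i
      unfolding x_def sum_right sum_distrib_left sum_distrib_right
      using m[OF that] by (intro sum.cong) (auto simp: bilinear algebra_simps)
    have "height x = (\<Sum>j\<in>J. c j * height (w j))" by (simp add: x_def height_sum height_scale)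
    also have "\<dots> > 0" using fin i0 nn h J by (intro sum_pos2[of _ i0]) (auto simp: less_imp_le)
    finally have "f x x \<noteq> 0" using height_radical[of x] by auto
    then have "f x x > 0" using psd[of x] by simp
    moreover have "f x x = (\<Sum>i\<in>J. c i * f (w i) x)"
      by (subst (1) x_def) (simp add: sum_left bilinear)
    ultimately obtain i where i: "i \<in> J" "c i * f (w i) x > 0"
    proof -
      have "\<exists>i\<in>J. c i * f (w i) x > 0"
      proof (rule ccontr)
        assume "\<not> ?thesis"
        then have "(\<Sum>i\<in>J. c i * f (w i) x) \<le> 0" by (intro sum_nonpos) (simp add: not_less)
        then show False using \<open>f x x > 0\<close> \<open>f x x = (\<Sum>i\<in>J. c i * f (w i) x)\<close> by simp
      qed
      then show ?thesis using that by blast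
    qed
    then have "c i > 0" "f (w i) x > 0" using nn by (auto simp: zero_less_mult_iff)
    moreover have "0 < f (w i) (w i) * (\<Sum>j\<in>J. of_int (cart (w i) (w j)) * c j)"
      unfolding fx[OF i(1), symmetric] using \<open>f (w i) x > 0\<close> by simp
    then have "(\<Sum>j\<in>J. of_int (cart (w i) (w j)) * c j) > 0"
      using rt(3)[OF i(1)] by (rule zero_less_mult_pos)
    ultimately show "\<exists>i\<in>J. 0 < c i \<and> 0 < (\<Sum>j\<in>J. of_int (cart (w i) (w j)) * c j)" using i by blast
  qed
  have diag: "cart (w i) (w i) = 2" if "i \<in> J" for i
    using m[OF that that] rt(3)[OF that] by simp
  have np': "cart (w i) (w j) \<le> 0" if "i \<in> J" "j \<in> J" "i \<noteq> j" for i j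
    using cart_sgn[OF rt(1) rt(1)] np that by (metis not_less)
  have z: "cart (w i) (w j) = 0 \<longleftrightarrow> cart (w j) (w i) = 0" if "i \<in> J" "j \<in> J" for i j
    using cart_zero rt(1) that sym by metis
  have "f (w i) (w i) * cart (w i) (w j) = f (w j) (w j) * cart (w j) (w i)" if "i \<in> J" "j \<in> J"
    for i j
    using m[OF that] m[OF that(2,1)] sym[of "w i" "w j"] by (simp add: mult.commute)
  then have "\<exists>d :: nat \<Rightarrow> real. \<forall>i\<in>J. d i > 0 \<and> (\<forall>j\<in>J. d i * cart (w i) (w j)
    = d j * cart (w j) (w i))"
    using rt(3) by (intro exI[of _ "\<lambda>i. f (w i) (w i)"]) blast
  then show ?thesis unfolding dynkin_def using fin diag np' z sub by blast
qed

text \<open>\<rho> i is the position of the base member proportional to member \<open>i\<close>, and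
  \<kappa> i is the factor. The factor 1/2 does not occur because the base takes the shortest member
  of each direction.\<close>

lemma dynkin_base:
  assumes conn: "connected_family n v" and n0: "0 < n"
  obtains w J \<rho> \<kappa> where "reach n v w" "root_family n w" "J \<subseteq> {..<n}" "J \<noteq> {}"
    "dynkin J (\<lambda>i j. cart (w i) (w j))" "linked J (\<lambda>i j. cart (w i) (w j))"
    "\<And>i. i < n \<Longrightarrow> \<rho> i \<in> J" "\<And>i. i \<in> J \<Longrightarrow> \<rho> i = i \<and> \<kappa> i = 1"
    "\<And>i. i < n \<Longrightarrow> \<kappa> i \<in> {1, 2} \<and> parallel (\<kappa> i) (w i) (w (\<rho> i))"
proof -
  obtain w where reach: "reach n v w" and r: "root_family n w" and h: "\<And>i. i < n \<Longrightarrow> height (w i) > 0"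
    and ac: "\<And>i j. i < n \<Longrightarrow> j < n \<Longrightarrow> i \<noteq> j \<Longrightarrow> f (w i) (w j) > 0 \<Longrightarrow>
       parallel 1 (w i) (w j) \<or> parallel 2 (w i) (w j) \<or> parallel 2 (w j) (w i)"
    using reduced_family by blast
  define N where "N i = f (w i) (w i)" for i
  have Npos: "N i > 0" if "i < n" for i using r that root_pos by (auto simp: root_family_def N_def)
  \<comment> \<open>One position per direction: a shortest member, and the first one among those of
    equal length. Members at an acute angle are exactly those with the same direction.\<close>
  define J where "J = {i. i < n \<and> (\<forall>k<n. f (w k) (w i) > 0 \<longrightarrow> N i < N k \<or> N i = N k \<and> i \<le> k)}"
  have J: "J \<subseteq> {..<n}" by (auto simp: J_def)
  have np: "f (w i) (w j) \<le> 0" if "i \<in> J" "j \<in> J" "i \<noteq> j" for i j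
  proof (rule ccontr)
    assume "\<not> f (w i) (w j) \<le> 0"
    then have "f (w i) (w j) > 0" "f (w j) (w i) > 0" using sym by (auto simp: not_le)
    then have "N i < N j \<or> N i = N j \<and> i \<le> j" "N j < N i \<or> N j = N i \<and> j \<le> i"
      using that by (auto simp: J_def)
    then show False using that(3) by auto
  qed
  have ex: "\<exists>j\<in>J. \<exists>c\<in>{1, 2}. parallel c (w i) (w j)" if i: "i < n" for i
  proof -
    define C where "C = {k. k < n \<and> f (w k) (w i) > 0}"
    have iC: "i \<in> C" "finite C" using i Npos by (auto simp: C_def N_def)
    define M where "M = Min (N ` C)"
    have "M \<in> N ` C" unfolding M_def by (rule Min_in) (use iC in auto)
    moreover have "\<And>k. k \<in> C \<Longrightarrow> M \<le> N k" using iC by (auto simp: M_def)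
    ultimately have M: "M \<in> N ` C" "\<And>k. k \<in> C \<Longrightarrow> M \<le> N k" by blast+
    define k where "k = (LEAST k. k \<in> C \<and> N k = M)"
    have ex: "\<exists>k. k \<in> C \<and> N k = M" using M(1) by auto
    have k: "k \<in> C" "N k = M" "\<And>k'. k' \<in> C \<Longrightarrow> N k' = M \<Longrightarrow> k \<le> k'"
      using LeastI_ex[OF ex] Least_le[of "\<lambda>k. k \<in> C \<and> N k = M"] by (auto simp: k_def)
    have kn: "k < n" "f (w k) (w i) > 0" using k(1) by (auto simp: C_def)
    have par: "(\<exists>c\<in>{1, 2}. parallel c (w i) (w k)) \<or> parallel 2 (w k) (w i)"
    proof (cases "k = i")
      case True then show ?thesis by auto
    next
      case False
      then show ?thesis using ac[of i k] kn i sym by auto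
    qed
    moreover have "\<not> parallel 2 (w k) (w i)"
    proof
      assume p: "parallel 2 (w k) (w i)"
      have "N k = 2 * (2 * N i)" using parallelD[OF p] by (simp add: N_def)
      then show False using M(2)[OF iC(1)] k(2) Npos[OF i] by simp
    qed
    ultimately obtain c where c: "c \<in> {1, 2}" "parallel c (w i) (w k)" by blast
    have "k \<in> J"
    proof -
      have "N k < N k' \<or> N k = N k' \<and> k \<le> k'" if "k' < n" "f (w k') (w k) > 0" for k'
      proof -
        have "f (w k') (w i) > 0" using parallelD(2)[OF c(2)] that(2) c(1) by auto
        then have "k' \<in> C" using that by (simp add: C_def)
        then show ?thesis using M(2)[of k'] k(2,3) by (metis less_eq_real_def)
      qed
      then show ?thesis using kn by (simp add: J_def)
    qed
    then show ?thesis using c by blast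
  qed
  have self: "j = i \<and> c = 1" if "i \<in> J" "j \<in> J" "c \<in> {1, 2}" "parallel c (w i) (w j)" for i j c
  proof -
    have n: "N i > 0" "N j > 0" using that Npos J by auto
    have "f (w i) (w j) = c * N j" using parallelD(1)[OF that(4)] by (simp add: N_def)
    then have "f (w i) (w j) > 0" using n that(3) by auto
    then have "j = i" using np[of i j] that by force
    moreover from this have "N i = c * N i" using parallelD(1)[OF that(4), of "w i"]
      by (simp add: N_def)
    ultimately show ?thesis using n by auto
  qed
  have "\<forall>i. \<exists>p. i < n \<longrightarrow> fst p \<in> J \<and> snd p \<in> {1, 2} \<and> parallel (snd p) (w i) (w (fst p))"
    using ex by (metis fst_conv snd_conv)
  then obtain g where g: "\<And>i. i < n \<Longrightarrow> fst (g i) \<in> J \<and> snd (g i) \<in> {1, 2} \<and>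
    parallel (snd (g i)) (w i) (w (fst (g i)))"
    by metis
  have gJ: "fst (g i) = i \<and> snd (g i) = 1" if "i \<in> J" for i
    using g[of i] self[of i "fst (g i)" "snd (g i)"] that J by auto
  have dyn: "dynkin J (\<lambda>i j. cart (w i) (w j))" using J r h np by (rule dynkin_of_obtuse)
  have rt: "root (w i)" if "i < n" for i using r that by (simp add: root_family_def)
  have "linked J (\<lambda>i j. cart (w i) (w j))"
    unfolding linked_def
  proof (intro allI impI)
    fix A assume A: "A \<subseteq> J" "A \<noteq> {}" "A \<noteq> J"
    \<comment> \<open>A cut of the base is pulled back to a cut of the whole family, which is
      connected; proportionality transfers the crossing pair to the base.\<close>
    define A' where "A' = {i. i < n \<and> fst (g i) \<in> A}"
    obtain a where a: "a \<in> A" using A by blast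
    obtain b where b: "b \<in> J" "b \<notin> A" using A by blast
    have "a \<in> A'" using a A J gJ[of a] by (auto simp: A'_def)
    moreover have "b \<in> {..<n} - A'" using b J gJ[of b] by (auto simp: A'_def)
    moreover have "A' \<subseteq> {..<n}" by (auto simp: A'_def)
    ultimately obtain i j where ij: "i \<in> A'" "j \<in> {..<n} - A'" "f (w i) (w j) \<noteq> 0"
      using connected_family_reach[OF reach conn] unfolding connected_family_def by blast
    then have lt: "i < n" "j < n" by (auto simp: A'_def)
    have "f (w i) (w j) = snd (g i) * (snd (g j) * f (w (fst (g i))) (w (fst (g j))))"
      using parallelD(1)[of "snd (g i)" "w i"] parallelD(2)[of "snd (g j)" "w j"] g lt by metis
    then have nz: "f (w (fst (g i))) (w (fst (g j))) \<noteq> 0" using ij(3) by auto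
    have "fst (g i) \<in> A" "fst (g j) \<in> J - A" using ij g lt by (auto simp: A'_def)
    then show "\<exists>i\<in>A. \<exists>j\<in>J - A. cart (w i) (w j) \<noteq> 0"
      using nz cart_zero rt A J by (meson DiffD1 lessThan_iff subsetD)
  qed
  moreover have "J \<noteq> {}" using ex[OF n0] by blast
  ultimately show ?thesis
    using that[OF reach r J _ dyn, of "\<lambda>i. fst (g i)" "\<lambda>i. snd (g i)"] g gJ by blast
qed

end

section \<open>Collecting the surplus roots\<close>

lemma map_of_chain:
  "map_of (chain a b) (p, q) = (if q = Suc p \<and> a \<le> p \<and> p < b then Some 1 else None)"
proof (induction b)
  case (Suc b)
  show ?case
  proof (cases "a \<le> b")
    case True
    then have "chain a (Suc b) = chain a b @ [((b, b + 1), 1)]" by (simp add: chain_def)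
    then show ?thesis using Suc True by (auto simp: map_add_def)
  qed (auto simp: chain_def)
qed (simp add: chain_def)

lemma entry_A:
  "1 \<le> p \<Longrightarrow> p \<le> l \<Longrightarrow> 1 \<le> q \<Longrightarrow> q \<le> l \<Longrightarrow> cartan_entry (diagram_A l r) p q = cartan_A p q"
  by (auto simp: cartan_entry_def diagram_A_def map_of_chain cartan_A_def)

lemma bonds_B:
  "map_of (bonds (diagram_B (Suc k) r s)) (p, q) =
     (if p = k \<and> q = Suc k then Some 2 else if q = Suc p \<and> 1 \<le> p \<and> p < k then Some 1 else None)"
  by (simp add: diagram_B_def map_of_chain map_add_def)

lemma entry_B:
  assumes "2 \<le> l" "1 \<le> p" "p \<le> l" "1 \<le> q" "q \<le> l"
  shows "cartan_entry (diagram_B l r s) p q = cartan_B l p q"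
proof -
  obtain k where "l = Suc k" using assms(1) by (cases l) auto
  then show ?thesis using assms by (simp add: cartan_entry_def bonds_B cartan_A_def cartan_B_def)
qed

lemma entry_C:
  assumes "2 \<le> l" "1 \<le> p" "p \<le> l" "1 \<le> q" "q \<le> l"
  shows "cartan_entry (diagram_C l r s) p q = cartan_C p q"
  using assms by (simp add: cartan_entry_def diagram_C_def map_of_chain cartan_A_def cartan_C_def)

lemma bonds_D:
  "map_of (bonds (diagram_D (k + 2) r)) (p, q) =
     (if p = k \<and> (q = k + 1 \<or> q = k + 2) \<or> q = Suc p \<and> 1 \<le> p \<and> p < k then Some 1 else None)"
  by (simp add: diagram_D_def map_of_chain map_add_def)

lemma entry_D:
  assumes "4 \<le> l" "1 \<le> p" "p \<le> l" "1 \<le> q" "q \<le> l"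
  shows "cartan_entry (diagram_D l r) p q = cartan_D l p q"
proof -
  have "l = (l - 2) + 2" using assms(1) by simp
  then obtain k where l: "l = k + 2" by blast
  have "p = k + 2 \<or> p \<le> k + 1" "q = k + 2 \<or> q \<le> k + 1" using assms l by auto
  then show ?thesis unfolding l
  proof (elim disjE)
    assume "p \<le> k + 1" "q \<le> k + 1"
    then have pq: "p \<noteq> k + 2" "q \<noteq> k + 2" by auto
    then have "cartan_D (k + 2) p q = cartan_A p q" by (simp add: cartan_D_def cartan_A_def)
    moreover have "map_of (bonds (diagram_D (k + 2) r)) (u, v)
      = (if v = Suc u then Some 1 else None)"
      if "1 \<le> u" "v \<le> k + 1" for u v
      using that by (auto simp: bonds_D[simplified])
    ultimately show "cartan_entry (diagram_D (k + 2) r) p q = cartan_D (k + 2) p q"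
      using assms \<open>p \<le> k + 1\<close> \<open>q \<le> k + 1\<close> by (simp add: cartan_entry_def cartan_A_def)
  next
    assume "p = k + 2" "q \<le> k + 1"
    then show "cartan_entry (diagram_D (k + 2) r) p q = cartan_D (k + 2) p q"
      by (simp add: cartan_entry_def bonds_D[simplified] cartan_D_def)
  next
    assume "p \<le> k + 1" "q = k + 2"
    then show "cartan_entry (diagram_D (k + 2) r) p q = cartan_D (k + 2) p q"
      by (simp add: cartan_entry_def bonds_D[simplified] cartan_D_def)
  next
    assume "p = k + 2" "q = k + 2"
    then show "cartan_entry (diagram_D (k + 2) r) p q = cartan_D (k + 2) p q"
      by (simp add: cartan_entry_def cartan_D_def)
  qed
qed

lemma entry_E:
  assumes "6 \<le> l" "1 \<le> p" "p \<le> l" "1 \<le> q" "q \<le> l"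
  shows "cartan_entry (diagram_E l r) p q = cartan_E p q"
  using assms by (simp add: cartan_entry_def diagram_E_def map_of_chain cartan_A_def cartan_E_def)

lemma entry_F:
  "1 \<le> p \<Longrightarrow> p \<le> 4 \<Longrightarrow> 1 \<le> q \<Longrightarrow> q \<le> 4 \<Longrightarrow> cartan_entry (diagram_F4 r s) p q = cartan_F p q"
  by (simp add: cartan_entry_def diagram_F4_def cartan_A_def cartan_F_def)

lemma entry_G:
  "1 \<le> p \<Longrightarrow> p \<le> 2 \<Longrightarrow> 1 \<le> q \<Longrightarrow> q \<le> 2 \<Longrightarrow> cartan_entry (diagram_G2 r s) p q = cartan_G p q"
  by (simp add: cartan_entry_def diagram_G2_def cartan_A_def cartan_G_def)

lemma bonds_BC:
  "2 \<le> l \<Longrightarrow> map_of (bonds (diagram_BC l r s t)) (p, q) =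
     (if p = 1 \<and> q = 2 \<or> p = l \<and> q = l + 1 then Some 2 else if q = Suc p \<and> 2 \<le> p \<and>
       p < l then Some 1 else None)"
  by (simp add: diagram_BC_def map_of_chain map_add_def)

text \<open>Without its node 1 the diagram is B_l with all numbers raised by one.\<close>

lemma entry_BC:
  assumes "2 \<le> l" "1 \<le> p" "p \<le> l" "1 \<le> q" "q \<le> l"
  shows "cartan_entry (diagram_BC l r s t) 1 (Suc q) = (if q = 1 then -1 else 0)"
    "cartan_entry (diagram_BC l r s t) (Suc p) 1 = (if p = 1 then -2 else 0)"
    "cartan_entry (diagram_BC l r s t) (Suc p) (Suc q) = cartan_B l p q"
  using assms by (simp_all add: cartan_entry_def bonds_BC cartan_A_def cartan_B_def)

text \<open>This will be applied to a simple root whose double is a root. At all other nodes the row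
  contains -1 or -3, and each case names a neighbour with such an entry.\<close>

lemma even_row:
  assumes t: "finite_type l P" and p: "1 \<le> p" "p \<le> l"
    and e: "\<And>q. 1 \<le> q \<Longrightarrow> q \<le> l \<Longrightarrow> q \<noteq> p \<Longrightarrow> even (P p q)"
  shows "p = l \<and> (l = 1 \<and> P = cartan_A \<or> 2 \<le> l \<and> P = cartan_B l)"
proof -
  have odd: False if "1 \<le> q" "q \<le> l" "q \<noteq> p" "odd (P p q)" for q using e that by blast
  show ?thesis
    using t
  proof cases
  case 1
  have "l = 1"
  proof (rule ccontr)
    assume "l \<noteq> 1"
    then consider "p < l" | "2 \<le> p" using p by linarith
    then show False
    proof cases
      case 1
      then have "even (P p (p + 1))" by (intro e) auto
      then show False by (simp add: \<open>P = cartan_A\<close> cartan_A_def)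
    next
      case 2
      then have "even (P p (p - 1))" using p by (intro e) auto
      moreover have "P p (p - 1) = -1" using 2 by (simp add: \<open>P = cartan_A\<close> cartan_A_def)
      ultimately show False by simp
    qed
  qed
  then show ?thesis using 1 p by simp
next
  case 2
  have "p = l"
  proof (rule ccontr)
    assume "p \<noteq> l"
    then show False using e[of "p + 1"] p 2 by (auto simp: cartan_A_def cartan_B_def)
  qed
  then show ?thesis using 2 by simp
next
  case 3
  consider "p \<le> 2" | "3 \<le> p" by linarith
  then have False
  proof cases
    case 1 then show ?thesis using p 3 by (intro odd[of "p + 1"]) (auto simp: cartan_A_def
      cartan_C_def)
  next
    case 2 then show ?thesis using p 3 by (intro odd[of "p - 1"]) (auto simp: cartan_A_def
      cartan_C_def)
  qed
  then show ?thesis ..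
next
  case 4
  consider "p = 1" | "2 \<le> p" "p < l" | "p = l" using p by linarith
  then have False
  proof cases
    case 1 then show ?thesis using 4 by (intro odd[of "p + 1"]) (auto simp: cartan_A_def
      cartan_D_def)
  next
    case 2 then show ?thesis using p 4 by (intro odd[of "p - 1"]) (auto simp: cartan_A_def
      cartan_D_def)
  next
    case 3 then show ?thesis using p 4 by (intro odd[of "p - 2"]) (auto simp: cartan_A_def
      cartan_D_def)
  qed
  then show ?thesis ..
next
  case 5
  then have l6: "6 \<le> l" by auto
  consider "p = 1" | "p = 2" | "p = 3" | "4 \<le> p" using p by linarith
  then have False
  proof cases
    case 1 then show ?thesis using l6 5 by (intro odd[of 3]) (auto simp: cartan_A_def cartan_E_def)
  next
    case 2 then show ?thesis using l6 5 by (intro odd[of 4]) (auto simp: cartan_A_def cartan_E_def)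
  next
    case 3 then show ?thesis using l6 5 by (intro odd[of 4]) (auto simp: cartan_A_def cartan_E_def)
  next
    case 4 then show ?thesis using p 5 by (intro odd[of "p - 1"]) (auto simp: cartan_A_def
      cartan_E_def)
  qed
  then show ?thesis ..
next
  case 6
  consider "p = 1" | "p = 2" | "p = 3" | "p = 4" using p 6 by linarith
  then have False
    by cases (use e[of 2] e[of 3] e[of 4] 6 in \<open>auto simp: cartan_A_def cartan_F_def\<close>)
  then show ?thesis ..
next
  case 7
  consider "p = 1" | "p = 2" using p 7 by linarith
  then have False
    by cases (use e[of 1] e[of 2] 7 in \<open>auto simp: cartan_A_def cartan_G_def\<close>)
  then show ?thesis ..
qed
qed

section \<open>Paths between simple roots of equal length\<close>

definition simple_edge :: "nat \<Rightarrow> (nat \<Rightarrow> nat \<Rightarrow> int) \<Rightarrow> nat \<Rightarrow> nat \<Rightarrow> bool" where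
  "simple_edge l P p q \<longleftrightarrow> 1 \<le> p \<and> p \<le> l \<and> 1 \<le> q \<and> q \<le> l \<and> P p q = -1 \<and> P q p = -1"

lemma simple_path_down:
  assumes "\<And>k. a \<le> k \<Longrightarrow> k < b \<Longrightarrow> simple_edge l P (Suc k) k" "a \<le> b"
  shows "(simple_edge l P)\<^sup>*\<^sup>* b a"
  using assms(2,1)
proof (induction b rule: dec_induct)
  case (step k)
  then have "simple_edge l P (Suc k) k" "(simple_edge l P)\<^sup>*\<^sup>* k a" by auto
  then show ?case by (rule converse_rtranclp_into_rtranclp)
qed simp

lemma simple_path_up:
  assumes "\<And>k. a \<le> k \<Longrightarrow> k < b \<Longrightarrow> simple_edge l P k (Suc k)" "a \<le> b"
  shows "(simple_edge l P)\<^sup>*\<^sup>* a b"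
  using assms(2,1)
proof (induction b rule: dec_induct)
  case (step k)
  then have "(simple_edge l P)\<^sup>*\<^sup>* a k" "simple_edge l P k (Suc k)" by auto
  then show ?case by (rule rtranclp.rtrancl_into_rtrancl)
qed simp

definition realized :: "nat \<Rightarrow> (nat \<Rightarrow> nat \<Rightarrow> int) \<Rightarrow> (nat \<Rightarrow> nat) \<Rightarrow> bool" where
  "realized l P m \<longleftrightarrow> (\<exists>D. modified_dynkin D \<and> nodes D = l \<and> (\<forall>p. 1 \<le> p \<and> p \<le> l \<longrightarrow> copies D p = m p) \<and>
     (\<forall>p q. 1 \<le> p \<and> p \<le> l \<and> 1 \<le> q \<and> q \<le> l \<longrightarrow> cartan_entry D p q = P p q))"

text \<open>One node \<open>\<tau> p\<close> for each root length receives all surplus roots of that length; simple edges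
  lead to it from every node of the same length.\<close>

lemma designated_nodes:
  assumes "finite_type l P"
  obtains \<tau> where "\<And>p. 1 \<le> p \<Longrightarrow> p \<le> l \<Longrightarrow> 1 \<le> \<tau> p \<and> \<tau> p \<le> l \<and> (simple_edge l P)\<^sup>*\<^sup>* p (\<tau> p)"
    "\<And>m. (\<And>p. 1 \<le> p \<Longrightarrow> p \<le> l \<Longrightarrow> 1 \<le> m p) \<Longrightarrow>
       (\<And>p. 1 \<le> p \<Longrightarrow> p \<le> l \<Longrightarrow> p \<notin> \<tau> ` {1..l} \<Longrightarrow> m p = 1) \<Longrightarrow>
       realized l P m"
  using assms
proof cases
  case 1
  show ?thesis
  proof (rule that[of "\<lambda>_. 1"])
    fix p assume p: "1 \<le> p" "p \<le> l"
    then have "(simple_edge l P)\<^sup>*\<^sup>* p 1"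
      by (intro simple_path_down) (auto simp: simple_edge_def 1 cartan_A_def)
    then show "1 \<le> (1::nat) \<and> 1 \<le> l \<and> (simple_edge l P)\<^sup>*\<^sup>* p 1" using 1 by simp
  next
    fix m assume m: "\<And>p. 1 \<le> p \<Longrightarrow> p \<le> l \<Longrightarrow> 1 \<le> m p"
      "\<And>p. 1 \<le> p \<Longrightarrow> p \<le> l \<Longrightarrow> p \<notin> (\<lambda>_. 1) ` {1..l} \<Longrightarrow> m p = (1 :: nat)"
    have mp: "m p = 1" if "1 \<le> p" "p \<le> l" "p \<noteq> 1" for p using m(2)[of p] that by auto
    have "modified_dynkin (diagram_A l (m 1))" using m(1) 1 by (intro modified_dynkin.intros) auto
    moreover have "copies (diagram_A l (m 1)) p = m p" if "1 \<le> p" "p \<le> l" for p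
      using mp[of p] that by (auto simp: diagram_A_def)
    moreover have "nodes (diagram_A l (m 1)) = l" by (simp add: diagram_A_def 1)
    moreover have "cartan_entry (diagram_A l (m 1)) p q = P p q" if "1 \<le> p" "p \<le> l" "1 \<le> q" "q
      \<le> l" for p q
      using entry_A that 1 by simp
    ultimately show "realized l P m"
      unfolding realized_def by (intro exI[of _ "diagram_A l (m 1)"]) simp
  qed
next
  case 2
  show ?thesis
  proof (rule that[of "\<lambda>p. if p = l then l else 1"])
    fix p assume p: "1 \<le> p" "p \<le> l"
    have "(simple_edge l P)\<^sup>*\<^sup>* p 1" if "p \<noteq> l"
      using p that by (intro simple_path_down) (auto simp: simple_edge_def 2 cartan_A_def
        cartan_B_def)
    then show "1 \<le> (if p = l then l else 1) \<and> (if p = l then l else 1) \<le> l \<and>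
      (simple_edge l P)\<^sup>*\<^sup>* p (if p = l then l else 1)" using 2 by simp
  next
    fix m assume m: "\<And>p. 1 \<le> p \<Longrightarrow> p \<le> l \<Longrightarrow> 1 \<le> m p"
      "\<And>p. 1 \<le> p \<Longrightarrow> p \<le> l \<Longrightarrow> p \<notin> (\<lambda>p. if p = l then l else 1) ` {1..l} \<Longrightarrow> m p = (1 :: nat)"
    have mp: "m p = 1" if "1 \<le> p" "p \<le> l" "p \<noteq> 1" "p \<noteq> l" for p using m(2)[of p] that by auto
    have "modified_dynkin (diagram_B l (m 1) (m l))" using m(1) 2
      by (intro modified_dynkin.intros) auto
    moreover have "copies (diagram_B l (m 1) (m l)) p = m p" if "1 \<le> p" "p \<le> l" for p
      using mp[of p] that by (auto simp: diagram_B_def)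
    moreover have "nodes (diagram_B l (m 1) (m l)) = l" by (simp add: diagram_B_def 2)
    moreover have "cartan_entry (diagram_B l (m 1) (m l)) p q = P p q" if "1 \<le> p" "p \<le> l" "1 \<le> q"
      "q \<le> l" for p q
      using entry_B that 2 by simp
    ultimately show "realized l P m"
      unfolding realized_def by (intro exI[of _ "diagram_B l (m 1) (m l)"]) simp
  qed
next
  case 3
  show ?thesis
  proof (rule that[of "\<lambda>p. if p = 1 then 1 else l"])
    fix p assume p: "1 \<le> p" "p \<le> l"
    have "(simple_edge l P)\<^sup>*\<^sup>* p l" if "p \<noteq> 1"
      using p that by (intro simple_path_up) (auto simp: simple_edge_def 3 cartan_A_def
        cartan_C_def)
    then show "1 \<le> (if p = 1 then 1 else l) \<and> (if p = 1 then 1 else l) \<le> l \<and>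
      (simple_edge l P)\<^sup>*\<^sup>* p (if p = 1 then 1 else l)" using 3 by simp
  next
    fix m assume m: "\<And>p. 1 \<le> p \<Longrightarrow> p \<le> l \<Longrightarrow> 1 \<le> m p"
      "\<And>p. 1 \<le> p \<Longrightarrow> p \<le> l \<Longrightarrow> p \<notin> (\<lambda>p. if p = 1 then 1 else l) ` {1..l} \<Longrightarrow> m p = (1 :: nat)"
    have mp: "m p = 1" if "1 \<le> p" "p \<le> l" "p \<noteq> 1" "p \<noteq> l" for p using m(2)[of p] that by auto
    have "modified_dynkin (diagram_C l (m 1) (m l))" using m(1) 3
      by (intro modified_dynkin.intros) auto
    moreover have "copies (diagram_C l (m 1) (m l)) p = m p" if "1 \<le> p" "p \<le> l" for p
      using mp[of p] that by (auto simp: diagram_C_def)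
    moreover have "nodes (diagram_C l (m 1) (m l)) = l" by (simp add: diagram_C_def 3)
    moreover have "cartan_entry (diagram_C l (m 1) (m l)) p q = P p q" if "1 \<le> p" "p \<le> l" "1 \<le> q"
      "q \<le> l" for p q
      using entry_C that 3 by simp
    ultimately show "realized l P m"
      unfolding realized_def by (intro exI[of _ "diagram_C l (m 1) (m l)"]) simp
  qed
next
  case 4
  show ?thesis
  proof (rule that[of "\<lambda>_. 1"])
    have path: "(simple_edge l P)\<^sup>*\<^sup>* p 1" if p: "1 \<le> p" "p < l" for p
      using p by (intro simple_path_down) (auto simp: simple_edge_def 4 cartan_A_def cartan_D_def)
    have "simple_edge l P l (l - 2)" using 4 by (auto simp: simple_edge_def cartan_D_def)
    moreover have "(simple_edge l P)\<^sup>*\<^sup>* (l - 2) 1" using path[of "l - 2"] 4 by auto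
    ultimately have "(simple_edge l P)\<^sup>*\<^sup>* l 1" by (rule converse_rtranclp_into_rtranclp)
    then show "1 \<le> (1::nat) \<and> 1 \<le> l \<and> (simple_edge l P)\<^sup>*\<^sup>* p 1" if "1 \<le> p" "p \<le> l" for p
      using path[of p] 4 that by (cases "p = l") auto
  next
    fix m assume m: "\<And>p. 1 \<le> p \<Longrightarrow> p \<le> l \<Longrightarrow> 1 \<le> m p"
      "\<And>p. 1 \<le> p \<Longrightarrow> p \<le> l \<Longrightarrow> p \<notin> (\<lambda>_. 1) ` {1..l} \<Longrightarrow> m p = (1 :: nat)"
    have mp: "m p = 1" if "1 \<le> p" "p \<le> l" "p \<noteq> 1" for p using m(2)[of p] that by auto
    have "modified_dynkin (diagram_D l (m 1))" using m(1) 4 by (intro modified_dynkin.intros) auto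
    moreover have "copies (diagram_D l (m 1)) p = m p" if "1 \<le> p" "p \<le> l" for p
      using mp[of p] that by (auto simp: diagram_D_def)
    moreover have "nodes (diagram_D l (m 1)) = l" by (simp add: diagram_D_def 4)
    moreover have "cartan_entry (diagram_D l (m 1)) p q = P p q" if "1 \<le> p" "p \<le> l" "1 \<le> q" "q
      \<le> l" for p q
      using entry_D that 4 by simp
    ultimately show "realized l P m"
      unfolding realized_def by (intro exI[of _ "diagram_D l (m 1)"]) simp
  qed
next
  case 5
  then have l6: "6 \<le> l" by auto
  show ?thesis
  proof (rule that[of "\<lambda>_. 1"])
    have e31: "simple_edge l P 3 1" and e24: "simple_edge l P 2 4"
      using 5 l6 by (auto simp: simple_edge_def cartan_E_def)
    have "(simple_edge l P)\<^sup>*\<^sup>* p 3" if p: "3 \<le> p" "p \<le> l" for p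
      using p by (intro simple_path_down) (auto simp: simple_edge_def 5 cartan_A_def cartan_E_def)
    then have path: "(simple_edge l P)\<^sup>*\<^sup>* p 1" if p: "3 \<le> p" "p \<le> l" for p
      using rtranclp.rtrancl_into_rtrancl[of "simple_edge l P" p 3 1] p e31 by simp
    have "(simple_edge l P)\<^sup>*\<^sup>* 4 1" using path[of 4] l6 by simp
    with e24 have "(simple_edge l P)\<^sup>*\<^sup>* 2 1" by (rule converse_rtranclp_into_rtranclp)
    then show "1 \<le> (1::nat) \<and> 1 \<le> l \<and> (simple_edge l P)\<^sup>*\<^sup>* p 1" if "1 \<le> p" "p \<le> l" for p
      using path[of p] l6 that by (cases "p = 1"; cases "p = 2") auto
  next
    fix m assume m: "\<And>p. 1 \<le> p \<Longrightarrow> p \<le> l \<Longrightarrow> 1 \<le> m p"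
      "\<And>p. 1 \<le> p \<Longrightarrow> p \<le> l \<Longrightarrow> p \<notin> (\<lambda>_. 1) ` {1..l} \<Longrightarrow> m p = (1 :: nat)"
    have mp: "m p = 1" if "1 \<le> p" "p \<le> l" "p \<noteq> 1" for p using m(2)[of p] that by auto
    have "modified_dynkin (diagram_E l (m 1))" using m(1) 5 by (intro modified_dynkin.intros) auto
    moreover have "copies (diagram_E l (m 1)) p = m p" if "1 \<le> p" "p \<le> l" for p
      using mp[of p] that by (auto simp: diagram_E_def)
    moreover have "nodes (diagram_E l (m 1)) = l" by (simp add: diagram_E_def 5)
    moreover have "cartan_entry (diagram_E l (m 1)) p q = P p q" if "1 \<le> p" "p \<le> l" "1 \<le> q" "q
      \<le> l" for p q
      using entry_E[OF l6] that 5 by simp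
    ultimately show "realized l P m"
      unfolding realized_def by (intro exI[of _ "diagram_E l (m 1)"]) simp
  qed
next
  case 6
  show ?thesis
  proof (rule that[of "\<lambda>p. if p \<le> 2 then 1 else 4"])
    fix p assume p: "1 \<le> p" "p \<le> l"
    have "(simple_edge l P)\<^sup>*\<^sup>* p 1" if "p \<le> 2"
      using p that by (intro simple_path_down) (auto simp: simple_edge_def 6 cartan_A_def
        cartan_F_def)
    moreover have "(simple_edge l P)\<^sup>*\<^sup>* p 4" if "\<not> p \<le> 2"
      using p that 6 by (intro simple_path_up) (auto simp: simple_edge_def cartan_A_def
        cartan_F_def)
    ultimately show "1 \<le> (if p \<le> 2 then 1 else 4 :: nat) \<and> (if p \<le> 2 then 1 else 4) \<le> l \<and>
      (simple_edge l P)\<^sup>*\<^sup>* p (if p \<le> 2 then 1 else 4)" using 6 by simp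
  next
    fix m assume m: "\<And>p. 1 \<le> p \<Longrightarrow> p \<le> l \<Longrightarrow> 1 \<le> m p"
      "\<And>p. 1 \<le> p \<Longrightarrow> p \<le> l \<Longrightarrow> p \<notin> (\<lambda>p. if p \<le> 2 then 1 else 4) ` {1..l} \<Longrightarrow> m p = (1 :: nat)"
    have m23: "m 2 = 1" "m 3 = 1" by (rule m(2); use 6 in auto)+
    have "modified_dynkin (diagram_F4 (m 1) (m 4))" using m(1) 6 by (intro modified_dynkin.intros)
      auto
    moreover have "copies (diagram_F4 (m 1) (m 4)) p = m p" if "1 \<le> p" "p \<le> 4" for p
    proof -
      have "p = 1 \<or> p = 2 \<or> p = 3 \<or> p = 4" using that by linarith
      then show ?thesis using m23 by (auto simp: diagram_F4_def)
    qed
    moreover have "nodes (diagram_F4 (m 1) (m 4)) = l" by (simp add: diagram_F4_def 6)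
    moreover have "cartan_entry (diagram_F4 (m 1) (m 4)) p q = P p q" if "1 \<le> p" "p \<le> l" "1 \<le> q"
      "q \<le> l" for p q
      using entry_F that 6 by simp
    ultimately show "realized l P m"
      using 6 unfolding realized_def by (intro exI[of _ "diagram_F4 (m 1) (m 4)"]) simp
  qed
next
  case 7
  show ?thesis
  proof (rule that[of id])
    fix m assume m: "\<And>p. 1 \<le> p \<Longrightarrow> p \<le> l \<Longrightarrow> 1 \<le> m p"
      "\<And>p. 1 \<le> p \<Longrightarrow> p \<le> l \<Longrightarrow> p \<notin> id ` {1..l} \<Longrightarrow> m p = (1 :: nat)"
    have "modified_dynkin (diagram_G2 (m 1) (m 2))" using m(1) 7 by (intro modified_dynkin.intros)
      auto
    moreover have "copies (diagram_G2 (m 1) (m 2)) p = m p" if "1 \<le> p" "p \<le> 2" for p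
    proof -
      have "p = 1 \<or> p = 2" using that by linarith
      then show ?thesis by (auto simp: diagram_G2_def)
    qed
    moreover have "nodes (diagram_G2 (m 1) (m 2)) = l" by (simp add: diagram_G2_def 7)
    moreover have "cartan_entry (diagram_G2 (m 1) (m 2)) p q = P p q" if "1 \<le> p" "p \<le> l" "1 \<le> q"
      "q \<le> l" for p q
      using entry_G that 7 by simp
    ultimately show "realized l P m"
      using 7 unfolding realized_def by (intro exI[of _ "diagram_G2 (m 1) (m 2)"]) simp
  qed (use 7 in auto)
qed

section \<open>Moving the surplus roots to their nodes\<close>

locale numbered_base = root_lattice f Q for f :: "'a::real_vector \<Rightarrow> 'a \<Rightarrow> real" and Q +
  fixes n :: nat and w :: "nat \<Rightarrow> 'a" and J :: "nat set" and l :: nat and P :: "nat \<Rightarrow> nat \<Rightarrow> int"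
    and g :: "nat \<Rightarrow> nat" and \<rho> :: "nat \<Rightarrow> nat" and \<kappa> :: "nat \<Rightarrow> real"
  assumes family: "root_family n w" and J: "J \<subseteq> {..<n}"
    and type: "finite_type l P" and g: "bij_betw g {1..l} J"
    and gram: "1 \<le> p \<Longrightarrow> p \<le> l \<Longrightarrow> 1 \<le> q \<Longrightarrow> q \<le> l \<Longrightarrow> cart (w (g p)) (w (g q)) = P p q"
    and \<rho>: "i < n \<Longrightarrow> \<rho> i \<in> J" "i \<in> J \<Longrightarrow> \<rho> i = i \<and> \<kappa> i = 1"
    and \<kappa>: "i < n \<Longrightarrow> \<kappa> i \<in> {1, 2} \<and> parallel (\<kappa> i) (w i) (w (\<rho> i))"
begin

definition b :: "nat \<Rightarrow> 'a" where
  "b p = w (g p)"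

definition node :: "nat \<Rightarrow> nat" where
  "node i = inv_into {1..l} g (\<rho> i)"

lemma g_mem: "1 \<le> p \<Longrightarrow> p \<le> l \<Longrightarrow> g p \<in> J"
  using g by (auto simp: bij_betw_def)

lemma g_node: "i < n \<Longrightarrow> g (node i) = \<rho> i"
  unfolding node_def by (rule f_inv_into_f) (use \<rho>(1) g in \<open>auto simp: bij_betw_def\<close>)

lemma node_range: "i < n \<Longrightarrow> 1 \<le> node i \<and> node i \<le> l"
proof -
  assume "i < n"
  then have "\<rho> i \<in> g ` {1..l}" using \<rho>(1) g by (simp add: bij_betw_def)
  then have "node i \<in> {1..l}" unfolding node_def by (rule inv_into_into)
  then show ?thesis by simp
qed

lemma node_g: "1 \<le> p \<Longrightarrow> p \<le> l \<Longrightarrow> node (g p) = p"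
  using \<rho>(2)[OF g_mem] g unfolding node_def by (simp add: bij_betw_def inv_into_f_f)

lemma node_parallel: "i < n \<Longrightarrow> parallel (\<kappa> i) (w i) (b (node i))"
  using \<kappa> by (simp add: b_def g_node)

lemma node_J: "i \<in> J \<Longrightarrow> g (node i) = i"
  using g_node \<rho>(2) J by (metis lessThan_iff subsetD)

lemma b_root: "1 \<le> p \<Longrightarrow> p \<le> l \<Longrightarrow> root (b p)"
  using g_mem J family by (auto simp: b_def root_family_def)

lemma b_gram: "1 \<le> p \<Longrightarrow> p \<le> l \<Longrightarrow> 1 \<le> q \<Longrightarrow> q \<le> l \<Longrightarrow> 2 * f (b p) (b q) = of_int (P p q) * f (b p) (b p)"
  using cart_mult[OF b_root rootQ[OF b_root], of p q] gram[of p q] by (simp add: b_def)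

text \<open>Surplus members agree with multiples of base roots only modulo the radical, so the end
  of a path is likewise compared by inner products.\<close>

definition lands :: "'a \<Rightarrow> 'a \<Rightarrow> bool" where
  "lands x y \<longleftrightarrow> (\<exists>t. orbit w J x t \<and> parallel 1 t y)"

lemma lands_self: "parallel 1 x y \<Longrightarrow> lands x y"
  unfolding lands_def by blast

lemma lands_refl: "lands x y \<Longrightarrow> 1 \<le> p \<Longrightarrow> p \<le> l \<Longrightarrow> lands x (refl (b p) y)"
proof -
  assume "lands x y" "1 \<le> p" "p \<le> l"
  then obtain t where t: "orbit w J x t" "parallel 1 t y" unfolding lands_def by blast
  have "orbit_step w J t (refl (b p) t)" using g_mem \<open>1 \<le> p\<close> \<open>p \<le> l\<close>
    by (auto simp: orbit_step_def b_def)
  with t(1) have "orbit w J x (refl (b p) t)" by (meson rtranclp.rtrancl_into_rtrancl)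
  then show ?thesis using parallel_refl_cong[OF t(2)] unfolding lands_def by blast
qed

lemma lands_minus: "lands x y \<Longrightarrow> lands x (- y)"
proof -
  assume "lands x y"
  then obtain t where t: "orbit w J x t" "parallel 1 t y" unfolding lands_def by blast
  have "orbit_step w J t (- t)" by (auto simp: orbit_step_def)
  with t(1) have "orbit w J x (- t)" by (meson rtranclp.rtrancl_into_rtrancl)
  then show ?thesis using parallel_minus_cong[OF t(2)] unfolding lands_def by blast
qed

lemma refl_b: "1 \<le> p \<Longrightarrow> p \<le> l \<Longrightarrow> 2 * f (b p) y = c * f (b p) (b p) \<Longrightarrow> refl (b p) y = y - c *\<^sub>R b p"
  using root_pos[OF b_root, of p] sym[of y "b p"] by (simp add: refl_def)

text \<open>Along a simple edge the reflection in \<open>b q\<close> takes \<open>b p\<close> to b p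
  + b q, and the reflection in \<open>b p\<close> takes this sum to \<open>b q\<close>.\<close>

lemma lands_edge:
  assumes "simple_edge l P p q" "lands x (b p)"
  shows "lands x (b q)"
proof -
  have r: "1 \<le> p" "p \<le> l" "1 \<le> q" "q \<le> l" "P p q = -1" "P q p = -1" using assms(1)
    by (auto simp: simple_edge_def)
  have 1: "refl (b q) (b p) = b p + b q"
    using refl_b[OF r(3,4), of "b p" "-1"] b_gram[OF r(3,4,1,2)] r(6) by simp
  have "2 * f (b p) (b p + b q) = 1 * f (b p) (b p)" using b_gram[OF r(1-4)] r(5)
    by (simp add: bilinear)
  then have "refl (b p) (b p + b q) = b q" using refl_b[OF r(1,2), of "b p + b q" 1] by simp
  then show ?thesis using lands_refl[OF lands_refl[OF assms(2) r(3,4)] r(1,2)] 1 by simp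
qed

lemma lands_path:
  assumes "(simple_edge l P)\<^sup>*\<^sup>* p q" "lands x (b p)"
  shows "lands x (b q)"
  using assms by (induction rule: rtranclp_induct) (auto intro: lands_edge)

lemma collect:
  assumes "\<And>i. i < n \<Longrightarrow> i \<notin> J \<Longrightarrow> lands (w i) (B (c i))" "\<And>i. i \<in> J \<Longrightarrow> parallel 1 (w i) (B (c i))"
  obtains w' where "reach n w w'" "\<And>i. i < n \<Longrightarrow> parallel 1 (w' i) (B (c i))"
proof -
  have "\<forall>i. \<exists>t. i < n \<and> i \<notin> J \<longrightarrow> orbit w J (w i) t \<and> parallel 1 t (B (c i))"
    using assms(1) unfolding lands_def by blast
  then obtain t where t: "\<And>i. i < n \<Longrightarrow> i \<notin> J \<Longrightarrow> orbit w J (w i) (t i) \<and> parallel 1 (t i) (B (c i))"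
    by metis
  have nz: "f (w i) (w i) \<noteq> 0" if "i < n" for i
    using family that root_pos[of "w i"] by (auto simp: root_family_def)
  have "reach n w (\<lambda>i. if i \<in> {..<n} - J then t i else w i)"
    using t nz by (intro reach_orbit[OF J]) auto
  then show ?thesis using that[of "\<lambda>i. if i \<in> {..<n} - J then t i else w i"] t assms(2) by auto
qed

lemma gram_transfer:
  assumes "parallel 1 x x'" "parallel 1 y y'" "2 * f x' y' = c * f x' x'"
  shows "2 * f x y = c * f x x"
proof -
  have "f x y = f x' y'" "f x x = f x' x'"
    using parallelD(1)[OF assms(1)] parallelD(2)[OF assms(1)] parallelD(2)[OF assms(2)] by simp_all
  then show ?thesis using assms(3) by simp
qed

text \<open>\<open>c i\<close> is the node of which member \<open>i\<close> is a copy. The order of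
  the members is left open; \<open>copy_list_permutation\<close> adjusts it to the order of the
  copies.\<close>

definition in_standard_form :: bool where
  "in_standard_form \<longleftrightarrow> (\<exists>D w' c. modified_dynkin D \<and> reach n w w' \<and> (\<forall>i<n. 1 \<le> c i \<and> c i \<le> nodes D) \<and>
     (\<forall>p. 1 \<le> p \<and> p \<le> nodes D \<longrightarrow> card {i. i < n \<and> c i = p} = copies D p) \<and>
     (\<forall>i<n. \<forall>j<n. 2 * f (w' i) (w' j) = of_int (cartan_entry D (c i) (c j)) * f (w' i) (w' i)))"

lemma card_fibre:
  assumes "k < n" "c k = p"
  shows "1 \<le> card {i. i < n \<and> c i = p}"
proof -
  have "{k} \<subseteq> {i. i < n \<and> c i = p}" using assms by auto
  then have "card {k} \<le> card {i. i < n \<and> c i = p}" by (intro card_mono) auto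
  then show ?thesis by simp
qed

lemma standard_form_reduced:
  assumes k: "\<And>i. i < n \<Longrightarrow> \<kappa> i = 1"
  shows in_standard_form
proof -
  obtain \<tau> where \<tau>: "\<And>p. 1 \<le> p \<Longrightarrow> p \<le> l \<Longrightarrow> 1 \<le> \<tau> p \<and> \<tau> p \<le> l \<and> (simple_edge l P)\<^sup>*\<^sup>* p (\<tau> p)"
    and D: "\<And>m. (\<And>p. 1 \<le> p \<Longrightarrow> p \<le> l \<Longrightarrow> 1 \<le> m p) \<Longrightarrow>
       (\<And>p. 1 \<le> p \<Longrightarrow> p \<le> l \<Longrightarrow> p \<notin> \<tau> ` {1..l} \<Longrightarrow> m p = 1) \<Longrightarrow>
       realized l P m"
    using designated_nodes[OF type] by blast
  \<comment> \<open>Base members keep their nodes and all others go to designated nodes, so every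
    node that is not designated has exactly one copy.\<close>
  define c where "c i = (if i \<in> J then node i else \<tau> (node i))" for i
  have c_range: "1 \<le> c i" "c i \<le> l" if "i < n" for i
    using node_range[OF that] \<tau>[of "node i"] by (auto simp: c_def)
  have par: "parallel 1 (w i) (b (node i))" if "i < n" for i using node_parallel[OF that]
    k[OF that] by simp
  obtain w' where w': "reach n w w'" "\<And>i. i < n \<Longrightarrow> parallel 1 (w' i) (b (c i))"
  proof (rule collect[of b c])
    fix i assume "i < n" "i \<notin> J"
    then show "lands (w i) (b (c i))"
      using lands_path[OF _ lands_self[OF par]] \<tau>[of "node i"] node_range[of i] by (simp add: c_def)
  next
    fix i assume "i \<in> J"
    then show "parallel 1 (w i) (b (c i))" using par J by (auto simp: c_def)
  qed (rule that)
  define m where "m p = card {i. i < n \<and> c i = p}" for p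
  have cg: "c (g p) = p" "g p < n" if "1 \<le> p" "p \<le> l" for p
    using that g_mem node_g J by (auto simp: c_def)
  have "1 \<le> m p" if "1 \<le> p" "p \<le> l" for p
    unfolding m_def using cg[OF that] by (intro card_fibre)
  moreover have "m p = 1" if p: "1 \<le> p" "p \<le> l" "p \<notin> \<tau> ` {1..l}" for p
  proof -
    have "i = g p" if i: "i < n" "c i = p" for i
    proof -
      have "i \<in> J" using p(3) i node_range[OF i(1)] by (auto simp: c_def split: if_splits)
      then show ?thesis using i node_J by (auto simp: c_def)
    qed
    then have "{i. i < n \<and> c i = p} = {g p}" using cg[OF p(1,2)] by blast
    then show ?thesis by (simp add: m_def)
  qed
  ultimately obtain D where D: "modified_dynkin D" "nodes D = l" "\<forall>p. 1 \<le> p \<and> p \<le> l \<longrightarrow> copies D p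
    = m p"
    "\<And>p q. 1 \<le> p \<and> p \<le> l \<and> 1 \<le> q \<and> q \<le> l \<Longrightarrow> cartan_entry D p q = P p q"
    using D[of m] unfolding realized_def by blast
  have "2 * f (w' i) (w' j) = of_int (cartan_entry D (c i) (c j)) * f (w' i) (w' i)" if "i < n"
    "j < n" for i j
    using gram_transfer[OF w'(2)[OF that(1)] w'(2)[OF that(2)] b_gram] c_range that D(4) by simp
  then show ?thesis unfolding in_standard_form_def using D w' c_range
    by (intro exI[of _ D] exI[of _ w'] exI[of _ c]) (auto simp: m_def)
qed

text \<open>A root which is twice another one forces type \<open>B\<close> (or rank one), and is moved to minus twice
  the sum of the base, the root attached to the long end in the diagram \<open>BC\<close>.\<close>

lemma doubled_end:
  assumes i: "i < n" "\<kappa> i = 2"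
  shows "node i = l \<and> (l = 1 \<and> P = cartan_A \<or> 2 \<le> l \<and> P = cartan_B l)"
proof (rule even_row[OF type])
  show p: "1 \<le> node i" "node i \<le> l" using node_range[OF i(1)] by auto
  fix q assume q: "1 \<le> q" "q \<le> l"
  let ?p = "node i"
  have par: "parallel 2 (w i) (b ?p)" using node_parallel[OF i(1)] i(2) by simp
  have rw: "root (w i)" using family i by (simp add: root_family_def)
  have m: "of_int (cart (w i) (b q)) * f (w i) (w i) = 2 * f (w i) (b q)"
    using cart_mult[OF rw rootQ[OF b_root[OF q]]] .
  have e: "f (w i) (w i) = 4 * f (b ?p) (b ?p)" "f (w i) (b q) = 2 * f (b ?p) (b q)"
    using parallelD[OF par] by simp_all
  \<comment> \<open>Row \<open>?p\<close> turns out to be twice the row of the doubled root, whose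
    entries are integers.\<close>
  have "of_int (2 * cart (w i) (b q)) * f (b ?p) (b ?p) = of_int (P ?p q) * f (b ?p) (b ?p)"
    using m b_gram[OF p q] unfolding e by simp
  then have "real_of_int (2 * cart (w i) (b q)) = of_int (P ?p q)"
    using root_pos[OF b_root[OF p]] by (simp only: mult_cancel_right) simp
  then have "P ?p q = 2 * cart (w i) (b q)" by linarith
  then show "even (P ?p q)" by simp
qed

lemma standard_form_doubled:
  assumes i0: "i0 < n" "\<kappa> i0 = 2"
  shows in_standard_form
proof -
  have l1: "1 \<le> l" and tP: "l = 1 \<and> P = cartan_A \<or> 2 \<le> l \<and> P = cartan_B l"
    using doubled_end[OF i0] node_range[OF i0(1)] by auto
  \<comment> \<open>The tail sums of the base lead from \<open>S l\<close>, the last simple root, to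
    \<open>S 1\<close>, the highest short root of B_l if l \<ge> 2. By \<open>fS\<close> the
    reflection in \<open>b p\<close> takes twice S (Suc p) to twice S p.\<close>
  define S where "S p = (\<Sum>q=p..l. b q)" for p
  have S_rec: "S p = b p + S (Suc p)" if "p \<le> l" for p
    unfolding S_def using that by (rule sum.atLeast_Suc_atMost)
  have S_l: "S l = b l" by (simp add: S_def)
  have edge: "P p (Suc p) = -1" if "1 \<le> p" "p < l" for p
    using tP that by (auto simp: cartan_A_def cartan_B_def)
  have zero: "P p q = 0" if "1 \<le> p" "Suc p < q" "q \<le> l" for p q
    using tP that by (auto simp: cartan_A_def cartan_B_def)
  have fS: "2 * f (b p) (S (Suc p)) = - f (b p) (b p)" if p: "1 \<le> p" "p < l" for p
  proof -
    have "f (b p) (S (Suc (Suc p))) = (\<Sum>q=Suc (Suc p)..l. f (b p) (b q))"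
      by (simp add: S_def sum_right)
    also have "\<dots> = 0"
    proof (rule sum.neutral, rule ballI)
      fix q assume "q \<in> {Suc (Suc p)..l}"
      then show "f (b p) (b q) = 0" using b_gram[of p q] zero[of p q] p by simp
    qed
    finally show ?thesis using b_gram[of p "Suc p"] edge[OF p] p S_rec[of "Suc p"]
      by (simp add: bilinear)
  qed
  have fS1: "2 * f (b p) (S 1) = (if p = 1 then (if l = 1 then 2 else 1) else 0) * f (b p) (b p)"
    if p: "1 \<le> p" "p \<le> l" for p
  proof -
    have step: "2 * f (b p) (S p) = (if p = l then 2 else 1) * f (b p) (b p)"
      using fS[of p] p S_rec[of p] S_l by (cases "p = l") (auto simp: bilinear)
    \<comment> \<open>On the way from S p down to S 1 only b (p - 1) is not orthogonal to
      \<open>b p\<close>, and it cancels what S p contributes. This leaves the attachment to node 1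
      alone.\<close>
    have "2 * f (b p) (S k) = 2 * f (b p) (S p) + (if k = p then 0 else if p = l then -2 else -1)
      * f (b p) (b p)"
      if k: "1 \<le> k" "k \<le> p" for k
      using k(2,1)
    proof (induction k rule: inc_induct)
      case (step k)
      have "P p k = (if Suc k = p then (if p = l then -2 else -1) else 0)"
        using tP step p by (auto simp: cartan_A_def cartan_B_def)
      then have "2 * f (b p) (b k) = (if Suc k = p then (if p = l then -2 else -1) else 0) * f
        (b p) (b p)"
        using b_gram[of p k] step p by simp
      then show ?case using step S_rec[of k] p by (auto simp: bilinear algebra_simps split:
        if_splits)
    qed simp
    from this[of 1] step p show ?thesis by (auto split: if_splits)
  qed
  \<comment> \<open>For l \<ge> 2 this makes the norm of 2 S 1 twice that of \<open>b 1\<close>, as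
    required of the longest root of BC.\<close>
  have SS: "2 * f (S 1) (S 1) = (if l = 1 then 2 else 1) * f (b 1) (b 1)"
  proof -
    have "2 * f (S 1) (S 1) = (\<Sum>p=1..l. 2 * f (b p) (S 1))"
      by (subst (1) S_def) (simp add: sum_left sum_distrib_left)
    also have "\<dots> = (\<Sum>p\<in>{1}. 2 * f (b p) (S 1))"
      using l1 fS1 by (intro sum.mono_neutral_right) auto
    finally show ?thesis using fS1[of 1] l1 by simp
  qed
  define B where "B p = (if p = 1 then - (2 *\<^sub>R S 1) else b (p - 1))" for p
  \<comment> \<open>In BC the base occupies the nodes from 2 on. A surplus root goes to node 1 if it
    is doubled, to node l + 1 if it is parallel to the short end with factor 1, and to node 2
    otherwise.\<close>
  define c where "c i = (if i \<in> J then Suc (node i) else if \<kappa> i = 2 then 1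
    else if node i = l then Suc l else 2)" for i
  have kJ: "\<kappa> i \<noteq> 2" if "i \<in> J" for i using \<rho>(2)[OF that] by simp
  have c_range: "1 \<le> c i" "c i \<le> Suc l" if "i < n" for i
    using node_range[OF that] l1 by (auto simp: c_def)
  obtain w' where w': "reach n w w'" "\<And>i. i < n \<Longrightarrow> parallel 1 (w' i) (B (c i))"
  proof (rule collect[of B c])
    fix i assume i: "i < n" "i \<notin> J"
    show "lands (w i) (B (c i))"
    proof (cases "\<kappa> i = 2")
      case True
      have "lands (w i) (2 *\<^sub>R S p)" if "p \<le> l" "1 \<le> p" for p
        using that
      proof (induction p rule: inc_induct)
        case base
        have "parallel 1 (w i) (2 *\<^sub>R b l)"
          using node_parallel[OF i(1)] True doubled_end[OF i(1) True]
            by (simp add: parallel_def scale_left)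
        then show ?case unfolding S_l by (rule lands_self)
      next
        case (step p)
        then have "lands (w i) (2 *\<^sub>R S (Suc p))" by simp
        moreover have "refl (b p) (2 *\<^sub>R S (Suc p)) = 2 *\<^sub>R S p"
          using refl_b[of p "2 *\<^sub>R S (Suc p)" "-2"] fS[of p] step S_rec[of p]
            by (simp add: scale_right scaleR_add_right)
        ultimately show ?case using lands_refl[of "w i" "2 *\<^sub>R S (Suc p)" p] step by simp
      qed
      then have "lands (w i) (2 *\<^sub>R S 1)" using l1 by simp
      then show ?thesis using True i by (simp add: c_def B_def lands_minus)
    next
      case False
      then have "\<kappa> i = 1" using \<kappa>[OF i(1)] by auto
      then have par: "parallel 1 (w i) (b (node i))" using node_parallel[OF i(1)] by simp
      show ?thesis
      proof (cases "node i = l")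
        case True
        then show ?thesis using lands_self[OF par] False i l1 by (simp add: c_def B_def)
      next
        case False
        have "(simple_edge l P)\<^sup>*\<^sup>* (node i) 1"
          using False node_range[OF i(1)] tP
          by (intro simple_path_down) (auto simp: simple_edge_def cartan_A_def cartan_B_def)
        then have "lands (w i) (b 1)" using lands_self[OF par] by (rule lands_path)
        then show ?thesis using False \<open>\<kappa> i = 1\<close> i by (simp add: c_def B_def)
      qed
    qed
  next
    fix i assume i: "i \<in> J"
    then have "i < n" using J by auto
    then show "parallel 1 (w i) (B (c i))"
      using node_parallel[of i] \<rho>(2)[OF i] i node_range[of i] by (simp add: c_def B_def)
  qed (rule that)
  define m where "m p = card {i. i < n \<and> c i = p}" for p
  have cg: "c (g p) = Suc p" "g p < n" if "1 \<le> p" "p \<le> l" for p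
    using that g_mem node_g J by (auto simp: c_def)
  have m_ge: "1 \<le> m p" if "1 \<le> p" "p \<le> Suc l" for p
  proof (cases "p = 1")
    case True
    have "c i0 = 1" using i0 kJ by (auto simp: c_def)
    then show ?thesis unfolding m_def using i0 True by (intro card_fibre) auto
  next
    case False
    then have "c (g (p - 1)) = p" "g (p - 1) < n" using cg[of "p - 1"] that by auto
    then show ?thesis unfolding m_def by (intro card_fibre)
  qed
  have m_one: "m p = 1" if p: "3 \<le> p" "p \<le> l" for p
  proof -
    have "i = g (p - 1)" if i: "i < n" "c i = p" for i
    proof -
      have "i \<in> J" "node i = p - 1" using p i by (auto simp: c_def split: if_splits)
      then show ?thesis using node_J by metis
    qed
    moreover have "c (g (p - 1)) = p" "g (p - 1) < n" using cg[of "p - 1"] p by auto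
    ultimately have "{i. i < n \<and> c i = p} = {g (p - 1)}" by blast
    then show ?thesis by (simp add: m_def)
  qed
  have split: "p = 1 \<or> (\<exists>p'. p = Suc p' \<and> 1 \<le> p' \<and> p' \<le> l)" if "1 \<le> p" "p \<le> Suc l" for p
    using that by (cases p) auto
  have gramB: "2 * f (B 1) (B 1) = 2 * f (B 1) (B 1)"
    "\<And>q. 1 \<le> q \<Longrightarrow> q \<le> l \<Longrightarrow> 2 * f (B 1) (B (Suc q)) = (if q = 1 then -1 else 0) * f (B 1) (B 1)"
    "\<And>p. 1 \<le> p \<Longrightarrow> p \<le> l \<Longrightarrow> 2 * f (B (Suc p)) (B 1) = (if p = 1 then (if l = 1 then -4 else -2) else
      0) * f (B (Suc p)) (B (Suc p))"
    "\<And>p q. 1 \<le> p \<Longrightarrow> p \<le> l \<Longrightarrow> 1 \<le> q \<Longrightarrow> q \<le> l \<Longrightarrow> 2 * f (B (Suc p)) (B (Suc q))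
      = of_int (P p q) * f (B (Suc p)) (B (Suc p))"
  proof -
    fix q assume q: "1 \<le> q" "q \<le> l"
    show "2 * f (B 1) (B (Suc q)) = (if q = 1 then -1 else 0) * f (B 1) (B 1)"
      using fS1[OF q] SS q sym[of "S 1" "b q"] by (auto simp: B_def bilinear)
  next
    fix p assume p: "1 \<le> p" "p \<le> l"
    show "2 * f (B (Suc p)) (B 1) = (if p = 1 then (if l = 1 then -4 else -2) else 0) * f
      (B (Suc p)) (B (Suc p))"
      using fS1[OF p] p by (auto simp: B_def bilinear)
  next
    fix p q assume "1 \<le> p" "p \<le> l" "1 \<le> q" "q \<le> l"
    then show "2 * f (B (Suc p)) (B (Suc q)) = of_int (P p q) * f (B (Suc p)) (B (Suc p))"
      using b_gram[of p q] by (simp add: B_def)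
  qed simp
  \<comment> \<open>In rank one the roots -2 b 1 and b 1 are proportional and form the quadruple
    bond of type A_2^(2).\<close>
  define D where "D = (if l = 1 then diagram_A1 (m 1) (m 2) else diagram_BC l (m 1) (m 2)
    (m (Suc l)))"
  have nodes: "nodes D = Suc l" by (simp add: D_def diagram_A1_def diagram_BC_def)
  have dyn: "modified_dynkin D"
    using m_ge[of 1] m_ge[of 2] m_ge[of "Suc l"] l1
      by (auto simp: D_def intro!: modified_dynkin.intros)
  have copies: "copies D p = m p" if p: "1 \<le> p" "p \<le> Suc l" for p
  proof (cases "l = 1")
    case True
    then have "p = 1 \<or> p = 2" using p by linarith
    then show ?thesis using True by (auto simp: D_def diagram_A1_def)
  next
    case False
    consider "p = 1" | "p = 2" | "3 \<le> p" "p \<le> l" | "p = Suc l" using p by linarith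
    then show ?thesis using False l1 m_one[of p] by cases (auto simp: D_def diagram_BC_def)
  qed
  have entries: "2 * f (B p) (B q) = of_int (cartan_entry D p q) * f (B p) (B p)"
    if p: "1 \<le> p" "p \<le> Suc l" and q: "1 \<le> q" "q \<le> Suc l" for p q
  proof (cases "l = 1")
    case True
    then have P: "P 1 1 = 2" using tP by (auto simp: cartan_A_def)
    have "p = 1 \<or> p = Suc 1" "q = 1 \<or> q = Suc 1" using True p q by auto
    then show ?thesis using gramB(2)[of 1] gramB(3)[of 1] gramB(4)[of 1 1] True P
      by (elim disjE) (simp_all add: D_def cartan_entry_def diagram_A1_def)
  next
    case False
    then have l2: "2 \<le> l" and P: "P = cartan_B l" using tP l1 by auto
    have d: "cartan_entry D 1 1 = 2" by (simp add: cartan_entry_def)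
    have e: "cartan_entry D 1 (Suc q') = (if q' = 1 then -1 else 0)"
      "cartan_entry D (Suc p') 1 = (if p' = 1 then -2 else 0)"
      "cartan_entry D (Suc p') (Suc q') = cartan_B l p' q'"
      if "1 \<le> p'" "p' \<le> l" "1 \<le> q'" "q' \<le> l" for p' q'
      using entry_BC[OF l2 that] False by (simp_all add: D_def)
    from split[OF p] split[OF q] show ?thesis
    proof (elim disjE exE conjE)
      assume "p = 1" "q = 1" then show ?thesis using d by simp
    next
      fix q' assume "p = 1" "q = Suc q'" "1 \<le> q'" "q' \<le> l"
      then show ?thesis using gramB(2)[of q'] e(1)[of q' q'] by simp
    next
      fix p' assume "q = 1" "p = Suc p'" "1 \<le> p'" "p' \<le> l"
      then show ?thesis using gramB(3)[of p'] e(2)[of p' p'] False by simp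
    next
      fix p' q' assume "p = Suc p'" "1 \<le> p'" "p' \<le> l" "q = Suc q'" "1 \<le> q'" "q' \<le> l"
      then show ?thesis using gramB(4)[of p' q'] e(3)[of p' q'] P by simp
    qed
  qed
  have "2 * f (w' i) (w' j) = of_int (cartan_entry D (c i) (c j)) * f (w' i) (w' i)" if "i < n"
    "j < n" for i j
    by (rule gram_transfer[OF w'(2)[OF that(1)] w'(2)[OF that(2)] entries])
      (use c_range that in auto)
  then show ?thesis unfolding in_standard_form_def using dyn w'(1) c_range copies nodes
    by (intro exI[of _ D] exI[of _ w'] exI[of _ c]) (auto simp: m_def)
qed

lemma standard_form: in_standard_form
proof (cases "\<exists>i<n. \<kappa> i = 2")
  case True then show ?thesis using standard_form_doubled by blast
next
  case False
  then have "\<kappa> i = 1" if "i < n" for i using \<kappa>[OF that] that by auto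
  then show ?thesis by (rule standard_form_reduced)
qed

end

theorem (in root_span) standard_family:
  assumes conn: "connected_family n v" and n0: "0 < n"
  obtains D w c where "modified_dynkin D" "reach n v w" "\<And>i. i < n \<Longrightarrow> 1 \<le> c i \<and> c i \<le> nodes D"
    "\<And>p. 1 \<le> p \<Longrightarrow> p \<le> nodes D \<Longrightarrow> card {i. i < n \<and> c i = p} = copies D p"
    "\<And>i j. i < n \<Longrightarrow> j < n \<Longrightarrow> 2 * f (w i) (w j) = of_int (cartan_entry D (c i) (c j)) * f (w i) (w i)"
proof -
  obtain w J \<rho> \<kappa> where w: "reach n v w" "root_family n w" "J \<subseteq> {..<n}" "J \<noteq> {}"
    "dynkin J (\<lambda>i j. cart (w i) (w j))" "linked J (\<lambda>i j. cart (w i) (w j))"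
    "\<And>i. i < n \<Longrightarrow> \<rho> i \<in> J" "\<And>i. i \<in> J \<Longrightarrow> \<rho> i = i \<and> \<kappa> i = 1"
    "\<And>i. i < n \<Longrightarrow> \<kappa> i \<in> {1, 2} \<and> parallel (\<kappa> i) (w i) (w (\<rho> i))"
    by (rule dynkin_base[OF conn n0], rule that)
  obtain l P g where t: "finite_type l P" "bij_betw g {1..l} J"
    "\<forall>p\<in>{1..l}. \<forall>q\<in>{1..l}. cart (w (g p)) (w (g q)) = P p q"
    using dynkin_classification[OF w(5,6,4)] unfolding has_finite_type_def numbered_def by blast
  interpret numbered_base f Q n w J l P g \<rho> \<kappa>
    by unfold_locales (use w t in auto)
  obtain D w' c where D: "modified_dynkin D" "reach n w w'" "\<forall>i<n. 1 \<le> c i \<and> c i \<le> nodes D"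
     "\<forall>p. 1 \<le> p \<and> p \<le> nodes D \<longrightarrow> card {i. i < n \<and> c i = p} = copies D p"
     "\<forall>i<n. \<forall>j<n. 2 * f (w' i) (w' j) = of_int (cartan_entry D (c i) (c j)) * f (w' i) (w' i)"
    using standard_form unfolding in_standard_form_def by blast
  have "reach n v w'" using w(1) D(2) by (rule rtranclp_trans)
  then show ?thesis using that[OF D(1)] D(3-5) by blast
qed

section \<open>Ranks and kernels\<close>

lemma mult_mat_vec_index:
  "A \<in> carrier_mat n n \<Longrightarrow> x \<in> carrier_vec n \<Longrightarrow> i < n \<Longrightarrow> (A *\<^sub>v x) $ i = (\<Sum>j<n. A $$ (i, j) * x $ j)"
  by (simp add: scalar_prod_def atLeast0LessThan)

lemma mat_kernel_iff:
  fixes A :: "'a::comm_ring_1 mat"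
  assumes "A \<in> carrier_mat n n"
  shows "x \<in> mat_kernel A \<longleftrightarrow> x \<in> carrier_vec n \<and> (\<forall>i<n. (\<Sum>j<n. A $$ (i, j) * x $ j) = 0)"
proof -
  have "A *\<^sub>v x = 0\<^sub>v n \<longleftrightarrow> (\<forall>i<n. (\<Sum>j<n. A $$ (i, j) * x $ j) = 0)" if "x \<in> carrier_vec n"
  proof
    assume "A *\<^sub>v x = 0\<^sub>v n"
    then show "\<forall>i<n. (\<Sum>j<n. A $$ (i, j) * x $ j) = 0"
      using mult_mat_vec_index[OF assms that] by auto
  next
    assume r: "\<forall>i<n. (\<Sum>j<n. A $$ (i, j) * x $ j) = 0"
    show "A *\<^sub>v x = 0\<^sub>v n"
      by (rule eq_vecI) (use assms r mult_mat_vec_index[OF assms that] in auto)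
  qed
  then show ?thesis using mat_kernel[OF assms] by auto
qed

lemma rank_plus_kernel_dim:
  fixes A :: "'a::field mat"
  assumes A: "A \<in> carrier_mat n n"
  shows "vec_space.rank n A + kernel.dim n A = n"
proof -
  interpret K: kernel n n A by unfold_locales (rule A)
  let ?V = "module_vec TYPE('a) n"
  have hom: "(\<lambda>v. A *\<^sub>v v) \<in> LinearCombinations.module_hom class_ring ?V ?V"
    unfolding LinearCombinations.module_hom_def using A
    by (auto simp: module_vec_simps mult_add_distrib_mat_vec[OF A] mult_mat_vec[OF A])
  have vs: "vectorspace class_ring ?V" by (rule vec_vs)
  interpret T: linear_map "class_ring :: 'a ring" ?V ?V "\<lambda>v. A *\<^sub>v v"
    unfolding linear_map_def mod_hom_def mod_hom_axioms_def
    using vs hom by (auto simp: vectorspace_def)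
  have im: "T.imT = LinearCombinations.module.span class_ring ?V (set (cols A))"
  proof -
    have "T.imT = K.NC.col_space A"
      unfolding T.im_def K.NC.col_space_eq[OF A] using A by (auto simp: module_vec_simps)
    then show ?thesis unfolding K.NC.col_space_def .
  qed
  have ker: "T.kerT = mat_kernel A"
    unfolding T.ker_def mat_kernel[OF A] by (simp add: module_vec_simps)
  have "vectorspace.dim class_ring (?V\<lparr>carrier := T.imT\<rparr>)
      + vectorspace.dim class_ring (?V\<lparr>carrier := T.kerT\<rparr>) = K.NC.dim"
    by (rule T.rank_nullity) (rule K.NC.fin_dim)
  then show ?thesis unfolding im ker K.NC.rank_def K.NC.dim_is_n by simp
qed

text \<open>A basis of the kernel is listed as coordinate functions \<open>c 0\<close>,
  \<open>c 1\<close>, ..., so that the form on the extended space can be defined by plain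
  sums.\<close>

lemma kernel_coordinates:
  fixes A :: "'a::field mat"
  assumes A: "A \<in> carrier_mat n n"
  obtains c :: "nat \<Rightarrow> nat \<Rightarrow> 'a" where
    "\<forall>k<kernel.dim n A. \<forall>i<n. (\<Sum>j<n. A $$ (i, j) * c k j) = 0"
    "\<forall>x. (\<forall>i<n. (\<Sum>j<n. A $$ (i, j) * x j) = 0) \<longrightarrow>
       (\<exists>y. \<forall>j<n. x j = (\<Sum>k<kernel.dim n A. y k * c k j))"
    "\<forall>y. (\<forall>j<n. (\<Sum>k<kernel.dim n A. y k * c k j) = 0) \<longrightarrow> (\<forall>k<kernel.dim n A. y k = 0)"
proof -
  interpret K: kernel n n A by unfold_locales (rule A)
  obtain B where B: "finite B" "K.basis B" using kernel_basis_exists[OF A] by blast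
  have BK: "B \<subseteq> mat_kernel A" and ind: "K.lin_indpt B" and gen: "K.span B = mat_kernel A"
    using B(2) unfolding K.Ker.basis_def by auto
  have d: "K.dim = card B" using K.Ker.dim_basis[OF B] .
  obtain h where h: "bij_betw h {..<K.dim} B" unfolding d
    using ex_bij_betw_nat_finite[OF B(1)] by (auto simp: atLeast0LessThan)
  have lc: "K.lincomb a B $ j = (\<Sum>k<K.dim. a (h k) * h k $ j)" if "j < n" for a j
    unfolding K.lincomb_index[OF that BK] using sum.reindex_bij_betw[OF h, of "\<lambda>x. a x * x $ j"]
      by simp
  have lc_dim: "K.lincomb a B \<in> carrier_vec n" for a
    using K.Ker.lincomb_closed[of B a] BK mat_kernel_carrier[OF A] by auto
  define c where "c k j = h k $ j" for k j
  show ?thesis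
  proof (rule that[of c]; intro allI impI)
    fix k i assume "k < K.dim" "i < n"
    then have "h k \<in> mat_kernel A" using h BK by (auto simp: bij_betw_def)
    then show "(\<Sum>j<n. A $$ (i, j) * c k j) = 0" using mat_kernel_iff[OF A] \<open>i < n\<close>
      by (simp add: c_def)
  next
    fix x assume x: "\<forall>i<n. (\<Sum>j<n. A $$ (i, j) * x j) = 0"
    have "vec n x \<in> mat_kernel A" unfolding mat_kernel_iff[OF A] using x by simp
    then have "vec n x \<in> K.span B" using gen by simp
    then have "\<exists>a. K.lincomb a B = vec n x"
      using K.Ker.finite_in_span[OF B(1), of "vec n x"] BK by blast
    then obtain a where "K.lincomb a B = vec n x" by blast
    then have "x j = (\<Sum>k<K.dim. a (h k) * c k j)" if "j < n" for j
      using lc[OF that, of a] that by (simp add: c_def)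
    then show "\<exists>y. \<forall>j<n. x j = (\<Sum>k<K.dim. y k * c k j)"
      by (intro exI[of _ "\<lambda>k. a (h k)"]) simp
  next
    fix y k assume y: "\<forall>j<n. (\<Sum>k<K.dim. y k * c k j) = 0" and k: "k < K.dim"
    define a where "a v = y (inv_into {..<K.dim} h v)" for v
    have ah: "a (h k) = y k" if "k < K.dim" for k
      using h that by (simp add: a_def bij_betw_def inv_into_f_f)
    have "K.lincomb a B = 0\<^sub>v n"
    proof (rule eq_vecI)
      fix j assume "j < dim_vec (0\<^sub>v n :: 'a vec)"
      then have j: "j < n" by simp
      have "K.lincomb a B $ j = (\<Sum>k<K.dim. y k * c k j)"
        unfolding lc[OF j] using ah by (intro sum.cong) (auto simp: c_def)
      then show "K.lincomb a B $ j = 0\<^sub>v n $ j" using y j by simp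
    qed (use lc_dim in auto)
    moreover have hk: "h k \<in> B" using h k by (auto simp: bij_betw_def)
    ultimately have "a (h k) = 0"
      using ind B(1) unfolding K.Ker.lin_dep_def by (metis subset_refl UNIV_I Pi_I)
    then show "y k = 0" using ah[OF k] by simp
  qed
qed

text \<open>Cartan matrices are Gram matrices with rescaled rows. The row factors do not affect
  kernels, so only kernels are compared; passing to the invertible coordinates \<open>W\<close>
  keeps their dimension, and with it the rank.\<close>

lemma rank_transform:
  fixes A N :: "'a::field mat" and W :: "nat \<Rightarrow> nat \<Rightarrow> 'a"
  assumes A: "A \<in> carrier_mat n n" and N: "N \<in> carrier_mat n n"
    and inj: "\<And>x. (\<And>k. k < n \<Longrightarrow> (\<Sum>i<n. x i * W i k) = 0) \<Longrightarrow> (\<And>i. i < n \<Longrightarrow> x i = 0)"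
    and ker: "\<And>x. (\<forall>i<n. (\<Sum>j<n. N $$ (i, j) * x j) = 0) \<longleftrightarrow>
       (\<forall>i<n. (\<Sum>k<n. A $$ (i, k) * (\<Sum>j<n. x j * W j k)) = 0)"
  shows "vec_space.rank n N = vec_space.rank n A"
proof -
  define B where "B = mat n n (\<lambda>(k, j). W j k)"
  have B: "B \<in> carrier_mat n n" by (simp add: B_def)
  have Bx: "(B *\<^sub>v x) $ k = (\<Sum>j<n. x $ j * W j k)" if "x \<in> carrier_vec n" "k < n" for x k
    unfolding mult_mat_vec_index[OF B that] using that(2)
    by (intro sum.cong) (auto simp: B_def mult.commute)
  have "det B \<noteq> 0"
  proof
    assume "det B = 0"
    then obtain x where x: "x \<in> carrier_vec n" "x \<noteq> 0\<^sub>v n" "B *\<^sub>v x = 0\<^sub>v n"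
      using det_0_iff_vec_prod_zero_field[OF B] by blast
    have "x $ i = 0" if "i < n" for i
      by (rule inj[of "\<lambda>i. x $ i", OF _ that]) (use Bx[OF x(1)] x(3) in auto)
    then have "x = 0\<^sub>v n" using x(1) by (intro eq_vecI) auto
    then show False using x(2) by simp
  qed
  from det_non_zero_imp_unit[OF B this, unfolded Units_def, of "()"]
  obtain C where C: "C \<in> carrier_mat n n" and BC: "B * C = 1\<^sub>m n" by (auto simp: ring_mat_def)
  have AB: "A * B \<in> carrier_mat n n" using A B by simp
  have "mat_kernel N = mat_kernel (A * B)"
  proof (rule Set.set_eqI)
    fix x
    show "x \<in> mat_kernel N \<longleftrightarrow> x \<in> mat_kernel (A * B)"
    proof (cases "x \<in> carrier_vec n")
      case True
      have Bxc: "B *\<^sub>v x \<in> carrier_vec n" using B True by simp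
      have "x \<in> mat_kernel (A * B) \<longleftrightarrow> B *\<^sub>v x \<in> mat_kernel A"
        unfolding mat_kernel[OF AB] mat_kernel[OF A] using A B True by auto
      also have "\<dots> \<longleftrightarrow> (\<forall>i<n. (\<Sum>k<n. A $$ (i, k) * (\<Sum>j<n. x $ j * W j k)) = 0)"
        unfolding mat_kernel_iff[OF A] using Bxc Bx[OF True] by simp
      also have "\<dots> \<longleftrightarrow> x \<in> mat_kernel N"
        unfolding mat_kernel_iff[OF N] using True ker[of "\<lambda>j. x $ j"] by simp
      finally show ?thesis by simp
    qed (use mat_kernel_carrier[OF N] mat_kernel_carrier[OF AB] in auto)
  qed
  moreover have "kernel.dim n (A * B) = kernel.dim n A"
    by (rule mat_kernel_dim_mult_eq_right[OF A B C BC])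
  ultimately have "kernel.dim n N = kernel.dim n A" by simp
  then show ?thesis using rank_plus_kernel_dim[OF A] rank_plus_kernel_dim[OF N] by simp
qed

section \<open>Realization of prime root systems\<close>

text \<open>Vectors will be functions on all of \<open>nat\<close>, a type that does not depend on
  \<open>n\<close>. The form ignores the coordinates from \<open>n\<close> on, which thus fall into
  its radical.\<close>

instantiation "fun" :: (type, real_vector) real_vector
begin

definition scaleR_fun :: "real \<Rightarrow> ('a \<Rightarrow> 'b) \<Rightarrow> 'a \<Rightarrow> 'b" where
  "scaleR_fun r g = (\<lambda>x. r *\<^sub>R g x)"

instance
  by standard (auto simp: scaleR_fun_def fun_eq_iff scaleR_add_right scaleR_add_left)

end

lemma count_replicate_blocks:
  "distinct ps \<Longrightarrow> count (mset (concat (map (\<lambda>p. replicate (k p) p) ps))) q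
    = (if q \<in> set ps then k q else 0)"
  by (induction ps) auto

lemma count_mset_filter: "count (mset xs) q = length (filter (\<lambda>x. q = x) xs)"
  by (induction xs) auto

text \<open>The labels \<open>c i\<close> and \<open>copy_list D\<close> agree as multisets because
  every node has the same number of copies in both.\<close>

lemma copy_list_permutation:
  assumes c: "\<And>i. i < n \<Longrightarrow> 1 \<le> c i \<and> c i \<le> nodes D"
    and k: "\<And>p. 1 \<le> p \<Longrightarrow> p \<le> nodes D \<Longrightarrow> card {i. i < n \<and> c i = p} = copies D p"
  obtains \<beta> where "\<beta> permutes {..<n}" "length (copy_list D) = n" "\<And>i. i < n \<Longrightarrow> copy_list D ! i
    = c (\<beta> i)"
proof -
  have cnt: "count (mset (map c [0..<n])) q = card {i. i < n \<and> c i = q}" for q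
  proof -
    have "count (mset (map c [0..<n])) q = length (filter (\<lambda>i. q = c i) [0..<n])"
      unfolding count_mset_filter by (simp add: filter_map o_def)
    also have "\<dots> = card {i. i < n \<and> c i = q}"
      by (subst length_filter_conv_card) (auto intro!: arg_cong[of _ _ card])
    finally show ?thesis .
  qed
  have "mset (copy_list D) = mset (map c [0..<n])"
  proof (rule multiset_eqI)
    fix q
    have "{i. i < n \<and> c i = q} = {}" if "\<not> (1 \<le> q \<and> q \<le> nodes D)" using c that by auto
    then show "count (mset (copy_list D)) q = count (mset (map c [0..<n])) q"
      unfolding copy_list_def cnt count_replicate_blocks[OF distinct_upt] using k[of q] by auto
  qed
  then obtain \<beta> where b: "\<beta> permutes {..<length (map c [0..<n])}" "permute_list \<beta> (map c [0..<n])
    = copy_list D"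
    by (rule mset_eq_permutation)
  have "copy_list D ! i = c (\<beta> i)" if "i < n" for i
  proof -
    have "\<beta> i < n" using permutes_in_image[OF b(1), of i] that by simp
    then show ?thesis unfolding b(2)[symmetric] using permute_list_nth[OF b(1)] that by simp
  qed
  moreover have "length (copy_list D) = n" unfolding b(2)[symmetric] by simp
  ultimately show ?thesis using that[of \<beta>] b(1) by simp
qed

section \<open>The form and the lattice of a symmetrized matrix\<close>

locale symmetrized_gim =
  fixes n :: nat and M :: "int mat" and s :: "nat \<Rightarrow> real"
  assumes M: "M \<in> carrier_mat n n"
    and diag: "i < n \<Longrightarrow> M $$ (i, i) = 2"
    and s_pos: "i < n \<Longrightarrow> s i > 0"
    and s_sym: "i < n \<Longrightarrow> j < n \<Longrightarrow> s i * of_int (M $$ (i, j)) = s j * of_int (M $$ (j, i))"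
    and s_psd: "0 \<le> (\<Sum>i<n. \<Sum>j<n. s i * of_int (M $$ (i, j)) * x i * x j)"
begin

text \<open>As the diagonal of \<open>M\<close> is 2, \<open>s i\<close> is half the square length
  of the root with index \<open>i\<close>.\<close>

definition G :: "nat \<Rightarrow> nat \<Rightarrow> real" where
  "G i j = s i * of_int (M $$ (i, j))"

definition f :: "(nat \<Rightarrow> real) \<Rightarrow> (nat \<Rightarrow> real) \<Rightarrow> real" where
  "f x y = (\<Sum>i<n. \<Sum>j<n. G i j * x i * y j)"

definition e :: "nat \<Rightarrow> nat \<Rightarrow> real" where
  "e j i = (if i = j then 1 else 0)"

definition Q :: "(nat \<Rightarrow> real) set" where
  "Q = {x. \<forall>i. x i \<in> \<int>}"

lemma G_sym: "i < n \<Longrightarrow> j < n \<Longrightarrow> G i j = G j i"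
  using s_sym by (simp add: G_def)

lemma f_sym: "f x y = f y x"
proof -
  have "f x y = (\<Sum>j<n. \<Sum>i<n. G i j * x i * y j)" unfolding f_def by (rule sum.swap)
  also have "\<dots> = f y x" unfolding f_def using G_sym by (intro sum.cong) (auto simp: mult_ac)
  finally show ?thesis .
qed

lemma f_e: "j < n \<Longrightarrow> f x (e j) = (\<Sum>i<n. G i j * x i)"
  unfolding f_def e_def by (intro sum.cong) (auto simp: if_distrib cong: if_cong)

lemma f_e_e: "i < n \<Longrightarrow> j < n \<Longrightarrow> f (e i) (e j) = G i j"
  by (simp add: f_e) (simp add: e_def if_distrib cong: if_cong)

lemma f_expand: "f x y = (\<Sum>j<n. y j * f x (e j))"
proof -
  have "f x y = (\<Sum>j<n. \<Sum>i<n. G i j * x i * y j)" unfolding f_def by (rule sum.swap)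
  also have "\<dots> = (\<Sum>j<n. y j * f x (e j))"
    by (intro sum.cong) (auto simp: f_e sum_distrib_left mult_ac)
  finally show ?thesis .
qed

sublocale root_lattice f Q
proof
  show "f x y = f y x" for x y by (rule f_sym)
  show "f (x + y) z = f x z + f y z" for x y z
    unfolding f_def sum.distrib[symmetric] by (intro sum.cong) (simp_all add: algebra_simps)
  show "f (c *\<^sub>R x) z = c * f x z" for c x z
    by (simp add: f_def scaleR_fun_def sum_distrib_left mult_ac)
  show "0 \<le> f x x" for x
    using s_psd[of x] by (simp add: f_def G_def)
  show "x - of_int m *\<^sub>R y \<in> Q" if "x \<in> Q" "y \<in> Q" for x y m
    using that by (auto simp: Q_def scaleR_fun_def fun_diff_def)
qed

lemma e_root: "j < n \<Longrightarrow> root (e j)"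
  unfolding root_def
proof (intro conjI ballI)
  assume j: "j < n"
  have jj: "f (e j) (e j) = 2 * s j" using j diag by (simp add: f_e_e G_def)
  show "e j \<in> Q" by (auto simp: Q_def e_def)
  show "0 < f (e j) (e j)" using jj s_pos[OF j] by simp
  fix u assume u: "u \<in> Q"
  have "f u (e j) = (\<Sum>i<n. s j * of_int (M $$ (j, i)) * u i)"
    unfolding f_e[OF j] using G_sym j by (intro sum.cong) (auto simp: G_def)
  also have "\<dots> = s j * (\<Sum>i<n. of_int (M $$ (j, i)) * u i)" by (simp add: sum_distrib_left mult_ac)
  finally have "2 * f u (e j) / f (e j) (e j) = (\<Sum>i<n. of_int (M $$ (j, i)) * u i)"
    unfolding jj using s_pos[OF j] by simp
  also have "\<dots> \<in> \<int>" using u by (auto simp: Q_def)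
  finally show "2 * f u (e j) / f (e j) (e j) \<in> \<int>" .
qed

sublocale root_span f Q n e
proof
  show "f x x = 0" if "x \<in> Q" "\<And>j. j < n \<Longrightarrow> f x (e j) = 0" for x
    using that by (subst f_expand) simp
qed (rule e_root)

text \<open>The last two conditions say that the matrix of the family is invertible over the complex
  numbers, by its trivial left and right kernels. The former gives linear independence of the roots,
  the latter the equality of ranks. A move is an invertible row operation.\<close>

definition admissible :: "(nat \<Rightarrow> nat \<Rightarrow> real) \<Rightarrow> bool" where
  "admissible w \<longleftrightarrow> (\<forall>i<n. f (w i) (w i) > 0) \<and>
     (\<forall>c :: nat \<Rightarrow> complex. (\<forall>k<n. (\<Sum>i<n. c i * of_real (w i k)) = 0) \<longrightarrow> (\<forall>i<n. c i = 0)) \<and>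
     (\<forall>y :: nat \<Rightarrow> complex. (\<forall>i<n. (\<Sum>k<n. of_real (w i k) * y k) = 0) \<longrightarrow> (\<forall>k<n. y k = 0))"

lemma admissible_independent:
  fixes c :: "nat \<Rightarrow> complex"
  assumes w: "admissible w" and c: "\<And>k. k < n \<Longrightarrow> (\<Sum>i<n. c i * of_real (w i k)) = 0" and i: "i < n"
  shows "c i = 0"
proof -
  have "(\<forall>k<n. (\<Sum>i<n. c i * of_real (w i k)) = 0) \<longrightarrow> (\<forall>i<n. c i = 0)"
    using w unfolding admissible_def by (elim conjE) (erule spec)
  then have "\<forall>i<n. c i = 0" by (rule mp) (use c in simp)
  with i show ?thesis by simp
qed

lemma admissible_complete:
  fixes y :: "nat \<Rightarrow> complex"
  assumes w: "admissible w" and y: "\<And>i. i < n \<Longrightarrow> (\<Sum>k<n. of_real (w i k) * y k) = 0" and k: "k < n"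
  shows "y k = 0"
proof -
  have "(\<forall>i<n. (\<Sum>k<n. of_real (w i k) * y k) = 0) \<longrightarrow> (\<forall>k<n. y k = 0)"
    using w unfolding admissible_def by (elim conjE) (erule spec)
  then have "\<forall>k<n. y k = 0" by (rule mp) (use y in simp)
  with k show ?thesis by simp
qed

lemma admissible_e: "admissible e"
  unfolding admissible_def
proof (intro conjI allI impI)
  show "f (e i) (e i) > 0" if "i < n" for i using root_pos[OF e_root[OF that]] .
  show "c i = 0" if "\<forall>k<n. (\<Sum>i<n. c i * of_real (e i k)) = 0" "i < n" for c :: "nat \<Rightarrow> complex" and i
  proof -
    have "(\<Sum>k<n. c k * of_real (e k i)) = (\<Sum>k<n. if k = i then c k else 0)"
      by (intro sum.cong) (auto simp: e_def)
    then show ?thesis using that by simp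
  qed
  show "y i = 0" if "\<forall>i<n. (\<Sum>k<n. of_real (e i k) * y k) = 0" "i < n" for y :: "nat \<Rightarrow> complex" and i
  proof -
    have "(\<Sum>k<n. of_real (e i k) * y k) = (\<Sum>k<n. if k = i then y k else 0)"
      by (intro sum.cong) (auto simp: e_def)
    then show ?thesis using that by simp
  qed
qed

lemma admissible_move:
  assumes "move n w w'" "admissible w"
  shows "admissible w'"
  using assms
proof (induction rule: move.induct)
  case (1 i j w)
  let ?w = "w(j := refl (w i) (w j))"
  define m where "m = 2 * f (w j) (w i) / f (w i) (w i)"
  have pos: "f (w k) (w k) > 0" if "k < n" for k using 1 that by (simp add: admissible_def)
  have wj: "?w j k = w j k - m * w i k" for k by (simp add: refl_def m_def fun_diff_def
    scaleR_fun_def)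
  have m2: "m = 2" if "i = j" using pos[OF 1(1)] that by (simp add: m_def)
  have split: "(\<Sum>k<n. g k) = g j + (\<Sum>k\<in>{..<n} - {j}. g k)" for g :: "nat \<Rightarrow> complex"
    using 1(2) by (intro sum.remove) auto
  show ?case
    unfolding admissible_def
  proof (intro conjI allI impI)
    fix k assume "k < n" then show "f (?w k) (?w k) > 0" using pos by (simp add: refl_isometry)
  next
    fix c :: "nat \<Rightarrow> complex" and i'
    assume c: "\<forall>k<n. (\<Sum>i<n. c i * of_real (?w i k)) = 0" and i': "i' < n"
    \<comment> \<open>These are the coefficients of the same combination in the old family: the
      reflection subtracts \<open>m\<close> times the coefficient at \<open>j\<close> from that at
      \<open>i\<close>. For i = j this is a sign change, as m = 2.\<close>
    define c' where "c' = (\<lambda>k. c k - (if k = i then c j * of_real m else 0))"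
    have "(\<Sum>k<n. c' k * of_real (w k q)) = (\<Sum>k<n. c k * of_real (?w k q))" for q
    proof -
      have "(\<Sum>k<n. c' k * of_real (w k q)) = (\<Sum>k<n. c k * of_real (w k q)) - (\<Sum>k<n. if k
        = i then c j * of_real m * of_real (w k q) else 0)"
        unfolding sum_subtractf[symmetric] by (intro sum.cong) (auto simp: c'_def algebra_simps)
      also have "(\<Sum>k<n. if k = i then c j * of_real m * of_real (w k q) else 0)
        = c j * of_real m * of_real (w i q)"
        using 1(1) by simp
      also have "(\<Sum>k<n. c k * of_real (w k q)) = c j * of_real (w j q) + (\<Sum>k\<in>{..<n} - {j}. c k *
        of_real (?w k q))"
        unfolding split[of "\<lambda>k. c k * of_real (w k q)"]
          by (intro arg_cong2[of _ _ _ _ "(+)"] sum.cong) auto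
      finally show ?thesis
        unfolding split[of "\<lambda>k. c k * of_real (?w k q)"] wj by (simp add: algebra_simps)
    qed
    then have c'0: "c' k = 0" if "k < n" for k using admissible_independent[OF 1(3), of c' k] c
      that by simp
    have cj: "c j = 0"
    proof (cases "i = j")
      case True
      then have "c j - c j * 2 = 0" using c'0[OF 1(2)] m2 by (simp add: c'_def)
      then show ?thesis by simp
    next
      case False
      then show ?thesis using c'0[OF 1(2)] by (simp add: c'_def)
    qed
    show "c i' = 0" using c'0[OF i'] cj by (simp add: c'_def split: if_splits)
  next
    fix y :: "nat \<Rightarrow> complex" and k
    assume y: "\<forall>i<n. (\<Sum>k<n. of_real (?w i k) * y k) = 0" and k: "k < n"
    have "(\<Sum>k<n. of_real (w q k) * y k) = 0" if q: "q < n" for q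
    proof (cases "q = j")
      case False
      then show ?thesis using y q by auto
    next
      case True
      have "(\<Sum>k<n. of_real (?w j k) * y k) = 0" using y 1(2) by blast
      then have z: "(\<Sum>k<n. of_real (w j k) * y k) - of_real m * (\<Sum>k<n. of_real (w i k) * y k) = 0"
        unfolding wj by (simp add: sum_subtractf sum_distrib_left algebra_simps)
      show ?thesis
      proof (cases "i = j")
        case ij: True
        then show ?thesis using z m2 True by simp
      next
        case ij: False
        then have "(\<Sum>k<n. of_real (w i k) * y k) = 0" using y 1(1) by auto
        then show ?thesis using z True by simp
      qed
    qed
    then show "y k = 0" using admissible_complete[OF 1(3), of y k] k by simp
  qed
qed

lemma admissible_reach: "reach n w w' \<Longrightarrow> admissible w \<Longrightarrow> admissible w'"
  by (induction rule: rtranclp_induct) (auto intro: admissible_move)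

abbreviation "Mc \<equiv> map_mat complex_of_int M"

lemma Mc: "Mc \<in> carrier_mat n n"
  using M by simp

lemma Mc_kernel:
  fixes x :: "nat \<Rightarrow> complex"
  assumes "i < n"
  shows "(\<Sum>j<n. Mc $$ (i, j) * x j) = 0 \<longleftrightarrow> (\<Sum>j<n. of_real (G i j) * x j) = 0"
proof -
  have "(\<Sum>j<n. of_real (G i j) * x j) = of_real (s i) * (\<Sum>j<n. Mc $$ (i, j) * x j)"
    unfolding sum_distrib_left using M assms by (intro sum.cong) (auto simp: G_def)
  then show ?thesis using s_pos[OF assms] by auto
qed

text \<open>The rank is n - d, so the dimension 2 n - rank required of the ambient space is n +
  d.\<close>

definition d :: nat where
  "d = kernel.dim n Mc"

lemma radical_basis:
  obtains c :: "nat \<Rightarrow> nat \<Rightarrow> complex" where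
    "\<forall>k<d. \<forall>i<n. (\<Sum>j<n. of_real (G i j) * c k j) = 0"
    "\<forall>x. (\<forall>i<n. (\<Sum>j<n. of_real (G i j) * x j) = 0) \<longrightarrow> (\<exists>y. \<forall>j<n. x j = (\<Sum>k<d. y k * c k j))"
    "\<forall>y. (\<forall>j<n. (\<Sum>k<d. y k * c k j) = 0) \<longrightarrow> (\<forall>k<d. y k = 0)"
proof -
  obtain c :: "nat \<Rightarrow> nat \<Rightarrow> complex" where c:
    "\<forall>k<d. \<forall>i<n. (\<Sum>j<n. Mc $$ (i, j) * c k j) = 0"
    "\<forall>x. (\<forall>i<n. (\<Sum>j<n. Mc $$ (i, j) * x j) = 0) \<longrightarrow> (\<exists>y. \<forall>j<n. x j = (\<Sum>k<d. y k * c k j))"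
    "\<forall>y. (\<forall>j<n. (\<Sum>k<d. y k * c k j) = 0) \<longrightarrow> (\<forall>k<d. y k = 0)"
    by (rule kernel_coordinates[OF Mc, folded d_def], rule that)
  have 1: "\<forall>k<d. \<forall>i<n. (\<Sum>j<n. of_real (G i j) * c k j) = 0" using c(1) Mc_kernel by simp
  have 2: "\<forall>x. (\<forall>i<n. (\<Sum>j<n. of_real (G i j) * x j) = 0) \<longrightarrow> (\<exists>y. \<forall>j<n. x j = (\<Sum>k<d. y k * c k j))"
    using c(2) Mc_kernel by simp
  show ?thesis by (rule that[OF 1 2 c(3)])
qed

end

section \<open>The ambient space of the prime root systems\<close>

locale extended_gim = symmetrized_gim +
  fixes rad :: "nat \<Rightarrow> nat \<Rightarrow> complex"
  assumes rad: "\<forall>k<d. \<forall>i<n. (\<Sum>j<n. of_real (G i j) * rad k j) = 0"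
    "\<forall>x. (\<forall>i<n. (\<Sum>j<n. of_real (G i j) * x j) = 0) \<longrightarrow> (\<exists>y. \<forall>j<n. x j = (\<Sum>k<d. y k * rad k j))"
    "\<forall>y. (\<forall>j<n. (\<Sum>k<d. y k * rad k j) = 0) \<longrightarrow> (\<forall>k<d. y k = 0)"
begin

abbreviation "V \<equiv> module_vec TYPE(complex) (n + d)"

text \<open>The degenerate form \<open>G\<close> on the first \<open>n\<close> coordinates is completed by pairing the last \<open>d\<close>
  coordinates with its radical. As \<open>G\<close> is real, taking conjugates of a basis of the radical makes
  the pairing on the radical the restriction of the standard Hermitian product.\<close>

definition form :: "complex vec \<Rightarrow> complex vec \<Rightarrow> complex" where
  "form u v = (\<Sum>i<n. \<Sum>j<n. of_real (G i j) * u $ i * v $ j) +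
     (\<Sum>i<n. \<Sum>k<d. cnj (rad k i) * (u $ i * v $ (n + k) + u $ (n + k) * v $ i))"

definition emb :: "(nat \<Rightarrow> real) \<Rightarrow> complex vec" where
  "emb x = vec (n + d) (\<lambda>k. if k < n then of_real (x k) else 0)"

lemma emb_carrier [simp]: "emb x \<in> carrier_vec (n + d)"
  by (simp add: emb_def)

lemma form_emb: "form (emb x) (emb y) = of_real (f x y)"
proof -
  have "(\<Sum>i<n. \<Sum>k<d. cnj (rad k i) * (emb x $ i * emb y $ (n + k) + emb x $ (n + k) * emb y $ i))
    = 0"
    by (intro sum.neutral ballI) (simp add: emb_def)
  moreover have "(\<Sum>i<n. \<Sum>j<n. of_real (G i j) * emb x $ i * emb y $ j) = of_real (f x y)"
    unfolding f_def of_real_sum by (intro sum.cong) (auto simp: emb_def)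
  ultimately show ?thesis by (simp add: form_def)
qed

lemma form_sym: "form u v = form v u"
proof -
  have "(\<Sum>i<n. \<Sum>j<n. of_real (G i j) * u $ i * v $ j) = (\<Sum>j<n. \<Sum>i<n. of_real (G i j) * u $ i * v $
    j)"
    by (rule sum.swap)
  also have "\<dots> = (\<Sum>i<n. \<Sum>j<n. of_real (G i j) * v $ i * u $ j)"
    using G_sym by (intro sum.cong) (auto simp: mult_ac)
  finally show ?thesis by (simp add: form_def algebra_simps)
qed

text \<open>Testing with the last unit vectors makes the first part of \<open>x\<close> Hermitian
  orthogonal to the radical (\<open>E1\<close>). Testing with the first ones gives G x + t = 0,
  where \<open>t\<close> is the conjugate of a radical vector (\<open>E2\<close>); as
  \<open>G\<close> kills that vector, \<open>t\<close> has norm 0. So the last coordinates vanish by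
  independence, the first part of \<open>x\<close> is radical, and \<open>E1\<close> makes its norm
  0.\<close>

lemma form_nondegenerate:
  assumes x: "x \<in> carrier_vec (n + d)" and z: "\<forall>y\<in>carrier_vec (n + d). form x y = 0"
  shows "x = 0\<^sub>v (n + d)"
proof -
  have E1: "(\<Sum>i<n. cnj (rad k i) * x $ i) = 0" if k: "k < d" for k
  proof -
    have 1: "(\<Sum>i<n. \<Sum>j<n. of_real (G i j) * x $ i * unit_vec (n + d) (n + k) $ j) = 0"
      using k by (intro sum.neutral ballI) (auto simp: unit_vec_def)
    have 2: "(\<Sum>i<n. \<Sum>k'<d. cnj (rad k' i) * (x $ i * unit_vec (n + d) (n + k) $ (n + k') + x $
      (n + k') * unit_vec (n + d) (n + k) $ i))
        = (\<Sum>i<n. \<Sum>k'<d. if k' = k then cnj (rad k i) * x $ i else 0)"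
      using k by (intro sum.cong) (auto simp: unit_vec_def)
    have "form x (unit_vec (n + d) (n + k)) = (\<Sum>i<n. cnj (rad k i) * x $ i)"
      unfolding form_def 1 2 using k by simp
    then show ?thesis using z by simp
  qed
  define t where "t j = (\<Sum>k<d. cnj (rad k j) * x $ (n + k))" for j
  have E2: "(\<Sum>i<n. of_real (G i j) * x $ i) + t j = 0" if j: "j < n" for j
  proof -
    have 1: "(\<Sum>i<n. \<Sum>j'<n. of_real (G i j') * x $ i * unit_vec (n + d) j $ j')
      = (\<Sum>i<n. of_real (G i j) * x $ i)"
    proof (intro sum.cong refl)
      fix i
      have "(\<Sum>j'<n. of_real (G i j') * x $ i * unit_vec (n + d) j $ j')
        = (\<Sum>j'<n. if j' = j then of_real (G i j) * x $ i else 0)"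
        using j by (intro sum.cong) (auto simp: unit_vec_def)
      then show "(\<Sum>j'<n. of_real (G i j') * x $ i * unit_vec (n + d) j $ j')
        = of_real (G i j) * x $ i" using j by simp
    qed
    have 2: "(\<Sum>i<n. \<Sum>k<d. cnj (rad k i) * (x $ i * unit_vec (n + d) j $ (n + k) + x $ (n + k) *
      unit_vec (n + d) j $ i))
        = (\<Sum>i<n. if i = j then t j else 0)"
      using j by (intro sum.cong) (auto simp: unit_vec_def t_def)
    have "form x (unit_vec (n + d) j) = (\<Sum>i<n. of_real (G i j) * x $ i) + t j"
      unfolding form_def 1 2 using j by simp
    then show ?thesis using z by simp
  qed
  have t_ker: "(\<Sum>j<n. of_real (G i j) * cnj (t j)) = 0" if i: "i < n" for i
  proof -
    have "(\<Sum>j<n. of_real (G i j) * cnj (t j)) = (\<Sum>j<n. \<Sum>k<d. of_real (G i j) * rad k j * cnj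
      (x $ (n + k)))"
      by (simp add: t_def sum_distrib_left mult_ac)
    also have "\<dots> = (\<Sum>k<d. \<Sum>j<n. of_real (G i j) * rad k j * cnj (x $ (n + k)))" by (rule sum.swap)
    also have "\<dots> = (\<Sum>k<d. (\<Sum>j<n. of_real (G i j) * rad k j) * cnj (x $ (n + k)))"
      by (simp add: sum_distrib_right)
    also have "\<dots> = 0" using rad(1) i by simp
    finally show ?thesis .
  qed
  have norm0: "\<forall>j<n. a j = 0" if "(\<Sum>j<n. cnj (a j) * a j) = 0" for a :: "nat \<Rightarrow> complex"
  proof -
    have "(\<Sum>j<n. cnj (a j) * a j) = of_real (\<Sum>j<n. (cmod (a j))\<^sup>2)"
      by (simp only: of_real_sum complex_norm_square mult.commute)
    then have "(\<Sum>j<n. (cmod (a j))\<^sup>2) = 0" using that by (metis of_real_eq_0_iff)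
    then show ?thesis by (simp add: sum_nonneg_eq_0_iff)
  qed
  have "(\<Sum>j<n. cnj (t j) * t j) = (\<Sum>j<n. cnj (t j) * - (\<Sum>i<n. of_real (G i j) * x $ i))"
  proof (intro sum.cong refl arg_cong2[of _ _ _ _ "(*)"])
    fix j assume "j \<in> {..<n}"
    then show "t j = - (\<Sum>i<n. of_real (G i j) * x $ i)"
      using E2[of j] by (simp add: eq_neg_iff_add_eq_0 add.commute)
  qed
  also have "\<dots> = - (\<Sum>j<n. \<Sum>i<n. cnj (t j) * of_real (G i j) * x $ i)"
    by (simp add: sum_negf sum_distrib_left mult_ac)
  also have "(\<Sum>j<n. \<Sum>i<n. cnj (t j) * of_real (G i j) * x $ i)
    = (\<Sum>i<n. \<Sum>j<n. cnj (t j) * of_real (G i j) * x $ i)"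
    by (rule sum.swap)
  also have "\<dots> = (\<Sum>i<n. (\<Sum>j<n. of_real (G i j) * cnj (t j)) * x $ i)"
    unfolding sum_distrib_right by (intro sum.cong refl) (simp add: mult_ac)
  also have "\<dots> = 0" using t_ker by simp
  finally have "(\<Sum>j<n. cnj (t j) * t j) = 0" by (simp only: minus_zero)
  then have t0: "\<forall>j<n. t j = 0" by (rule norm0)
  have "(\<Sum>k<d. cnj (x $ (n + k)) * rad k j) = 0" if "j < n" for j
  proof -
    have "(\<Sum>k<d. cnj (x $ (n + k)) * rad k j) = cnj (t j)" by (simp add: t_def mult_ac)
    then show ?thesis using t0 that by simp
  qed
  then have "\<forall>j<n. (\<Sum>k<d. cnj (x $ (n + k)) * rad k j) = 0" by blast
  moreover have "(\<forall>j<n. (\<Sum>k<d. cnj (x $ (n + k)) * rad k j) = 0) \<longrightarrow> (\<forall>k<d. cnj (x $ (n + k)) = 0)"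
    by (rule spec[OF rad(3)])
  ultimately have "\<forall>k<d. cnj (x $ (n + k)) = 0" by (rule mp[rotated])
  then have hi: "\<forall>k<d. x $ (n + k) = 0" by simp
  have "(\<Sum>i<n. of_real (G j i) * x $ i) = 0" if "j < n" for j
    using E2[OF that] t0 that G_sym by simp
  then have "\<forall>j<n. (\<Sum>i<n. of_real (G j i) * x $ i) = 0" by blast
  moreover have "(\<forall>j<n. (\<Sum>i<n. of_real (G j i) * x $ i) = 0) \<longrightarrow> (\<exists>y. \<forall>j<n. x $ j
    = (\<Sum>k<d. y k * rad k j))"
    by (rule spec[OF rad(2)])
  ultimately have "\<exists>y. \<forall>j<n. x $ j = (\<Sum>k<d. y k * rad k j)" by (rule mp[rotated])
  then obtain y where y: "\<And>j. j < n \<Longrightarrow> x $ j = (\<Sum>k<d. y k * rad k j)" by blast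
  have "(\<Sum>j<n. cnj (x $ j) * x $ j) = (\<Sum>j<n. \<Sum>k<d. cnj (y k) * cnj (rad k j) * x $ j)"
  proof (intro sum.cong refl)
    fix j assume "j \<in> {..<n}"
    then have "cnj (x $ j) = (\<Sum>k<d. cnj (y k) * cnj (rad k j))" using y[of j] by simp
    then show "cnj (x $ j) * x $ j = (\<Sum>k<d. cnj (y k) * cnj (rad k j) * x $ j)"
      by (simp add: sum_distrib_right)
  qed
  also have "\<dots> = (\<Sum>k<d. \<Sum>j<n. cnj (y k) * cnj (rad k j) * x $ j)" by (rule sum.swap)
  also have "\<dots> = (\<Sum>k<d. cnj (y k) * (\<Sum>j<n. cnj (rad k j) * x $ j))"
    by (simp add: sum_distrib_left mult_ac)
  also have "\<dots> = 0" using E1 by simp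
  finally have lo: "\<forall>j<n. x $ j = 0" by (rule norm0)
  show ?thesis
  proof (rule eq_vecI)
    fix i assume "i < dim_vec (0\<^sub>v (n + d) :: complex vec)"
    then have i: "i < n + d" by simp
    show "x $ i = 0\<^sub>v (n + d) $ i"
    proof (cases "i < n")
      case False
      then have "i = n + (i - n)" "i - n < d" using i by auto
      then have "x $ i = 0" using hi by metis
      then show ?thesis using i by simp
    qed (use lo i in simp)
  qed (use x in simp)
qed

lemma form_ok: "nondeg_symm_bilinear_form V form"
  unfolding nondeg_symm_bilinear_form_def module_vec_simps
proof (intro conjI ballI allI impI)
  fix x y z :: "complex vec" assume xy: "x \<in> carrier_vec (n + d)" "y \<in> carrier_vec (n + d)"
  show "form (x + y) z = form x z + form y z"
  proof -
    have "(\<Sum>i<n. \<Sum>j<n. of_real (G i j) * (x + y) $ i * z $ j) =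
        (\<Sum>i<n. \<Sum>j<n. of_real (G i j) * x $ i * z $ j) + (\<Sum>i<n. \<Sum>j<n. of_real (G i j) * y $ i * z $
          j)"
      unfolding sum.distrib[symmetric] using xy by (intro sum.cong) (simp_all add: algebra_simps)
    moreover have "(\<Sum>i<n. \<Sum>k<d. cnj (rad k i) * ((x + y) $ i * z $ (n + k) + (x + y) $ (n + k) * z
      $ i)) =
        (\<Sum>i<n. \<Sum>k<d. cnj (rad k i) * (x $ i * z $ (n + k) + x $ (n + k) * z $ i)) +
        (\<Sum>i<n. \<Sum>k<d. cnj (rad k i) * (y $ i * z $ (n + k) + y $ (n + k) * z $ i))"
      unfolding sum.distrib[symmetric] using xy by (intro sum.cong) (simp_all add: algebra_simps)
    ultimately show ?thesis by (simp add: form_def)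
  qed
next
  fix c and x y :: "complex vec" assume "x \<in> carrier_vec (n + d)"
  then show "form (c \<cdot>\<^sub>v x) y = c * form x y"
    by (simp add: form_def sum_distrib_left algebra_simps)
qed (use form_sym form_nondegenerate in auto)

lemma emb_refl: "reflection V form (emb a) (emb x) = emb (refl a x)"
proof -
  interpret U: vec_space "TYPE(complex)" "n + d" .
  have minus: "u \<ominus>\<^bsub>V\<^esub> v = u - v" if uv: "u \<in> carrier_vec (n + d)" "v \<in> carrier_vec (n + d)" for u v
  proof -
    have "\<ominus>\<^bsub>V\<^esub> v = - v"
      by (rule U.M.minus_equality) (use uv in auto)
    then show ?thesis using uv by (simp add: a_minus_def module_vec_simps minus_add_uminus_vec)
  qed
  have "2 * form (emb x) (emb a) / form (emb a) (emb a) = of_real (2 * f x a / f a a)"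
    by (simp add: form_emb)
  then have "reflection V form (emb a) (emb x) = emb x - of_real (2 * f x a / f a a) \<cdot>\<^sub>v emb a"
    unfolding reflection_def by (simp add: minus module_vec_simps)
  also have "\<dots> = emb (refl a x)"
    by (rule eq_vecI) (auto simp: emb_def refl_def fun_diff_def scaleR_fun_def)
  finally show ?thesis .
qed

lemma emb_inj:
  assumes "admissible w"
  shows "inj_on (\<lambda>i. emb (w i)) {..<n}"
proof (rule inj_onI)
  fix i j assume ij: "i \<in> {..<n}" "j \<in> {..<n}" "emb (w i) = emb (w j)"
  define c :: "nat \<Rightarrow> complex" where "c k = (if k = i then 1 else 0) - (if k = j then 1 else 0)"
    for k
  have "(\<Sum>k<n. c k * of_real (w k q)) = 0" if "q < n" for q
  proof -
    have "of_real (w i q) = (of_real (w j q) :: complex)"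
      using arg_cong[OF ij(3), of "\<lambda>v. v $ q"] that by (simp add: emb_def)
    moreover have "(\<Sum>k<n. c k * of_real (w k q)) = (\<Sum>k<n. if k = i then of_real (w k q) else 0) -
      (\<Sum>k<n. if k = j then of_real (w k q) else 0)"
      unfolding sum_subtractf[symmetric] by (intro sum.cong) (auto simp: c_def)
    ultimately show ?thesis using ij by simp
  qed
  then have "c i = 0" using admissible_independent[OF assms, of c i] ij(1) by simp
  then show "i = j" by (simp add: c_def split: if_splits)
qed

text \<open>Braid steps act on sets, moves on families. They correspond because admissible families
  have no repetitions, so removing \<open>emb (u j)\<close> affects only position
  \<open>j\<close>.\<close>

lemma reach_braid:
  assumes "reach n w w'" "admissible w"
  shows "(braid_step V form)\<^sup>*\<^sup>* ((\<lambda>i. emb (w i)) ` {..<n}) ((\<lambda>i. emb (w' i)) ` {..<n})"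
  using assms(1)
proof (induction rule: rtranclp_induct)
  case (step u u')
  have u: "admissible u" using admissible_reach[OF step(1) assms(2)] .
  from step(2) obtain i j where ij: "i < n" "j < n" "u' = u(j := refl (u i) (u j))"
    by (auto elim: move.cases)
  let ?R = "(\<lambda>i. emb (u i)) ` {..<n}"
  have "form (emb (u i)) (emb (u i)) \<noteq> 0" using u ij(1) by (auto simp: form_emb admissible_def)
  then have "braid_step V form ?R ((?R - {emb (u j)}) \<union> {reflection V
    form (emb (u i)) (emb (u j))})"
    using ij by (intro braid_step.intros) auto
  moreover have "(?R - {emb (u j)}) \<union> {reflection V form (emb (u i)) (emb (u j))}
    = (\<lambda>i. emb (u' i)) ` {..<n}"
  proof -
    have "?R - {emb (u j)} = (\<lambda>i. emb (u i)) ` ({..<n} - {j})"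
      using inj_on_image_set_diff[OF emb_inj[OF u], of "{..<n}" "{j}"] ij(2) by auto
    also have "\<dots> = (\<lambda>i. emb (u' i)) ` ({..<n} - {j})" using ij(3) by auto
    finally have "?R - {emb (u j)} = (\<lambda>i. emb (u' i)) ` ({..<n} - {j})" .
    moreover have "reflection V form (emb (u i)) (emb (u j)) = emb (u' j)" using ij(3)
      by (simp add: emb_refl)
    ultimately show ?thesis using ij(2) by auto
  qed
  ultimately have "braid_step V form ?R ((\<lambda>i. emb (u' i)) ` {..<n})" by (simp only:)
  then show ?case by (rule rtranclp.rtrancl_into_rtrancl[OF step(3)])
qed simp

lemma emb_independent:
  assumes "admissible w"
  shows "\<not> module.lin_dep class_ring V ((\<lambda>i. emb (w i)) ` {..<n})"
proof -
  interpret U: vec_space "TYPE(complex)" "n + d" .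
  let ?R = "(\<lambda>i. emb (w i)) ` {..<n}"
  have R: "?R \<subseteq> carrier_vec (n + d)" by auto
  show ?thesis
  proof (rule U.finite_lin_indpt2)
    fix a assume "U.lincomb a ?R = 0\<^sub>v (n + d)"
    then have lc: "(\<Sum>x\<in>?R. a x * x $ k) = 0" if "k < n" for k
      using U.lincomb_index[OF _ R, of k a] that by simp
    have "(\<Sum>i<n. a (emb (w i)) * of_real (w i k)) = 0" if k: "k < n" for k
      using lc[OF k] unfolding sum.reindex[OF emb_inj[OF assms]] using k by (simp add: emb_def)
    then have "a (emb (w i)) = 0" if "i < n" for i
      using admissible_independent[OF assms, of "\<lambda>i. a (emb (w i))" i] that by simp
    then show "\<forall>v\<in>?R. a v = 0" by auto
  qed (use R in auto)
qed

text \<open>The space was built for \<open>M\<close>, and its dimension fits \<open>N\<close> only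
  if the ranks agree. The rows of \<open>N\<close> are rescaled rows of the Gram matrix of
  \<open>w\<close>; as the right kernel of \<open>w\<close> is trivial, the kernel of that matrix is
  the kernel of \<open>G\<close> pulled back along the coefficients.\<close>

lemma prime_root_system_emb:
  assumes w: "admissible w" and b: "\<beta> permutes {..<n}" and N: "N \<in> carrier_mat n n"
    and entries: "\<And>i j. i < n \<Longrightarrow> j < n \<Longrightarrow> 2 * f (w (\<beta> i)) (w (\<beta> j)) = of_int (N $$ (i, j)) * f
      (w (\<beta> i)) (w (\<beta> i))"
  shows "prime_root_system V form N ((\<lambda>i. emb (w i)) ` {..<n})"
proof -
  interpret U: vec_space "TYPE(complex)" "n + d" .
  let ?Nc = "map_mat complex_of_int N"
  have \<beta>: "\<beta> i < n" if "i < n" for i using permutes_in_image[OF b, of i] that by simp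
  have bij: "bij_betw \<beta> {..<n} {..<n}" using b by (rule permutes_imp_bij)
  have pos: "f (w i) (w i) > 0" if "i < n" for i using w that by (simp add: admissible_def)
  have fw: "f (w p) (w q) = (\<Sum>k<n. w p k * (\<Sum>l<n. G k l * w q l))" for p q
    unfolding f_def by (simp add: sum_distrib_left mult_ac)
  have rank: "vec_space.rank n ?Nc = vec_space.rank n Mc"
  proof (rule rank_transform[OF Mc, of _ "\<lambda>j k. of_real (w (\<beta> j) k)"])
    show "?Nc \<in> carrier_mat n n" using N by simp
  next
    fix x :: "nat \<Rightarrow> complex" and i
    assume x: "\<And>k. k < n \<Longrightarrow> (\<Sum>i<n. x i * of_real (w (\<beta> i) k)) = 0" and i: "i < n"
    define x' where "x' p = x (inv_into {..<n} \<beta> p)" for p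
    have x'\<beta>: "x' (\<beta> i) = x i" if "i < n" for i
      using bij that by (simp add: x'_def bij_betw_def inv_into_f_f)
    have "(\<Sum>p<n. x' p * of_real (w p k)) = 0" if "k < n" for k
    proof -
      have "(\<Sum>p<n. x' p * of_real (w p k)) = (\<Sum>i<n. x' (\<beta> i) * of_real (w (\<beta> i) k))"
        using sum.reindex_bij_betw[OF bij, of "\<lambda>p. x' p * of_real (w p k)"] by simp
      then show ?thesis using x[OF that] x'\<beta> by simp
    qed
    then have "x' (\<beta> i) = 0" using admissible_independent[OF w, of x' "\<beta> i"] \<beta>[OF i] by simp
    then show "x i = 0" using x'\<beta>[OF i] by simp
  next
    fix x :: "nat \<Rightarrow> complex"
    define t where "t k = (\<Sum>j<n. x j * of_real (w (\<beta> j) k))" for k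
    define r where "r k = (\<Sum>l<n. of_real (G k l) * t l)" for k
    have Nx: "of_real (f (w (\<beta> i)) (w (\<beta> i))) * (\<Sum>j<n. ?Nc $$ (i, j) * x j)
      = 2 * (\<Sum>k<n. of_real (w (\<beta> i) k) * r k)"
      if i: "i < n" for i
    proof -
      have "of_real (f (w (\<beta> i)) (w (\<beta> i))) * (\<Sum>j<n. ?Nc $$ (i, j) * x j)
          = (\<Sum>j<n. of_real (of_int (N $$ (i, j)) * f (w (\<beta> i)) (w (\<beta> i))) * x j)"
        unfolding sum_distrib_left using N i by (intro sum.cong) (auto simp: mult_ac)
      also have "\<dots> = (\<Sum>j<n. of_real (2 * f (w (\<beta> i)) (w (\<beta> j))) * x j)"
        using entries[OF i] by (intro sum.cong) auto
      also have "\<dots> = (\<Sum>j<n. \<Sum>k<n. 2 * (of_real (w (\<beta> i) k) * (\<Sum>l<n. of_real (G k l) *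
        (x j * of_real (w (\<beta> j) l)))))"
        unfolding fw by (intro sum.cong refl) (simp add: sum_distrib_left sum_distrib_right mult_ac)
      also have "\<dots> = (\<Sum>k<n. \<Sum>j<n. 2 * (of_real (w (\<beta> i) k) * (\<Sum>l<n. of_real (G k l) *
        (x j * of_real (w (\<beta> j) l)))))"
        by (rule sum.swap)
      also have "\<dots> = (\<Sum>k<n. 2 * (of_real (w (\<beta> i) k) * r k))"
      proof (intro sum.cong refl)
        fix k
        have "r k = (\<Sum>l<n. \<Sum>j<n. of_real (G k l) * (x j * of_real (w (\<beta> j) l)))"
          by (simp add: r_def t_def sum_distrib_left)
        also have "\<dots> = (\<Sum>j<n. \<Sum>l<n. of_real (G k l) * (x j * of_real (w (\<beta> j) l)))"
          by (rule sum.swap)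
        finally show "(\<Sum>j<n. 2 * (of_real (w (\<beta> i) k) * (\<Sum>l<n. of_real (G k l) *
          (x j * of_real (w (\<beta> j) l)))))
            = 2 * (of_real (w (\<beta> i) k) * r k)" by (simp add: sum_distrib_left)
      qed
      also have "\<dots> = 2 * (\<Sum>k<n. of_real (w (\<beta> i) k) * r k)" by (rule sum_distrib_left[symmetric])
      finally show ?thesis .
    qed
    have "(\<forall>i<n. (\<Sum>j<n. ?Nc $$ (i, j) * x j) = 0) \<longleftrightarrow> (\<forall>i<n. (\<Sum>k<n. of_real (w (\<beta> i) k) * r k) = 0)"
    proof -
      have "(\<Sum>j<n. ?Nc $$ (i, j) * x j) = 0 \<longleftrightarrow> (\<Sum>k<n. of_real (w (\<beta> i) k) * r k) = 0" if i: "i < n"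
        for i
      proof -
        have nz: "of_real (f (w (\<beta> i)) (w (\<beta> i))) \<noteq> (0 :: complex)" using pos[OF \<beta>[OF i]] by simp
        have "(\<Sum>j<n. ?Nc $$ (i, j) * x j) = 0 \<longleftrightarrow> of_real (f (w (\<beta> i)) (w (\<beta> i))) *
          (\<Sum>j<n. ?Nc $$ (i, j) * x j) = 0"
          using nz by (simp only: mult_eq_0_iff) simp
        also have "\<dots> \<longleftrightarrow> (\<Sum>k<n. of_real (w (\<beta> i) k) * r k) = 0" unfolding Nx[OF i] by simp
        finally show ?thesis .
      qed
      then show ?thesis by blast
    qed
    also have "\<dots> \<longleftrightarrow> (\<forall>k<n. r k = 0)"
    proof
      assume h: "\<forall>i<n. (\<Sum>k<n. of_real (w (\<beta> i) k) * r k) = 0"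
      have p: "(\<Sum>k<n. of_real (w p k) * r k) = 0" if "p < n" for p
      proof -
        have "p \<in> \<beta> ` {..<n}" using bij that by (simp add: bij_betw_def)
        then obtain i where "i < n" "\<beta> i = p" by blast
        then show ?thesis using h by blast
      qed
      show "\<forall>k<n. r k = 0"
        by (intro allI impI, rule admissible_complete[OF w, of r]) (rule p)
    qed simp
    also have "\<dots> \<longleftrightarrow> (\<forall>i<n. (\<Sum>k<n. Mc $$ (i, k) * t k) = 0)"
      using Mc_kernel[of _ t] by (simp add: r_def)
    finally show "(\<forall>i<n. (\<Sum>j<n. ?Nc $$ (i, j) * x j) = 0) \<longleftrightarrow>
      (\<forall>i<n. (\<Sum>k<n. Mc $$ (i, k) * (\<Sum>j<n. x j * of_real (w (\<beta> j) k))) = 0)" by (simp add: t_def)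
  qed
  have dim: "n + d = 2 * dim_row N - vec_space.rank (dim_row N) ?Nc"
    using rank_plus_kernel_dim[OF Mc] N rank by (simp add: d_def)
  have inj: "bij_betw (\<lambda>i. emb (w i)) {..<n} ((\<lambda>i. emb (w i)) ` {..<n})"
    using emb_inj[OF w] by (simp add: bij_betw_def)
  have bij': "bij_betw (\<lambda>i. emb (w (\<beta> i))) {..<n} ((\<lambda>i. emb (w i)) ` {..<n})"
    using bij_betw_trans[OF bij inj] by (simp add: o_def)
  have ent: "2 * form (emb (w (\<beta> i))) (emb (w (\<beta> j))) / form (emb (w (\<beta> i))) (emb (w (\<beta> i)))
    = of_int (N $$ (i, j))"
    if "i < n" "j < n" for i j
  proof -
    have "2 * form (emb (w (\<beta> i))) (emb (w (\<beta> j))) / form (emb (w (\<beta> i))) (emb (w (\<beta> i)))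
        = of_real (2 * f (w (\<beta> i)) (w (\<beta> j)) / f (w (\<beta> i)) (w (\<beta> i)))" by (simp add: form_emb)
    also have "\<dots> = of_real (of_int (N $$ (i, j)))" unfolding entries[OF that]
      using pos[OF \<beta>[OF that(1)]] by simp
    finally show ?thesis by simp
  qed
  show ?thesis
    unfolding prime_root_system_def
  proof (intro conjI)
    show "vectorspace class_ring V" by (rule vec_vs)
    show "vectorspace.fin_dim class_ring V" by (rule U.fin_dim)
    show "vectorspace.dim class_ring V = 2 * dim_row N - vec_space.rank (dim_row N) ?Nc"
      by (rule trans[OF U.dim_is_n dim])
    show "nondeg_symm_bilinear_form V form" by (rule form_ok)
    show "(\<lambda>i. emb (w i)) ` {..<n} \<subseteq> carrier V" by (auto simp: module_vec_simps)
    show "\<not> module.lin_dep class_ring V ((\<lambda>i. emb (w i)) ` {..<n})" using w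
      by (rule emb_independent)
    show "\<exists>\<alpha>. bij_betw \<alpha> {..<dim_row N} ((\<lambda>i. emb (w i)) ` {..<n}) \<and>
      (\<forall>i<dim_row N. form (\<alpha> i) (\<alpha> i) \<in> \<real> \<and> Re (form (\<alpha> i) (\<alpha> i)) > 0) \<and>
      (\<forall>i<dim_row N. \<forall>j<dim_row N. 2 * form (\<alpha> i) (\<alpha> j) / form (\<alpha> i) (\<alpha> i) = of_int (N $$ (i, j)))"
      using bij' ent N pos \<beta> by (intro exI[of _ "\<lambda>i. emb (w (\<beta> i))"]) (auto simp: form_emb)
  qed
qed

theorem braid_equivalent_diagram:
  assumes conn: "connected_family n e" and n0: "0 < n"
  shows "\<exists>D. modified_dynkin D \<and> braid_equivalent M (intersection_matrix D)"
proof -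
  obtain D w c where D: "modified_dynkin D" and reach: "reach n e w"
    and c: "\<And>i. i < n \<Longrightarrow> 1 \<le> c i \<and> c i \<le> nodes D"
    "\<And>p. 1 \<le> p \<Longrightarrow> p \<le> nodes D \<Longrightarrow> card {i. i < n \<and> c i = p} = copies D p"
    and gram: "\<And>i j. i < n \<Longrightarrow> j < n \<Longrightarrow> 2 * f (w i) (w j) = of_int (cartan_entry D (c i) (c j)) * f
      (w i) (w i)"
    by (rule standard_family[OF conn n0], rule that)
  obtain \<beta> where b: "\<beta> permutes {..<n}" "length (copy_list D) = n" "\<And>i. i < n \<Longrightarrow> copy_list D ! i
    = c (\<beta> i)"
    by (rule copy_list_permutation[OF c], assumption+, rule that)
  have w: "admissible w" using admissible_reach[OF reach admissible_e] .
  have "prime_root_system V form M ((\<lambda>i. emb (e i)) ` {..<n})"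
  proof (rule prime_root_system_emb[OF admissible_e permutes_id M])
    fix i j assume "i < n" "j < n"
    then show "2 * f (e (id i)) (e (id j)) = of_int (M $$ (i, j)) * f (e (id i)) (e (id i))"
      using diag by (simp add: f_e_e G_def)
  qed
  moreover have "prime_root_system V form (intersection_matrix D) ((\<lambda>i. emb (w i)) ` {..<n})"
  proof (rule prime_root_system_emb[OF w b(1)])
    show "intersection_matrix D \<in> carrier_mat n n" using b(2) by (simp add: intersection_matrix_def)
    fix i j assume ij: "i < n" "j < n"
    then have "\<beta> i < n" "\<beta> j < n" using permutes_in_image[OF b(1)] by auto
    then show "2 * f (w (\<beta> i)) (w (\<beta> j)) = of_int (intersection_matrix D $$ (i, j)) * f (w (\<beta> i))
      (w (\<beta> i))"
      using gram ij b by (simp add: intersection_matrix_def)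
  qed
  moreover have "(braid_step V form)\<^sup>*\<^sup>* ((\<lambda>i. emb (e i)) ` {..<n}) ((\<lambda>i. emb (w i)) ` {..<n})"
    using reach admissible_e by (rule reach_braid)
  ultimately show ?thesis using D unfolding braid_equivalent_def by blast
qed

end

theorem theorem11:
  fixes n :: nat and M :: "int mat"
  assumes "n \<ge> 3"
    and "gim n M"
    and "symmetrizable n M"
    and "indecomposable n M"
    and "gim_positive_definite n M \<or> gim_positive_semidefinite n M"
  shows "\<exists>D. modified_dynkin D \<and> braid_equivalent M (intersection_matrix D)"
proof -
  have M: "M \<in> carrier_mat n n" and diag: "\<And>i. i < n \<Longrightarrow> M $$ (i, i) = 2"
    using assms(2) by (auto simp: gim_def)
  let ?Mr = "map_mat real_of_int M"
  obtain S where S: "symmetrizes n S M" and pos: "\<And>i. i < n \<Longrightarrow> S $$ (i, i) > 0"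
    and psd: "\<And>x. x \<in> carrier_vec n \<Longrightarrow> x \<bullet> ((S * ?Mr) *\<^sub>v x) \<ge> 0"
    using assms(5)
  proof
    assume "gim_positive_definite n M"
    then obtain S where S: "symmetrizes n S M" "\<forall>i<n. S $$ (i, i) > 0"
      "\<forall>x\<in>carrier_vec n. x \<noteq> 0\<^sub>v n \<longrightarrow> x \<bullet> ((S * ?Mr) *\<^sub>v x) > 0"
      unfolding gim_positive_definite_def by blast
    have SM: "S * ?Mr \<in> carrier_mat n n"
      by (rule mult_carrier_mat[of _ n n]) (use S(1) M in \<open>auto simp: symmetrizes_def\<close>)
    have "x \<bullet> ((S * ?Mr) *\<^sub>v x) \<ge> 0" if "x \<in> carrier_vec n" for x
    proof (cases "x = 0\<^sub>v n")
      case True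
      have "(S * ?Mr) *\<^sub>v x \<in> carrier_vec n" using SM that by simp
      then show ?thesis using True by simp
    next
      case False
      then show ?thesis using S(3) that by (simp add: less_imp_le)
    qed
    then show ?thesis using that[OF S(1)] S(2) by blast
  next
    assume "gim_positive_semidefinite n M"
    then show ?thesis using that unfolding gim_positive_semidefinite_def by blast
  qed
  have Sc: "S \<in> carrier_mat n n" and Sd: "diagonal_mat S"
    and St: "transpose_mat (S * ?Mr) = S * ?Mr" using S by (auto simp: symmetrizes_def)
  have SM: "S * ?Mr \<in> carrier_mat n n" using Sc M by simp
  have entry: "(S * ?Mr) $$ (i, j) = S $$ (i, i) * of_int (M $$ (i, j))" if "i < n" "j < n" for i j
  proof -
    have "(S * ?Mr) $$ (i, j) = (\<Sum>k<n. S $$ (i, k) * of_int (M $$ (k, j)))"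
      using that Sc M by (simp add: scalar_prod_def atLeast0LessThan)
    also have "\<dots> = (\<Sum>k<n. if k = i then S $$ (i, i) * of_int (M $$ (i, j)) else 0)"
      using Sd Sc that by (intro sum.cong) (auto simp: diagonal_mat_def)
    finally show ?thesis using that by simp
  qed
  \<comment> \<open>The diagonal of \<open>S\<close> provides the half square lengths.\<close>
  interpret symmetrized_gim n M "\<lambda>i. S $$ (i, i)"
  proof
    fix i j assume ij: "i < n" "j < n"
    have "(S * ?Mr) $$ (i, j) = (S * ?Mr) $$ (j, i)"
      by (metis St SM carrier_matD ij index_transpose_mat(1))
    then show "S $$ (i, i) * of_int (M $$ (i, j)) = S $$ (j, j) * of_int (M $$ (j, i))"
      using entry ij by simp
  next
    fix x :: "nat \<Rightarrow> real"
    have "0 \<le> vec n x \<bullet> ((S * ?Mr) *\<^sub>v vec n x)" by (rule psd) simp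
    also have "\<dots> = (\<Sum>i<n. x i * (\<Sum>j<n. (S * ?Mr) $$ (i, j) * x j))"
    proof -
      have "vec n x \<bullet> ((S * ?Mr) *\<^sub>v vec n x) = (\<Sum>i<n. vec n x $ i * ((S * ?Mr) *\<^sub>v vec n x) $ i)"
        unfolding scalar_prod_def by (simp only: dim_mult_mat_vec carrier_matD[OF SM]
          atLeast0LessThan)
      also have "\<dots> = (\<Sum>i<n. x i * (\<Sum>j<n. (S * ?Mr) $$ (i, j) * x j))"
        by (intro sum.cong refl) (simp add: mult_mat_vec_index[OF SM] del: index_mult_mat_vec)
      finally show ?thesis .
    qed
    also have "\<dots> = (\<Sum>i<n. \<Sum>j<n. S $$ (i, i) * of_int (M $$ (i, j)) * x i * x j)"
      unfolding sum_distrib_left using entry by (intro sum.cong) (auto simp: mult_ac)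
    finally show "0 \<le> (\<Sum>i<n. \<Sum>j<n. S $$ (i, i) * of_int (M $$ (i, j)) * x i * x j)" .
  qed (use M diag pos in auto)
  have "connected_family n e"
    unfolding connected_family_def
  proof (intro allI impI, rule ccontr)
    fix A assume A: "A \<subseteq> {..<n}" "A \<noteq> {}" "A \<noteq> {..<n}"
      and "\<not> (\<exists>i\<in>A. \<exists>j\<in>{..<n} - A. f (e i) (e j) \<noteq> 0)"
    then have z: "G i j = 0" if "i \<in> A" "j \<in> {..<n} - A" for i j
      using f_e_e[of i j] that by auto
    have "M $$ (i, j) = 0 \<and> M $$ (j, i) = 0" if "i \<in> A" "j \<in> {..<n} - A" for i j
    proof -
      have "i < n" "j < n" using that A by auto
      then have "M $$ (i, j) = 0" "M $$ (j, i) = 0"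
        using z[OF that] G_sym[of i j] pos[of i] pos[of j] by (auto simp: G_def)
      then show ?thesis by simp
    qed
    moreover have "{..<n} - A \<noteq> {}" "A \<inter> ({..<n} - A) = {}" "A \<union> ({..<n} - A) = {..<n}" using A
      by auto
    ultimately have "\<exists>I J. I \<noteq> {} \<and> J \<noteq> {} \<and> I \<inter> J = {} \<and> I \<union> J = {..<n} \<and>
        (\<forall>i\<in>I. \<forall>j\<in>J. M $$ (i, j) = 0 \<and> M $$ (j, i) = 0)"
      using A(2) by (intro exI[of _ A] exI[of _ "{..<n} - A"]) simp
    then show False using assms(4) unfolding indecomposable_def by (rule notE[rotated])
  qed
  moreover obtain c where "extended_gim n M (\<lambda>i. S $$ (i, i)) c"
    by (rule radical_basis, rule that, unfold_locales)
  ultimately show ?thesis using assms(1) by (intro extended_gim.braid_equivalent_diagram) auto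
qed

end
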